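(* Let $d\ge2$ and let $T$ be an ergodic group automorphism of $\mathbb T^d=\mathbb R^d/\mathbb Z^d$ induced by the integer matrix $S$. Let $r_u$ be the spectral radius of $S^{-1}_{|E_u}$, let $\rho_u\in(r_u,1)$ and $\zeta\in(\rho_u^{1/(3(d+2)(d_e+d_s))},1)$. There exist $C>0$, $N\ge0$, $\xi\in(0,1)$, a sequence of measurable sets $(\mathcal V_n)_{n\ge0}$ of $\mathbb T^d$ and a $\sigma$-algebra $\mathcal F_0$ on $\mathbb T^d$ such that $\mathcal F_0\subseteq T^{-1}\mathcal F_0$ and such that, for every bounded (measurable) function $\varphi:\mathbb T^d\to\mathbb R$ and every integer $n\ge N$, we have $$\|\mathbb E[\varphi|\mathcal F_n]-\varphi\|_\infty\le\omega_{(u)}(\varphi,\rho_u^n),$$ $$\text{on }\mathcal V_n,\quad|\mathbb E[\varphi|\mathcal F_{-n}]-\mathbb E[\varphi]|\le C\big(\|\varphi\|_\infty\xi^n+\omega_{(s,e)}(\varphi,\zeta^n)\big),$$ and $$\bar\lambda(\mathbb T^d\setminus\mathcal V_n)\le C\xi^n,$$ where $\mathcal F_k:=T^{-k}\mathcal F_0$ for every $k\in\mathbb Z$.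
   Context: $\bar\lambda$ is the Lebesgue (Haar) probability measure on $\mathbb T^d$; expectations and conditional expectations are with respect to $\bar\lambda$. $\bar x$ denotes the class in $\mathbb T^d$ of $x\in\mathbb R^d$. $T$ is the quotient map of $x\mapsto S\cdot x$, where $S$ is a $d\times d$ integer matrix of determinant $\pm1$; ergodicity is equivalent to no eigenvalue of $S$ being a root of unity. $E_u,E_e,E_s$ are the $S$-stable subspaces of $\mathbb R^d$ associated to the eigenvalues of $S$ of modulus respectively $>1$, $=1$, $<1$, of dimensions $d_u,d_e,d_s$. Fix a basis $v_1,\dots,v_d$ of $\mathbb R^d$ with $v_1,\dots,v_{d_u}\in E_u$, $v_{d_u+1},\dots,v_{d_u+d_e}\in E_e$, $v_{d_u+d_e+1},\dots,v_d\in E_s$ and $\det(v_1|\cdots|v_d)=1$, and the norm $\|\sum_ix_iv_i\|=\max_i|x_i|$. For $*\in\{u,e,s\}$, $B_*(\delta)=\{y\in E_*:\|y\|\le\delta\}$. For $\varphi:\mathbb T^d\to\mathbb R$ and $\delta>0$: $\omega_{(u)}(\varphi,\delta)=\sup\{|\varphi(\bar x)-\varphi(\bar x+\overline{h_u})|:\bar x\in\mathbb T^d,\ h_u\in B_u(\delta)\}$, and $\omega_{(s,e)}(\varphi,\delta)=\sup\{|\varphi(\bar x)-\varphi(\bar x+\overline{h_s}+\overline{h_e})|:\bar x\in\mathbb T^d,\ h_s\in B_s(\delta),\ h_e\in B_e(\delta)\}$. Relations between conditional expectations are understood almost everywhere. *)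

theory Defs
  imports "HOL-Probability.Probability"
begin

subsection \<open>The torus\<close>

quotient_type (overloaded) 'n torus = "real^'n::finite" / "\<lambda>x y. \<forall>i. x $ i - y $ i \<in> \<int>"
proof (rule equivpI)
  show "reflp (\<lambda>x y :: real^'n. \<forall>i. x $ i - y $ i \<in> \<int>)"
    by (auto intro: reflpI)
  show "symp (\<lambda>x y :: real^'n. \<forall>i. x $ i - y $ i \<in> \<int>)"
  proof (rule sympI, rule allI)
    fix x y :: "real^'n" and i
    assume "\<forall>i. x $ i - y $ i \<in> \<int>"
    then have "- (x $ i - y $ i) \<in> \<int>" by (blast intro: Ints_minus)
    then show "y $ i - x $ i \<in> \<int>" by simp
  qed
  show "transp (\<lambda>x y :: real^'n. \<forall>i. x $ i - y $ i \<in> \<int>)"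
  proof (rule transpI, rule allI)
    fix x y z :: "real^'n" and i
    assume "\<forall>i. x $ i - y $ i \<in> \<int>" "\<forall>i. y $ i - z $ i \<in> \<int>"
    then have "(x $ i - y $ i) + (y $ i - z $ i) \<in> \<int>" by (blast intro: Ints_add)
    then show "x $ i - z $ i \<in> \<int>" by simp
  qed
qed

instantiation torus :: (finite) ab_group_add
begin

lift_definition zero_torus :: "'a torus" is 0 .

lift_definition plus_torus :: "'a torus \<Rightarrow> 'a torus \<Rightarrow> 'a torus" is "(+)"
  by (simp add: add_diff_add Ints_add)

lift_definition uminus_torus :: "'a torus \<Rightarrow> 'a torus" is "uminus"
proof -
  fix x y :: "real^'a" and i
  assume "\<And>i. x $ i - y $ i \<in> \<int>"
  then have "- (x $ i - y $ i) \<in> \<int>" by (blast intro: Ints_minus)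
  then show "(- x) $ i - (- y) $ i \<in> \<int>" by simp
qed

lift_definition minus_torus :: "'a torus \<Rightarrow> 'a torus \<Rightarrow> 'a torus" is "(-)"
proof -
  fix x y x' y' :: "real^'a" and i
  assume "\<And>i. x $ i - y $ i \<in> \<int>" "\<And>i. x' $ i - y' $ i \<in> \<int>"
  then have "(x $ i - y $ i) - (x' $ i - y' $ i) \<in> \<int>"
    by (blast intro: Ints_diff)
  then show "(x - x') $ i - (y - y') $ i \<in> \<int>"
    by (simp add: algebra_simps)
qed

instance
  by standard (transfer; simp)+

end

instantiation torus :: (finite) topological_space
begin

definition open_torus :: "'a torus set \<Rightarrow> bool"
  where "open_torus U \<longleftrightarrow> open (abs_torus -` U)"

instance
proof
  show "open (UNIV :: 'a torus set)"
    by (simp add: open_torus_def)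
  show "open (U \<inter> V)" if "open U" "open V" for U V :: "'a torus set"
    using that by (simp add: open_torus_def vimage_Int open_Int)
  show "open (\<Union>K)" if "\<forall>U\<in>K. open U" for K :: "'a torus set set"
    using that by (simp add: open_torus_def vimage_Union open_UN)
qed

end

definition torus_measure :: "('n::finite) torus measure"
  where "torus_measure =
    distr (restrict_space lborel {x :: real^'n. \<forall>i. 0 \<le> x $ i \<and> x $ i < 1}) borel abs_torus"

lift_definition torus_map :: "int^'n^'n \<Rightarrow> 'n::finite torus \<Rightarrow> 'n torus"
  is "\<lambda>S x. map_matrix real_of_int S *v x"
proof -
  fix S :: "int^'n^'n" and x y :: "real^'n" and i
  assume *: "\<And>i. x $ i - y $ i \<in> \<int>"
  have "(\<Sum>j\<in>UNIV. real_of_int (S $ i $ j) * (x $ j - y $ j)) \<in> \<int>"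
    using * by (intro Ints_sum Ints_mult) auto
  then show "(map_matrix real_of_int S *v x) $ i - (map_matrix real_of_int S *v y) $ i \<in> \<int>"
    by (simp add: matrix_vector_mult_def right_diff_distrib sum_subtractf)
qed

definition ergodic :: "'a measure \<Rightarrow> ('a \<Rightarrow> 'a) \<Rightarrow> bool"
  where "ergodic M T \<longleftrightarrow> T \<in> M \<rightarrow>\<^sub>M M \<and> distr M M T = M \<and>
    (\<forall>A\<in>sets M. T -` A \<inter> space M = A \<longrightarrow> A \<in> null_sets M \<or> space M - A \<in> null_sets M)"


subsection \<open>Spectral subspaces\<close>

text \<open>The real part of the sum of the generalised complex eigenspaces for the eigenvalues
  whose modulus satisfies the given condition.\<close>

definition spectral_subspace :: "(real \<Rightarrow> bool) \<Rightarrow> int^'n^'n \<Rightarrow> (real^'n::finite) set"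
  where "spectral_subspace P S =
    {x. (\<chi> i. complex_of_real (x $ i)) \<in>
        vec.span {z :: complex^'n. \<exists>c k. P (cmod c) \<and>
          ((\<lambda>w. map_matrix of_int S *v w - c *s w) ^^ k) z = 0}}"

definition E_u :: "int^'n^'n \<Rightarrow> (real^'n::finite) set"
  where "E_u = spectral_subspace (\<lambda>r. r > 1)"

definition E_e :: "int^'n^'n \<Rightarrow> (real^'n::finite) set"
  where "E_e = spectral_subspace (\<lambda>r. r = 1)"

definition E_s :: "int^'n^'n \<Rightarrow> (real^'n::finite) set"
  where "E_s = spectral_subspace (\<lambda>r. r < 1)"

text \<open>The spectral radius of the restriction of \<open>A\<close> to an invariant subspace \<open>W\<close>, through the
  eigenvectors in the complexification of \<open>W\<close>. The maximum makes sense for \<open>W \<noteq> {0}\<close>.\<close>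

definition spectral_radius_on :: "real^'n^'n \<Rightarrow> (real^'n::finite) set \<Rightarrow> real"
  where "spectral_radius_on A W =
    Max (cmod ` {c. \<exists>z :: complex^'n. z \<noteq> 0 \<and> (\<chi> i. Re (z $ i)) \<in> W \<and> (\<chi> i. Im (z $ i)) \<in> W \<and>
      map_matrix complex_of_real A *v z = c *s z})"


subsection \<open>Adapted bases and moduli of continuity\<close>

text \<open>The index type \<open>'n\<close> carries no order, so the order of the basis is given by
  a numbering \<open>e\<close> of the indices by \<open>1, \<dots>, d\<close>; the \<open>k\<close>-th basis vector is \<open>v (e k)\<close>.
  As \<open>e\<close> numbers both the rows and the columns, the determinant does not depend on it.
  A nonzero determinant makes \<open>v\<close> a basis.\<close>

definition adapted_basis :: "int^'n^'n \<Rightarrow> (nat \<Rightarrow> 'n) \<Rightarrow> ('n::finite \<Rightarrow> real^'n) \<Rightarrow> bool"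
  where "adapted_basis S e v \<longleftrightarrow>
    bij_betw e {1..CARD('n)} UNIV \<and>
    (\<forall>k\<in>{1..dim (E_u S)}. v (e k) \<in> E_u S) \<and>
    (\<forall>k\<in>{dim (E_u S) + 1..dim (E_u S) + dim (E_e S)}. v (e k) \<in> E_e S) \<and>
    (\<forall>k\<in>{dim (E_u S) + dim (E_e S) + 1..CARD('n)}. v (e k) \<in> E_s S) \<and>
    det (\<chi> i j. v j $ i) = 1"

definition basis_norm :: "('n::finite \<Rightarrow> real^'n) \<Rightarrow> real^'n \<Rightarrow> real"
  where "basis_norm v y = (MAX i. \<bar>representation (range v) y (v i)\<bar>)"

definition ball_in :: "('n::finite \<Rightarrow> real^'n) \<Rightarrow> (real^'n) set \<Rightarrow> real \<Rightarrow> (real^'n) set"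
  where "ball_in v W \<delta> = {y \<in> W. basis_norm v y \<le> \<delta>}"

definition omega_u :: "int^'n^'n \<Rightarrow> ('n::finite \<Rightarrow> real^'n) \<Rightarrow> ('n torus \<Rightarrow> real) \<Rightarrow> real \<Rightarrow> real"
  where "omega_u S v \<phi> \<delta> =
    Sup {\<bar>\<phi> x - \<phi> (x + abs_torus h)\<bar> | x h. h \<in> ball_in v (E_u S) \<delta>}"

definition omega_se :: "int^'n^'n \<Rightarrow> ('n::finite \<Rightarrow> real^'n) \<Rightarrow> ('n torus \<Rightarrow> real) \<Rightarrow> real \<Rightarrow> real"
  where "omega_se S v \<phi> \<delta> =
    Sup {\<bar>\<phi> x - \<phi> (x + abs_torus h + abs_torus h')\<bar> | x h h'.
      h \<in> ball_in v (E_s S) \<delta> \<and> h' \<in> ball_in v (E_e S) \<delta>}"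


subsection \<open>Sub-\<open>\<sigma>\<close>-algebras and the \<open>L\<^sup>\<infinity>\<close> norm\<close>

definition int_iterate :: "('a \<Rightarrow> 'a) \<Rightarrow> int \<Rightarrow> 'a \<Rightarrow> 'a"
  where "int_iterate T k = (if k \<ge> 0 then T ^^ nat k else inv T ^^ nat (- k))"

text \<open>The \<open>\<sigma>\<close>-algebra \<open>T\<^sup>-\<^sup>k F\<close> for a bijection \<open>T\<close>. A sub-\<open>\<sigma>\<close>-algebra is represented by a
  measure of which only the space and the measurable sets matter.\<close>

definition pullback_algebra :: "('a \<Rightarrow> 'a) \<Rightarrow> 'a measure \<Rightarrow> int \<Rightarrow> 'a measure"
  where "pullback_algebra T F k = vimage_algebra (space F) (int_iterate T k) F"

definition Linf_norm :: "'a measure \<Rightarrow> ('a \<Rightarrow> real) \<Rightarrow> ereal"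
  where "Linf_norm M f = esssup M (\<lambda>x. ereal \<bar>f x\<bar>)"

end

theory Submission
  imports Defs
begin

text \<open>
  Take for \<open>F\<^sub>0\<close> the \<open>\<sigma>\<close>-algebra generated by the itinerary of \<open>x\<close>: for each \<open>k \<ge> 0\<close>, the translate
  of \<open>E\<^sub>u\<close> that contains the representative of \<open>T\<^sup>-\<^sup>k x\<close> in the unit cube. Its atoms are bounded
  pieces of unstable leaves, and \<open>T\<^sup>-\<^sup>n\<close> contracts them, which gives the first estimate.

  A translation by a vector of \<open>E\<^sub>u\<close> changes the itinerary only if \<open>T\<^sup>-\<^sup>k x\<close> is close to the boundary
  of the cube for some \<open>k\<close>. Outside the exceptional set where the conditional probability of this
  event given \<open>F\<^sub>-\<^sub>n\<close> is large, the elements of \<open>F\<^sub>-\<^sub>n\<close> are almost invariant under the vectors of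
  \<open>E\<^sub>u\<close> of length at most \<open>\<zeta>\<^sup>-\<^sup>n\<^sup>d\<close>, up to a constant. By a pigeonhole argument, each vector of
  \<open>\<real>\<^sup>d\<close> is modulo \<open>\<int>\<^sup>d\<close> the sum of such a vector and a vector of \<open>E\<^sub>e + E\<^sub>s\<close> of length at most
  \<open>\<zeta>\<^sup>n\<close>. So the integral of \<open>\<phi>\<close> over an element of \<open>F\<^sub>-\<^sub>n\<close> hardly changes under any translation of
  \<open>\<phi>\<close>, and it is close to its average over all translations.
\<close>

section \<open>Integer vectors\<close>

text \<open>Two properties of the splitting carry the argument: backward iteration contracts
  \<open>U\<close> at rate \<rho>, and forward orbits in \<open>W\<close> are bounded by a multiple
  of \<theta>^n for every \<theta> > 1. Bounded orbits in \<open>W\<close> cannot be expected, since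
  \<open>S\<close> may have Jordan blocks at eigenvalues of modulus one. Besides invariance of the
  measure, ergodicity gives one fact: no nonzero integer vector is orthogonal to
  \<open>E_u S\<close>. Otherwise a power of the transposed matrix fixes a nonzero integer vector,
  and the cosines along its orbit add up to a nonconstant invariant function. The constants come
  from one balance. Moves of order \<zeta>^n along \<open>W\<close> cost vectors of \<open>U\<close>
  of length of order 1/\<zeta>^(nd). Carried back n steps these are of order q^n with q =
  \<open>\<rho>\<^sub>u\<close> / \<zeta>^d, and the bound on \<zeta> gives q < 1. The past of a
  point comes that near to a face of the cube with probability of order q^n; Markov's inequality at
  a threshold of order q^(n/2) controls both the exceptional set and the error, whence \<xi> = sqrt
  q. The first estimate admits no constant, so a rate \<rho> below \<open>\<rho>\<^sub>u\<close> is
  used and the gap absorbs the constants once n is at least \<open>N\<close>.\<close>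

definition int_vectors :: "(real^'n) set"
  where "int_vectors = {x. \<forall>i. x $ i \<in> \<int>}"

lemma int_vectors_add: "x \<in> int_vectors \<Longrightarrow> y \<in> int_vectors \<Longrightarrow> x + y \<in> int_vectors"
  and int_vectors_diff: "x \<in> int_vectors \<Longrightarrow> y \<in> int_vectors \<Longrightarrow> x - y \<in> int_vectors"
  and int_vectors_zero: "0 \<in> int_vectors"
  and int_vectors_scale: "c \<in> \<int> \<Longrightarrow> x \<in> int_vectors \<Longrightarrow> c *\<^sub>R x \<in> int_vectors"
  by (auto simp: int_vectors_def)

lemma int_vectors_sum: "(\<And>i. i \<in> I \<Longrightarrow> f i \<in> int_vectors) \<Longrightarrow> (\<Sum>i\<in>I. f i) \<in> int_vectors"
  by (induction I rule: infinite_finite_induct) (auto intro: int_vectors_add int_vectors_zero)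

lemma axis_in_int_vectors: "axis i 1 \<in> int_vectors"
  by (auto simp: int_vectors_def axis_def)

lemma det_Ints:
  fixes M :: "real^'n^'n::finite"
  assumes "\<And>i j. M $ i $ j \<in> \<int>"
  shows "det M \<in> \<int>"
  unfolding det_def using assms by (intro Ints_sum Ints_mult Ints_prod) auto

text \<open>Cramer's rule: the product is the determinant of \<open>M\<close> with one column
  replaced by \<open>M *v y\<close>, again an integer matrix.\<close>

lemma det_times_solution_Ints:
  fixes M :: "real^'n^'n::finite"
  assumes "\<And>i j. M $ i $ j \<in> \<int>" and "M *v y \<in> int_vectors"
  shows "y $ k * det M \<in> \<int>"
  unfolding cramer_lemma[of k M y, symmetric]
  by (rule det_Ints) (use assms in \<open>auto simp: int_vectors_def\<close>)

text \<open>A basis of the span taken from \<open>Y\<close> is completed by unit vectors to a basis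
  of integer vectors, the columns of \<open>M\<close>. A row of the inverse of \<open>M\<close>
  belonging to an added column kills all other columns, and multiplication by \<open>det M\<close>
  makes it integral.\<close>

lemma int_vector_orthogonal_to_proper_subspace:
  fixes Y :: "(real^'n::finite) set"
  assumes Y: "Y \<subseteq> int_vectors" and proper: "span Y \<noteq> UNIV"
  shows "\<exists>k\<in>int_vectors. k \<noteq> 0 \<and> (\<forall>x\<in>span Y. k \<bullet> x = 0)"
proof -
  obtain B where B: "B \<subseteq> Y" "independent B" "Y \<subseteq> span B"
    using maximal_independent_subset[of Y] by blast
  have spB: "span B = span Y"
    using B by (metis span_mono span_span subset_antisym)
  let ?E = "range (\<lambda>i. axis i (1::real)) :: (real^'n) set"
  obtain B' where B': "B \<subseteq> B'" "B' \<subseteq> B \<union> ?E" "independent B'" "B \<union> ?E \<subseteq> span B'"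
    using maximal_independent_subset_extend[of B "B \<union> ?E"] B(2) by blast
  have "?E = Basis"
    by (auto simp: Basis_vec_def)
  then have "UNIV \<subseteq> span B'"
    using B'(4) span_mono[of ?E "span B'"] by (simp only: span_span span_Basis) blast
  then have spB': "span B' = UNIV" by auto
  have cB': "card B' = CARD('n)" "finite B'"
  proof -
    have "card B' = dim (span B')" using B'(3) by (simp add: dim_eq_card_independent)
    then show "card B' = CARD('n)" by (simp add: spB')
    show "finite B'" using B'(3) by (rule independent_imp_finite)
  qed
  have "B' \<noteq> B" using spB spB' proper by auto
  then obtain b0 where b0: "b0 \<in> B'" "b0 \<notin> B" using B'(1) by auto
  obtain f :: "'n \<Rightarrow> real^'n" where f: "bij_betw f UNIV B'"
    using cB' finite_same_card_bij[of "UNIV::'n set" B'] by auto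
  obtain i0 where i0: "f i0 = b0" using f b0 by (auto simp: bij_betw_def)
  define M :: "real^'n^'n" where "M = (\<chi> i j. f j $ i)"
  have Mcol: "M *v axis j 1 = f j" for j
    by (simp add: M_def matrix_vector_mul_component vec_eq_iff inner_axis)
  have "inj f" using f by (simp add: bij_betw_def)
  have "surj ((*v) M)"
  proof -
    have "span B' \<subseteq> range ((*v) M)"
    proof (rule span_minimal)
      show "B' \<subseteq> range ((*v) M)"
      proof
        fix b assume "b \<in> B'"
        then obtain j where "b = f j" using f by (auto simp: bij_betw_def)
        then have "b = M *v axis j 1" by (simp add: Mcol)
        then show "b \<in> range ((*v) M)" by blast
      qed
      show "subspace (range ((*v) M))"
        by (rule linear_subspace_image) auto
    qed
    then show ?thesis using spB' by auto
  qed
  then have dM: "det M \<noteq> 0"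
    by (metis invertible_det_nz matrix_right_invertible_surjective invertible_right_inverse)
  then obtain N where N: "M ** N = mat 1" "N ** M = mat 1"
    by (metis invertible_det_nz invertible_def)
  \<comment> \<open>A row of the adjugate of \<open>M\<close>; its entries are integers by Cramer's
    rule, applied to the solutions of \<open>M *v y = axis a 1\<close>.\<close>
  define k where "k = det M *\<^sub>R row i0 N"
  have k: "k \<bullet> x = (N *v x) $ i0 * det M" for x
    by (simp add: k_def matrix_vector_mul_component row_def inner_vec_def matrix_vector_mult_def sum_distrib_left mult_ac)
  have MN: "M *v (N *v x) = x" for x using N by (simp add: matrix_vector_mul_assoc)
  have NM: "N *v (M *v x) = x" for x using N by (simp add: matrix_vector_mul_assoc)
  have B'int: "B' \<subseteq> int_vectors" using B' B Y axis_in_int_vectors by blast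
  have Mint: "M $ i $ j \<in> \<int>" for i j
  proof -
    have "f j \<in> int_vectors" using B'int f by (auto simp: bij_betw_def)
    then show ?thesis by (simp add: M_def int_vectors_def)
  qed
  have "k \<in> int_vectors"
  proof -
    have "k $ a \<in> \<int>" for a
    proof -
      have "k $ a = k \<bullet> axis a 1" by (simp add: inner_axis)
      then show ?thesis unfolding k
        using det_times_solution_Ints[of M "N *v axis a 1" i0] Mint
        by (simp add: MN axis_in_int_vectors)
    qed
    then show ?thesis by (auto simp: int_vectors_def)
  qed
  moreover have "k \<bullet> b0 = det M"
    unfolding k i0[symmetric] Mcol[symmetric] NM by simp
  then have "k \<noteq> 0" using dM by auto
  moreover have "k \<bullet> x = 0" if "x \<in> span Y" for x
  proof -
    have "k \<bullet> b = 0" if "b \<in> B" for b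
    proof -
      have "b \<in> f ` UNIV" using f B'(1) that by (auto simp: bij_betw_def)
      then obtain j where j: "f j = b" by blast
      then have "j \<noteq> i0" using i0 b0 that by auto
      then show ?thesis unfolding k j[symmetric] Mcol[symmetric] NM by (simp add: axis_def)
    qed
    moreover have "x \<in> span B" using that spB by simp
    ultimately show ?thesis
      using orthogonal_to_span[of x B k] unfolding orthogonal_def by (auto simp: inner_commute)
  qed
  ultimately show ?thesis by blast
qed

lemma Ints_vec_scaled_small:
  fixes y :: "real^'n::finite"
  assumes "y = c *\<^sub>R z" and "z \<in> int_vectors" and "\<And>i. \<bar>y \<bullet> axis i 1\<bar> < c" and "c > 0"
  shows "y = 0"
proof -
  have "z $ i = 0" for i
  proof -
    have "c * \<bar>z $ i\<bar> < c" using assms(3)[of i] assms(1,4) by (simp add: inner_axis abs_mult)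
    then have "\<bar>z $ i\<bar> < 1" using assms(4) by simp
    moreover have "z $ i \<in> \<int>" using assms(2) by (simp add: int_vectors_def)
    ultimately show ?thesis using Ints_nonzero_abs_less1 by blast
  qed
  then have "z = 0" by (simp add: vec_eq_iff)
  then show ?thesis using assms by simp
qed

section \<open>Iteration of lattice automorphisms and periodic integer vectors\<close>

lemma linear_funpow: "linear f \<Longrightarrow> linear (f ^^ n)" for f :: "'a::real_vector \<Rightarrow> 'a"
  by (induction n) (auto intro: linear_compose simp: linear_id)

lemma funpow_invariant: "(\<And>x. x \<in> X \<Longrightarrow> f x \<in> X) \<Longrightarrow> x \<in> X \<Longrightarrow> (f ^^ n) x \<in> X"
  by (induction n) auto

lemma funpow_inverse: "(\<And>x. f (g x) = x) \<Longrightarrow> (f ^^ n) ((g ^^ n) x) = x" for f g :: "'a \<Rightarrow> 'a"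
proof (induction n arbitrary: x)
  case (Suc n)
  have "(f ^^ Suc n) ((g ^^ Suc n) x) = f ((f ^^ n) ((g ^^ n) (g x)))"
    by (simp add: funpow_swap1)
  then show ?case using Suc by simp
qed simp

text \<open>There are only finitely many integer matrices modulo 3, so two powers of
  \<open>A\<close> agree modulo 3. The smaller power is cancelled with \<open>A'\<close>, which
  preserves divisibility by 3 because it too maps integer vectors to integer vectors.\<close>

lemma periodic_mod_3:
  fixes A A' :: "real^'n::finite \<Rightarrow> real^'n"
  assumes lin: "linear A" "linear A'" and inv: "\<And>x. A' (A x) = x"
    and int: "\<And>x. x \<in> int_vectors \<Longrightarrow> A x \<in> int_vectors" "\<And>x. x \<in> int_vectors \<Longrightarrow> A' x \<in> int_vectors"
  obtains P where "P > 0"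
    "\<And>x. x \<in> int_vectors \<Longrightarrow> \<exists>z\<in>int_vectors. (A ^^ P) x - x = 3 *\<^sub>R z"
proof -
  define g where "g = (\<lambda>i (a::'n) (b::'n). \<lfloor>((A ^^ i) (axis a 1)) $ b\<rfloor> mod 3)"
  have "range g \<subseteq> UNIV \<rightarrow> UNIV \<rightarrow> {0..<3}" by (auto simp: g_def)
  moreover have "finite ((UNIV::'n set) \<rightarrow> (UNIV :: 'n set) \<rightarrow> {0..<3::int})"
  proof -
    have "finite (Pi\<^sub>E (UNIV::'n set) (\<lambda>_. Pi\<^sub>E (UNIV :: 'n set) (\<lambda>_. {0..<3::int})))"
      by (intro finite_PiE) auto
    then show ?thesis by (simp add: PiE_UNIV_domain Pi_def)
  qed
  ultimately have "finite (range g)" by (rule finite_subset)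
  then have "\<not> inj g" using finite_imageD infinite_UNIV_nat by blast
  then obtain i j where ij: "i < j" "g i = g j"
    by (metis injI linorder_neqE_nat)
  have pw: "(A ^^ n) x \<in> int_vectors" if "x \<in> int_vectors" for n x
    using int(1) that by (rule funpow_invariant)
  have pw': "(A' ^^ n) x \<in> int_vectors" if "x \<in> int_vectors" for n x
    using int(2) that by (rule funpow_invariant)
  have ax: "\<exists>z\<in>int_vectors. (A ^^ j) (axis a 1) - (A ^^ i) (axis a 1) = 3 *\<^sub>R z" for a
  proof -
    let ?d = "(A ^^ j) (axis a 1) - (A ^^ i) (axis a 1)"
    have "\<exists>m::int. ?d $ b = 3 * of_int m" for b
    proof -
      have i: "((A ^^ i) (axis a 1)) $ b \<in> \<int>" "((A ^^ j) (axis a 1)) $ b \<in> \<int>"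
        using pw[OF axis_in_int_vectors] by (auto simp: int_vectors_def)
      have "\<lfloor>((A ^^ j) (axis a 1)) $ b\<rfloor> mod 3 = \<lfloor>((A ^^ i) (axis a 1)) $ b\<rfloor> mod 3"
        using ij(2) by (metis g_def)
      then have "3 dvd \<lfloor>((A ^^ j) (axis a 1)) $ b\<rfloor> - \<lfloor>((A ^^ i) (axis a 1)) $ b\<rfloor>"
        by (simp add: mod_eq_dvd_iff)
      then obtain m where "\<lfloor>((A ^^ j) (axis a 1)) $ b\<rfloor> - \<lfloor>((A ^^ i) (axis a 1)) $ b\<rfloor> = 3 * m" ..
      then have "real_of_int (\<lfloor>((A ^^ j) (axis a 1)) $ b\<rfloor> - \<lfloor>((A ^^ i) (axis a 1)) $ b\<rfloor>) = 3 * of_int m" by simp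
      then show ?thesis using i by (auto intro!: exI[of _ m] simp: Ints_def)
    qed
    then obtain m where m: "\<And>b. ?d $ b = 3 * of_int (m b)" by metis
    have "?d = 3 *\<^sub>R (\<chi> b. of_int (m b))" using m by (simp add: vec_eq_iff)
    then show ?thesis by (intro bexI[of _ "\<chi> b. of_int (m b)"]) (auto simp: int_vectors_def)
  qed
  have *: "\<exists>z\<in>int_vectors. (A ^^ j) x - (A ^^ i) x = 3 *\<^sub>R z" if "x \<in> int_vectors" for x
  proof -
    obtain z where z: "\<And>a. z a \<in> int_vectors" "\<And>a. (A ^^ j) (axis a 1) - (A ^^ i) (axis a 1) = 3 *\<^sub>R z a"
      using ax by metis
    have x: "x = (\<Sum>a\<in>UNIV. x $ a *\<^sub>R axis a 1)"
      using basis_expansion[of x] by (simp add: scalar_mult_eq_scaleR)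
    have "(A ^^ n) x = (\<Sum>a\<in>UNIV. x $ a *\<^sub>R (A ^^ n) (axis a 1))" for n
      by (subst x) (simp add: linear_sum[OF linear_funpow[OF lin(1)]] linear_cmul[OF linear_funpow[OF lin(1)]])
    then have "(A ^^ j) x - (A ^^ i) x = (\<Sum>a\<in>UNIV. x $ a *\<^sub>R ((A ^^ j) (axis a 1) - (A ^^ i) (axis a 1)))"
      by (simp add: sum_subtractf scaleR_diff_right)
    also have "\<dots> = 3 *\<^sub>R (\<Sum>a\<in>UNIV. x $ a *\<^sub>R z a)"
      by (simp add: z(2) scaleR_sum_right mult.commute)
    finally show ?thesis
      using z(1) that by (intro bexI[of _ "\<Sum>a\<in>UNIV. x $ a *\<^sub>R z a"] int_vectors_sum int_vectors_scale)
         (auto simp: int_vectors_def)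
  qed
  have A'A: "(A' ^^ n) ((A ^^ n) x) = x" for n x using inv by (rule funpow_inverse)
  show ?thesis
  proof (rule that[of "j - i"])
    fix x :: "real^'n" assume x: "x \<in> int_vectors"
    then obtain z where z: "z \<in> int_vectors" "(A ^^ j) x - (A ^^ i) x = 3 *\<^sub>R z" using * by blast
    have "(A ^^ j) x = (A ^^ i) ((A ^^ (j - i)) x)"
      using ij(1) by (metis comp_apply funpow_add le_add_diff_inverse less_imp_le)
    then have "(A ^^ (j - i)) x - x = (A' ^^ i) (3 *\<^sub>R z)"
      unfolding z(2)[symmetric] linear_diff[OF linear_funpow[OF lin(2)]] by (simp add: A'A)
    also have "\<dots> = 3 *\<^sub>R (A' ^^ i) z" by (simp add: linear_cmul[OF linear_funpow[OF lin(2)]])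
    finally show "\<exists>z\<in>int_vectors. (A ^^ (j - i)) x - x = 3 *\<^sub>R z" using pw'[OF z(1)] by blast
  qed (use ij in auto)
qed

text \<open>A form of Kronecker's theorem on algebraic integers all of whose conjugates have modulus at
  most one. Modulo 3 some power \<open>B\<^sup>P\<close> is the identity, so \<open>(B\<^sup>P - 1)\<^sup>m k\<close> is divisible by \<open>3\<^sup>m\<close>;
  it grows more slowly than that, so it vanishes for large \<open>m\<close>.\<close>

lemma periodic_int_vector:
  fixes A B B' pw :: "real^'n::finite \<Rightarrow> real^'n"
  assumes lin: "linear A" "linear B" "linear B'" and inv: "\<And>x. B' (B x) = x"
    and adj: "\<And>x y. B x \<bullet> y = x \<bullet> A y"
    and int: "\<And>x. x \<in> int_vectors \<Longrightarrow> B x \<in> int_vectors" "\<And>x. x \<in> int_vectors \<Longrightarrow> B' x \<in> int_vectors"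
    and U: "subspace U" "\<And>x. x \<in> U \<Longrightarrow> A x \<in> U"
    and split: "\<And>x. x - pw x \<in> U"
    and growth: "\<And>\<theta>. \<theta> > 1 \<Longrightarrow> \<exists>C. \<forall>x n. norm ((A ^^ n) (pw x)) \<le> C * \<theta> ^ n * norm x"
    and k: "k \<in> int_vectors" "k \<noteq> 0" "\<And>x. x \<in> U \<Longrightarrow> k \<bullet> x = 0"
  obtains P l where "P > 0" "l \<in> int_vectors" "l \<noteq> 0" "(B ^^ P) l = l"
proof -
  obtain P where P: "P > 0" "\<And>x. x \<in> int_vectors \<Longrightarrow> \<exists>z\<in>int_vectors. (B ^^ P) x - x = 3 *\<^sub>R z"
    using periodic_mod_3[OF lin(2,3) inv int] by metis
  define D where "D = (\<lambda>x. (B ^^ P) x - x)"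
  define E where "E = (\<lambda>x. (A ^^ P) x - x)"
  have linD: "linear D" unfolding D_def by (intro linear_compose_sub linear_funpow lin linear_ident)
  have linE: "linear E" unfolding E_def by (intro linear_compose_sub linear_funpow lin linear_ident)
  have adjP: "(B ^^ n) x \<bullet> y = x \<bullet> (A ^^ n) y" for n x y
    by (induction n arbitrary: x) (simp_all add: adj funpow_swap1)
  have adjD: "D x \<bullet> y = x \<bullet> E y" for x y by (simp add: D_def E_def inner_diff adjP)
  have adjDn: "(D ^^ n) x \<bullet> y = x \<bullet> (E ^^ n) y" for n x y
    by (induction n arbitrary: x) (simp_all add: adjD funpow_swap1)
  have div: "\<exists>z\<in>int_vectors. (D ^^ m) k = 3 ^ m *\<^sub>R z" for m
  proof (induction m)
    case 0 show ?case using k by auto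
  next
    case (Suc m)
    then obtain z where z: "z \<in> int_vectors" "(D ^^ m) k = 3 ^ m *\<^sub>R z" by blast
    obtain z' where z': "z' \<in> int_vectors" "D z = 3 *\<^sub>R z'" using P(2)[OF z(1)] unfolding D_def by blast
    have "(D ^^ Suc m) k = 3 ^ Suc m *\<^sub>R z'"
      using z z' by (simp add: linear_cmul[OF linD])
    then show ?case using z' by blast
  qed
  \<comment> \<open>Each application of \<open>E\<close> then multiplies the bound on the
    \<open>W\<close> part by at most \<theta>^P + 1 = 5/2, which stays below the factor 3 gained in
    divisibility.\<close>
  define \<theta> where "\<theta> = root P (3/2)"
  have \<theta>: "\<theta> > 1" "\<theta> ^ P = 3/2" using P(1) by (auto simp: \<theta>_def)
  obtain C where C: "\<And>x n. norm ((A ^^ n) (pw x)) \<le> C * \<theta> ^ n * norm x" using growth[OF \<theta>(1)] by blast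
  have grow: "norm ((A ^^ n) ((E ^^ m) (pw x))) \<le> C * \<theta> ^ n * norm x * (5/2) ^ m" for n m x
  proof (induction m arbitrary: n)
    case 0 show ?case using C by simp
  next
    case (Suc m)
    have "(A ^^ n) ((E ^^ Suc m) (pw x)) = (A ^^ (n + P)) ((E ^^ m) (pw x)) - (A ^^ n) ((E ^^ m) (pw x))"
      by (simp add: E_def linear_diff[OF linear_funpow[OF lin(1)]] funpow_add)
    then have "norm ((A ^^ n) ((E ^^ Suc m) (pw x)))
      \<le> norm ((A ^^ (n + P)) ((E ^^ m) (pw x))) + norm ((A ^^ n) ((E ^^ m) (pw x)))"
      by (metis norm_triangle_ineq4)
    also have "\<dots> \<le> C * \<theta> ^ (n + P) * norm x * (5/2) ^ m + C * \<theta> ^ n * norm x * (5/2) ^ m"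
      by (intro add_mono Suc.IH)
    also have "\<dots> = C * \<theta> ^ n * norm x * (5/2) ^ Suc m"
      by (simp add: power_add \<theta>(2) algebra_simps)
    finally show ?case .
  qed
  have Einv: "(E ^^ m) x \<in> U" if "x \<in> U" for m x
    using that by (rule funpow_invariant[rotated])
       (auto simp: E_def intro!: subspace_diff U(1) funpow_invariant[OF U(2)])
  \<comment> \<open>By adjointness \<open>D\<close> moves to the other side of the inner product as
    \<open>E\<close>. There only the component \<open>pw\<close> contributes, since \<open>E\<close>
    preserves \<open>U\<close> and \<open>k\<close> is orthogonal to \<open>U\<close>.\<close>
  have small: "\<bar>(D ^^ m) k \<bullet> axis i 1\<bar> \<le> norm k * C * (5/2) ^ m" for m i
  proof -
    let ?x = "axis i 1 :: real^'n"
    have "(E ^^ m) ?x = (E ^^ m) (?x - pw ?x) + (E ^^ m) (pw ?x)"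
      by (simp add: linear_diff[OF linear_funpow[OF linE]])
    then have "(D ^^ m) k \<bullet> ?x = k \<bullet> (E ^^ m) (pw ?x)"
      unfolding adjDn using k(3)[OF Einv[OF split]] by (simp add: inner_add_right)
    also have "\<bar>\<dots>\<bar> \<le> norm k * norm ((E ^^ m) (pw ?x))" by (rule Cauchy_Schwarz_ineq2)
    also have "\<dots> \<le> norm k * (C * (5/2) ^ m)"
      using grow[of 0 m ?x] by (intro mult_left_mono) auto
    finally show ?thesis by (simp add: mult.assoc)
  qed
  have "\<exists>m. norm k * C * (5/2) ^ m < 3 ^ m"
  proof -
    have "(\<lambda>m. norm k * C * (5/6) ^ m) \<longlonglongrightarrow> norm k * C * 0"
      by (intro tendsto_mult_left LIMSEQ_power_zero) auto
    then have "eventually (\<lambda>m. norm k * C * (5/6) ^ m < 1) sequentially"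
      by (intro order_tendstoD(2)) auto
    then obtain m where m: "norm k * C * (5/6) ^ m < 1" by (auto simp: eventually_sequentially)
    have "(5/2::real) ^ m = (5/6) ^ m * 3 ^ m" by (simp flip: power_mult_distrib)
    then have "norm k * C * (5/2) ^ m = (norm k * C * (5/6) ^ m) * 3 ^ m" by simp
    also have "\<dots> < 1 * 3 ^ m" using m by (intro mult_strict_right_mono) auto
    finally show ?thesis by auto
  qed
  then obtain m where m: "norm k * C * (5/2) ^ m < 3 ^ m" ..
  have "(D ^^ m) k = 0"
  proof -
    obtain z where "z \<in> int_vectors" "(D ^^ m) k = 3 ^ m *\<^sub>R z" using div by blast
    then show ?thesis using small[of m] m by (intro Ints_vec_scaled_small) (auto intro: le_less_trans)
  qed
  moreover have "(D ^^ 0) k \<noteq> 0" using k by simp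
  \<comment> \<open>The last nonvanishing iterate is annihilated by \<open>D\<close>, that is, fixed
    by the \<open>P\<close>-th power of \<open>B\<close>.\<close>
  ultimately obtain j where j: "(D ^^ j) k \<noteq> 0" "(D ^^ Suc j) k = 0"
    using ex_least_nat_less[of "\<lambda>m. (D ^^ m) k = 0" m] by auto
  show ?thesis
  proof (rule that[OF P(1) _ j(1)])
    show "(D ^^ j) k \<in> int_vectors"
      using div[of j] by (auto intro!: int_vectors_scale)
    show "(B ^^ P) ((D ^^ j) k) = (D ^^ j) k" using j(2) by (simp add: D_def)
  qed
qed

section \<open>Density of translates of the unstable space\<close>

text \<open>Dirichlet's argument: among the L^d + 1 multiples of \<open>u\<close> with factors from
  0 to L^d, two have fractional parts in the same of the L^d subcubes of side 1/L.\<close>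

lemma simultaneous_approximation:
  fixes u :: "real^'n::finite"
  assumes "L > 0"
  obtains j m where "1 \<le> j" "j \<le> L ^ CARD('n)" "m \<in> int_vectors"
    "norm (real j *\<^sub>R u - m) \<le> real CARD('n) / real L"
proof -
  define g where "g = (\<lambda>(j::nat) (i::'n). \<lfloor>real L * frac (real j * u $ i)\<rfloor>)"
  let ?S = "Pi\<^sub>E (UNIV :: 'n set) (\<lambda>_. {0..<int L})"
  have "g j i \<in> {0..<int L}" for j i
    using assms frac_lt_1[of "real j * u $ i"]
    using mult_strict_left_mono[of "frac (real j * u $ i)" 1 "real L"] by (simp add: g_def floor_less_iff)
  then have "g ` {0..L ^ CARD('n)} \<subseteq> ?S" by (auto simp: PiE_UNIV_domain)
  moreover have "card ?S = L ^ CARD('n)" by (subst card_PiE) auto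
  moreover have "finite ?S" by (intro finite_PiE) auto
  ultimately have "card (g ` {0..L ^ CARD('n)}) \<le> L ^ CARD('n)"
    using card_mono by metis
  then have "card (g ` {0..L ^ CARD('n)}) < card {0..L ^ CARD('n)}" by simp
  then have "\<not> inj_on g {0..L ^ CARD('n)}" by (rule pigeonhole)
  then obtain a b where ab: "a < b" "b \<le> L ^ CARD('n)" "g a = g b"
    unfolding inj_on_def by (metis atLeastAtMost_iff linorder_neqE_nat)
  define m :: "real^'n" where "m = (\<chi> i. of_int (\<lfloor>real b * u $ i\<rfloor> - \<lfloor>real a * u $ i\<rfloor>))"
  have comp: "\<bar>(real (b - a) *\<^sub>R u - m) $ i\<bar> \<le> 1 / real L" for i
  proof -
    have eq: "(real (b - a) *\<^sub>R u - m) $ i = frac (real b * u $ i) - frac (real a * u $ i)"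
      using ab(1) by (simp add: m_def frac_def of_nat_diff algebra_simps)
    have "g a i = g b i" using ab by simp
    then have "\<bar>real L * frac (real b * u $ i) - real L * frac (real a * u $ i)\<bar> \<le> 1"
      unfolding g_def by linarith
    then have "real L * \<bar>frac (real b * u $ i) - frac (real a * u $ i)\<bar> \<le> 1"
      using assms by (simp add: abs_mult flip: right_diff_distrib)
    then show ?thesis using assms unfolding eq by (simp add: field_simps)
  qed
  have "norm (real (b - a) *\<^sub>R u - m) \<le> (\<Sum>i\<in>UNIV. \<bar>(real (b - a) *\<^sub>R u - m) $ i\<bar>)"
    by (rule norm_le_l1_cart)
  also have "\<dots> \<le> (\<Sum>i\<in>(UNIV::'n set). 1 / real L)" by (intro sum_mono comp)
  finally show ?thesis
    using ab by (intro that[of "b - a" m]) (auto simp: m_def int_vectors_def)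
qed

text \<open>In the application \<open>U\<close> is \<open>E_u S\<close>, \<open>W\<close> is the sum
  of \<open>E_e S\<close> and \<open>E_s S\<close>, and \<open>A'\<close> is the inverse of
  \<open>A\<close>. The rate on \<open>W\<close> is an arbitrary \<theta> > 1 in order to cover the
  polynomial growth caused by Jordan blocks; it is always used with \<theta> * \<rho> < 1.\<close>

locale toral_splitting =
  fixes A A' pu pw :: "real^'n::finite \<Rightarrow> real^'n" and U W :: "(real^'n) set" and Cu \<rho> :: real
  assumes linA: "linear A" and linA': "linear A'" and linpu: "linear pu" and linpw: "linear pw"
    and AA': "\<And>x. A (A' x) = x" and A'A: "\<And>x. A' (A x) = x"
    and A_int: "\<And>x. x \<in> int_vectors \<Longrightarrow> A x \<in> int_vectors"
    and A'_int: "\<And>x. x \<in> int_vectors \<Longrightarrow> A' x \<in> int_vectors"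
    and pu_pw: "\<And>x. pu x + pw x = x" and pu: "\<And>x. pu x \<in> U" and pw: "\<And>x. pw x \<in> W"
    and pw_U: "\<And>x. x \<in> U \<Longrightarrow> pw x = 0" and pu_W: "\<And>x. x \<in> W \<Longrightarrow> pu x = 0"
    and subspaceU: "subspace U" and subspaceW: "subspace W"
    and A_U: "\<And>x. x \<in> U \<Longrightarrow> A x \<in> U" and A'_U: "\<And>x. x \<in> U \<Longrightarrow> A' x \<in> U"
    and A_W: "\<And>x. x \<in> W \<Longrightarrow> A x \<in> W"
    and \<rho>: "0 < \<rho>" "\<rho> < 1" and Cu: "Cu > 0"
    and contraction: "\<And>x n. x \<in> U \<Longrightarrow> norm ((A' ^^ n) x) \<le> Cu * \<rho> ^ n * norm x"
    and growth: "\<And>\<theta>. \<theta> > 1 \<Longrightarrow> \<exists>C. \<forall>x\<in>W. \<forall>n. norm ((A ^^ n) x) \<le> C * \<theta> ^ n * norm x"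
    and nonresonance: "\<And>k. k \<in> int_vectors \<Longrightarrow> (\<And>x. x \<in> U \<Longrightarrow> k \<bullet> x = 0) \<Longrightarrow> k = 0"
begin

lemma pu_U: "x \<in> U \<Longrightarrow> pu x = x"
  using pu_pw[of x] pw_U[of x] by simp

lemma pw_W: "x \<in> W \<Longrightarrow> pw x = x"
  using pu_pw[of x] pu_W[of x] by simp

lemma pu_commute: "pu (A x) = A (pu x)"
  and pw_commute: "pw (A x) = A (pw x)"
proof -
  have *: "A x = A (pu x) + A (pw x)" by (metis linear_add[OF linA] pu_pw)
  show "pu (A x) = A (pu x)"
    by (simp add: * linear_add[OF linpu] pu_U A_U pu pu_W A_W pw)
  show "pw (A x) = A (pw x)"
    by (simp add: * linear_add[OF linpw] pw_U A_U pu pw_W A_W pw)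
qed

lemma pu_A'_commute: "pu (A' x) = A' (pu x)"
  by (metis pu_commute AA' A'A)

lemma pu_funpow_A': "pu ((A' ^^ n) x) = (A' ^^ n) (pu x)"
  by (induction n) (simp_all add: pu_A'_commute)

text \<open>\<open>A\<close> is injective, so \<open>A\<close> maps \<open>X\<close> into itself
  without loss of dimension, hence onto \<open>X\<close>.\<close>

lemma invariant_subspace_A':
  assumes X: "subspace X" "\<And>x. x \<in> X \<Longrightarrow> A x \<in> X" and x: "x \<in> X"
  shows "A' x \<in> X"
proof -
  have "inj A" by (metis A'A injI)
  then have "dim (A ` X) = dim X" by (intro dim_image_eq[OF linA]) (auto intro: inj_on_subset)
  then have "A ` X = X"
    using X linA by (intro subspace_dim_equal linear_subspace_image) auto
  then obtain y where "x = A y" "y \<in> X" using x by blast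
  then show ?thesis by (simp add: A'A)
qed

text \<open>For \<open>x = y + z\<close> in \<open>X\<close>, transport \<open>y\<close> backwards by \<open>n\<close> steps, complete it by a small vector of
  \<open>W\<close> to an element of \<open>X\<close>, and return: this completes \<open>y\<close> to an element of \<open>X\<close> by a vector of \<open>W\<close>
  that tends to 0.\<close>

lemma invariant_subspace_pu:
  assumes X: "subspace X" "\<And>x. x \<in> X \<Longrightarrow> A x \<in> X" and x: "x \<in> X"
  shows "pu x \<in> X"
proof -
  obtain g where g: "g ` pu ` X \<subseteq> X" "linear g" "\<forall>v\<in>pu ` X. pu (g v) = v"
    using linear_exists_right_inverse_on[OF linpu X(1)] by auto
  define L where "L = (\<lambda>y. pw (g y))"
  have "linear L" unfolding L_def using linear_compose[OF g(2) linpw] by (simp add: comp_def)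
  then obtain K where K: "\<And>y. norm (L y) \<le> K * norm y" "K > 0"
    using linear_bounded_pos by blast
  have gy: "g v = v + L v" if "v \<in> pu ` X" for v
    using pu_pw[of "g v"] g(3) that by (simp add: L_def)
  \<comment> \<open>Any growth rate on \<open>W\<close> strictly between 1 and 1/\<rho> would do:
    the contraction on \<open>U\<close> has to win.\<close>
  define \<theta> where "\<theta> = 2 / (1 + \<rho>)"
  have \<theta>: "\<theta> > 1" "\<theta> * \<rho> < 1" "\<theta> > 0" using \<rho> by (auto simp: \<theta>_def field_simps)
  obtain C where C: "\<And>x n. x \<in> W \<Longrightarrow> norm ((A ^^ n) x) \<le> C * \<theta> ^ n * norm x"
    using growth[OF \<theta>(1)] by blast
  have C': "norm ((A ^^ n) x) \<le> \<bar>C\<bar> * \<theta> ^ n * norm x" if "x \<in> W" for x n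
  proof -
    have "C * \<theta> ^ n * norm x \<le> \<bar>C\<bar> * \<theta> ^ n * norm x"
      using \<theta>(3) by (intro mult_right_mono) auto
    then show ?thesis using C[OF that, of n] by linarith
  qed
  let ?y = "pu x"
  define e where "e n = (A ^^ n) (L ((A' ^^ n) ?y))" for n
  have XA': "(A' ^^ n) x' \<in> X" if "x' \<in> X" for n x'
    using invariant_subspace_A'[OF X] that by (rule funpow_invariant)
  have in_X: "L ?y - e n \<in> X" for n
  proof -
    have y_n: "(A' ^^ n) ?y \<in> pu ` X"
      using XA'[OF x, of n] by (metis pu_funpow_A' image_eqI)
    have "(A ^^ n) (g ((A' ^^ n) ?y)) = ?y + e n"
      unfolding gy[OF y_n] e_def by (simp add: linear_add[OF linear_funpow[OF linA]] funpow_inverse[of A A', OF AA'])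
    moreover have "g ((A' ^^ n) ?y) \<in> X" using g(1) y_n by blast
    then have "(A ^^ n) (g ((A' ^^ n) ?y)) \<in> X" using X(2) by (intro funpow_invariant)
    moreover have "g ?y \<in> X" using g(1) x by blast
    ultimately have "g ?y - (?y + e n) \<in> X" using subspace_diff[OF X(1)] by metis
    then show ?thesis using gy[of ?y] x by simp
  qed
  have "e \<longlonglongrightarrow> 0"
  proof (rule Lim_null_comparison)
    have "norm (e n) \<le> \<bar>C\<bar> * K * Cu * norm ?y * (\<theta> * \<rho>) ^ n" for n
    proof -
      have "norm (e n) \<le> \<bar>C\<bar> * \<theta> ^ n * norm (L ((A' ^^ n) ?y))"
        unfolding e_def by (rule C') (simp add: L_def pw)
      also have "\<dots> \<le> \<bar>C\<bar> * \<theta> ^ n * (K * (Cu * \<rho> ^ n * norm ?y))"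
        using \<theta>(3) K(2) contraction[OF pu, of n x]
        by (intro mult_left_mono order_trans[OF K(1)]) auto
      finally show ?thesis by (simp add: power_mult_distrib mult_ac)
    qed
    then show "eventually (\<lambda>n. norm (e n) \<le> \<bar>C\<bar> * K * Cu * norm ?y * (\<theta> * \<rho>) ^ n) sequentially" by simp
    have "(\<lambda>n. \<bar>C\<bar> * K * Cu * norm ?y * (\<theta> * \<rho>) ^ n) \<longlonglongrightarrow> \<bar>C\<bar> * K * Cu * norm ?y * 0"
      using \<theta> \<rho> by (intro tendsto_mult_left LIMSEQ_power_zero) auto
    then show "(\<lambda>n. \<bar>C\<bar> * K * Cu * norm ?y * (\<theta> * \<rho>) ^ n) \<longlonglongrightarrow> 0" by simp
  qed
  then have "(\<lambda>n. L ?y - e n) \<longlonglongrightarrow> L ?y - 0" by (intro tendsto_intros)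
  then have "L ?y \<in> X"
    using closed_sequentially[OF closed_subspace[OF X(1)], of "\<lambda>n. L ?y - e n"] in_X by simp
  moreover have "g ?y \<in> X" using g(1) x by blast
  ultimately have "g ?y - L ?y \<in> X" using subspace_diff[OF X(1)] by metis
  then show ?thesis using gy[of ?y] x by simp
qed

text \<open>A nonzero integer vector orthogonal to \<open>X\<close> cannot be orthogonal to
  \<open>U\<close> by \<open>nonresonance\<close>, so \<open>U\<close> is not contained in
  \<open>X\<close>. A unit vector of \<open>U\<close> orthogonal to the intersection of
  \<open>X\<close> and \<open>U\<close> works, because \<open>pu\<close> maps the invariant subspace
  \<open>X\<close> into that intersection.\<close>

lemma proper_invariant_subspace_avoids_unit_vector:
  assumes X: "subspace X" "\<And>x. x \<in> X \<Longrightarrow> A x \<in> X" and Y: "X = span Y" "Y \<subseteq> int_vectors" and proper: "X \<noteq> UNIV"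
  obtains u where "u \<in> U" "norm u = 1" "\<And>x. x \<in> X \<Longrightarrow> 1 \<le> norm (pu (u - x))"
proof -
  obtain k where k: "k \<in> int_vectors" "k \<noteq> 0" "\<And>x. x \<in> X \<Longrightarrow> k \<bullet> x = 0"
    using int_vector_orthogonal_to_proper_subspace[OF Y(2)] proper Y(1) by auto
  have sub: "subspace (X \<inter> U)" using X(1) subspaceU by (rule subspace_inter)
  have "\<not> U \<subseteq> X" using nonresonance[OF k(1)] k(2,3) by blast
  then have "span (X \<inter> U) \<subset> span U"
    using sub subspaceU by (simp add: span_eq_iff[THEN iffD2]) blast
  then obtain y where y: "y \<noteq> 0" "y \<in> span U" "\<And>x. x \<in> span (X \<inter> U) \<Longrightarrow> orthogonal y x"
    using orthogonal_to_subspace_exists_gen by metis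
  define u where "u = y /\<^sub>R norm y"
  have uU: "u \<in> U" using y(2) subspaceU unfolding u_def by (auto simp: span_eq_iff[THEN iffD2] intro: subspace_scale)
  have nu: "norm u = 1" using y(1) by (simp add: u_def)
  show ?thesis
  proof (rule that[OF uU nu])
    fix x assume x: "x \<in> X"
    have "pu x \<in> X \<inter> U" using invariant_subspace_pu[OF X x] pu by blast
    then have "orthogonal u (pu x)"
      using y(3)[OF span_base, of "pu x"] unfolding u_def orthogonal_def by simp
    then have "(norm (u - pu x))\<^sup>2 = (norm u)\<^sup>2 + (norm (pu x))\<^sup>2"
      unfolding orthogonal_def by (simp add: power2_norm_eq_inner inner_diff inner_commute)
    then have "1 \<le> (norm (u - pu x))\<^sup>2" using nu by simp
    then have "1 \<le> norm (u - pu x)" using power2_le_imp_le[of 1 "norm (u - pu x)"] by simp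
    then show "1 \<le> norm (pu (u - x))" by (simp add: linear_diff[OF linpu] pu_U[OF uU])
  qed
qed

section \<open>Lattice points long in \<open>U\<close> and short in \<open>W\<close>, and the
  covering of the space by them\<close>

definition lattice_box :: "real \<Rightarrow> real \<Rightarrow> (real^'n) set"
  where "lattice_box R \<delta> = {x \<in> int_vectors. norm (pu x) \<le> R \<and> norm (pw x) \<le> \<delta>}"

lemma lattice_box_mono: "R \<le> R' \<Longrightarrow> \<delta> \<le> \<delta>' \<Longrightarrow> lattice_box R \<delta> \<subseteq> lattice_box R' \<delta>'"
  by (auto simp: lattice_box_def)

text \<open>The spans of the boxes with sides \<open>K\<^sup>iR\<close> and \<open>K\<^sup>i\<delta>\<close> increase with \<open>i\<close>, so if none of the first
  ones is the whole space, one of them is \<open>A\<close>-invariant; simultaneous approximation of a suitable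
  unit vector of \<open>U\<close> then gives a lattice point of the smallest box outside of it.\<close>

lemma lattice_box_spans:
  assumes K: "K \<ge> 1" "\<And>x. norm (A x) \<le> K * norm x"
    and K0: "K0 > 0" "\<And>x. norm (pu x) \<le> K0 * norm x" "\<And>x. norm (pw x) \<le> K0 * norm x"
    and \<delta>: "0 < \<delta>" "\<delta> \<le> 1" and L: "L > 0" "K0 * real CARD('n) / real L \<le> \<delta> / 2"
  shows "span (lattice_box (K ^ CARD('n) * (real L ^ CARD('n) + 1)) (K ^ CARD('n) * \<delta>)) = UNIV"
proof (rule ccontr)
  let ?R = "real L ^ CARD('n) + 1"
  define X where "X i = span (lattice_box (K ^ i * ?R) (K ^ i * \<delta>))" for i
  assume "\<not> ?thesis"
  then have notU: "X (CARD('n)) \<noteq> UNIV" by (simp add: X_def)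
  have mono: "X i \<subseteq> X j" if "i \<le> j" for i j
    unfolding X_def using K(1) \<delta> that
    by (intro span_mono lattice_box_mono mult_right_mono power_increasing) auto
  have proper: "X i \<noteq> UNIV" if "i \<le> CARD('n)" for i
    using mono[OF that] notU by auto
  \<comment> \<open>Otherwise each of the d inclusions raises the dimension by at least one, and the
    last span is the whole space.\<close>
  have "\<exists>i<CARD('n). X (Suc i) = X i"
  proof (rule ccontr)
    assume *: "\<not> ?thesis"
    have "i \<le> CARD('n) \<Longrightarrow> i \<le> dim (X i)" for i
    proof (induction i)
      case (Suc i)
      have "X i \<noteq> X (Suc i)" using * Suc.prems by (metis Suc_le_eq)
      then have "\<not> dim (X (Suc i)) \<le> dim (X i)"
        using subspace_dim_equal[of "X i" "X (Suc i)"] mono[of i "Suc i"] unfolding X_def by auto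
      then show ?case using Suc by simp
    qed simp
    from this[of "CARD('n)"] have "dim (X CARD('n)) = DIM(real^'n)"
      using dim_subset_UNIV[of "X CARD('n)"] by simp
    then have "span (X CARD('n)) = UNIV" by (simp only: dim_eq_full)
    then show False using notU unfolding X_def by (simp only: span_span)
  qed
  then obtain i where i: "i < CARD('n)" "X (Suc i) = X i" by blast
  \<comment> \<open>\<open>A\<close> sends each box into the next one, as \<open>K\<close> bounds
    its norm and it commutes with both projections; and the next span is the same.\<close>
  have inv: "A x \<in> X i" if "x \<in> X i" for x
  proof -
    have "A ` X i = span (A ` lattice_box (K ^ i * ?R) (K ^ i * \<delta>))"
      unfolding X_def by (rule linear_span_image[OF linA, symmetric])
    also have "\<dots> \<subseteq> X (Suc i)" unfolding X_def
    proof (rule span_mono, rule image_subsetI)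
      fix x assume x: "x \<in> lattice_box (K ^ i * ?R) (K ^ i * \<delta>)"
      have "norm (A (pu x)) \<le> K * (K ^ i * ?R)"
        using x K by (intro order_trans[OF K(2)] mult_left_mono) (auto simp: lattice_box_def)
      moreover have "norm (A (pw x)) \<le> K * (K ^ i * \<delta>)"
        using x K by (intro order_trans[OF K(2)] mult_left_mono) (auto simp: lattice_box_def)
      ultimately show "A x \<in> lattice_box (K ^ Suc i * ?R) (K ^ Suc i * \<delta>)"
        using x A_int by (simp add: lattice_box_def pu_commute pw_commute mult.assoc)
    qed
    finally show ?thesis using i that by blast
  qed
  obtain u where u: "u \<in> U" "norm u = 1" "\<And>x. x \<in> X i \<Longrightarrow> 1 \<le> norm (pu (u - x))"
    using proper_invariant_subspace_avoids_unit_vector[of "X i" "lattice_box (K ^ i * ?R) (K ^ i * \<delta>)"] inv proper[of i] i(1)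
    unfolding X_def lattice_box_def by (auto simp: X_def)
  obtain j m where jm: "1 \<le> j" "j \<le> L ^ CARD('n)" "m \<in> int_vectors"
    "norm (real j *\<^sub>R u - m) \<le> real CARD('n) / real L"
    using simultaneous_approximation[OF L(1)] by metis
  let ?s = "real j *\<^sub>R u - m"
  have s: "K0 * norm ?s \<le> \<delta> / 2"
    using mult_left_mono[OF jm(4), of K0] K0(1) L(2) by (simp only: times_divide_eq_right) linarith
  have m: "m = real j *\<^sub>R u - ?s" by simp
  have "pw m = - pw ?s"
    by (subst m) (simp add: linear_diff[OF linpw] linear_cmul[OF linpw] pw_U[OF u(1)])
  then have pwm: "norm (pw m) \<le> \<delta>" using K0(3)[of ?s] s \<delta> by simp
  have "pu m = real j *\<^sub>R u - pu ?s"
    by (subst m) (simp add: linear_diff[OF linpu] linear_cmul[OF linpu] pu_U[OF u(1)])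
  then have "norm (pu m) \<le> norm (real j *\<^sub>R u) + norm (pu ?s)" by (metis norm_triangle_ineq4)
  also have "\<dots> \<le> real j + \<delta> / 2" using K0(2)[of ?s] s u(2) by simp
  also have "\<dots> \<le> ?R"
  proof -
    have "real j \<le> real (L ^ CARD('n))" using jm(2) by (simp only: of_nat_le_iff)
    then show ?thesis unfolding of_nat_power using \<delta> by linarith
  qed
  finally have pum: "norm (pu m) \<le> ?R" .
  have "m \<in> lattice_box (K ^ 0 * ?R) (K ^ 0 * \<delta>)" using pum pwm jm(3) by (simp add: lattice_box_def)
  then have "m \<in> X 0" unfolding X_def by (rule span_base)
  then have "m \<in> X i" using mono[of 0 i] by blast
  \<comment> \<open>The span is closed under division by \<open>j\<close>. The quotient differs from
    \<open>u\<close>, as seen by \<open>pu\<close>, by at most \<delta>/2, which contradicts the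
    distance 1.\<close>
  then have "(1 / real j) *\<^sub>R m \<in> X i" unfolding X_def by (rule span_scale)
  from u(3)[OF this] have "1 \<le> norm (pu (u - (1 / real j) *\<^sub>R m))" .
  also have "u - (1 / real j) *\<^sub>R m = (1 / real j) *\<^sub>R ?s" using jm(1) by (simp add: scaleR_diff_right)
  also have "norm (pu \<dots>) = norm (pu ?s) / real j" using jm(1) by (simp add: linear_cmul[OF linpu])
  also have "\<dots> \<le> norm (pu ?s) / 1" using jm(1) by (intro divide_left_mono) auto
  also have "\<dots> \<le> \<delta> / 2" using K0(2)[of ?s] s by simp
  finally show False using \<delta> by simp
qed

text \<open>The small box contains a basis of the space. Rounding down the coordinates of
  \<open>t\<close> in this basis leaves a lattice point and a combination of d box vectors with
  coefficients in [0, 1), so the remainder has \<open>pu\<close> and \<open>pw\<close> parts at most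
  d times the sides of the box.\<close>

theorem density:
  obtains C where "C > 0"
    "\<And>\<delta> t. 0 < \<delta> \<Longrightarrow> \<delta> \<le> 1 \<Longrightarrow>
      \<exists>m\<in>int_vectors. \<exists>w\<in>U. \<exists>b\<in>W. t = m + w + b \<and> norm w \<le> C / \<delta> ^ CARD('n) \<and> norm b \<le> \<delta>"
proof -
  let ?d = "CARD('n)"
  obtain K1 where K1: "K1 > 0" "\<And>x. norm (A x) \<le> K1 * norm x" using linear_bounded_pos[OF linA] by blast
  define K where "K = max 1 K1"
  have K: "K \<ge> 1" "norm (A x) \<le> K * norm x" for x
    using K1(2)[of x] mult_right_mono[of K1 K "norm x"] by (auto simp: K_def)
  obtain K2 where K2: "K2 > 0" "\<And>x. norm (pu x) \<le> K2 * norm x" using linear_bounded_pos[OF linpu] by blast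
  obtain K3 where K3: "K3 > 0" "\<And>x. norm (pw x) \<le> K3 * norm x" using linear_bounded_pos[OF linpw] by blast
  define K0 where "K0 = max K2 K3"
  have K0: "K0 > 0" "norm (pu x) \<le> K0 * norm x" "norm (pw x) \<le> K0 * norm x" for x
    using K2(1) K2(2)[of x] mult_right_mono[of K2 K0 "norm x"] K3(2)[of x] mult_right_mono[of K3 K0 "norm x"]
    by (auto simp: K0_def)
  \<comment> \<open>Chosen so that the integer \<open>L\<close> below is at most
    \<open>Q / \<delta>\<close>; the summand 1 pays for rounding up. The power d in the bound for
    \<open>w\<close> is that of the multiplier in Dirichlet's theorem.\<close>
  define Q where "Q = 2 * K0 * ?d * (?d * K ^ ?d) + 1"
  define C where "C = ?d * K ^ ?d * (2 * Q ^ ?d)"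
  have Kd: "K ^ ?d \<ge> 1" using K(1) by simp
  have d1: "real ?d \<ge> 1" by (simp add: Suc_leI)
  have Q1: "Q \<ge> 1" using K0(1) Kd by (simp add: Q_def)
  show ?thesis
  proof (rule that[of C])
    show "C > 0" using K(1) Q1 d1 unfolding C_def by (intro mult_pos_pos) auto
    fix \<delta> :: real and t :: "real^'n" assume \<delta>: "0 < \<delta>" "\<delta> \<le> 1"
    \<comment> \<open>The factor \<open>K ^ ?d\<close> is lost in making the span invariant, and the
      factor d in adding up the basis vectors.\<close>
    define \<delta>' where "\<delta>' = \<delta> / (?d * K ^ ?d)"
    have dK: "?d * K ^ ?d \<ge> 1" using mult_mono[OF d1 Kd] by simp
    have \<delta>': "0 < \<delta>'" "\<delta>' \<le> 1" "?d * K ^ ?d * \<delta>' = \<delta>"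
    proof -
      show "0 < \<delta>'" using \<delta> dK by (simp add: \<delta>'_def)
      show "\<delta>' \<le> 1" using \<delta> dK unfolding \<delta>'_def by (subst divide_le_eq) auto
      show "?d * K ^ ?d * \<delta>' = \<delta>" using K(1) by (simp add: \<delta>'_def)
    qed
    define y where "y = 2 * K0 * ?d / \<delta>'"
    define L where "L = nat \<lceil>y\<rceil>"
    have y: "y > 0" using K0(1) \<delta>' by (simp add: y_def)
    have L: "L > 0" "real L \<ge> y" "real L \<le> y + 1" using y unfolding L_def by linarith+
    have "K0 * real ?d / real L \<le> K0 * real ?d / y"
      using L y K0(1) by (intro divide_left_mono) auto
    also have "\<dots> = \<delta>' / 2" using K0(1) \<delta>' by (simp add: y_def)
    finally have sp: "span (lattice_box (K ^ ?d * (real L ^ ?d + 1)) (K ^ ?d * \<delta>')) = UNIV"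
      using lattice_box_spans[OF K K0 \<delta>'(1,2) L(1)] by blast
    have "y = 2 * K0 * ?d * (?d * K ^ ?d) / \<delta>" unfolding y_def \<delta>'_def by simp
    then have "y + 1 \<le> Q / \<delta>" using \<delta> by (simp add: Q_def field_simps)
    then have "real L \<le> Q / \<delta>" using L(3) by simp
    then have "real L ^ ?d \<le> (Q / \<delta>) ^ ?d" by (intro power_mono) auto
    moreover have "1 \<le> (Q / \<delta>) ^ ?d" using Q1 \<delta> by (intro one_le_power) (simp add: field_simps)
    ultimately have LQ: "real L ^ ?d + 1 \<le> 2 * Q ^ ?d / \<delta> ^ ?d" by (simp add: power_divide)
    let ?Y = "lattice_box (K ^ ?d * (real L ^ ?d + 1)) (K ^ ?d * \<delta>')"
    obtain B where B: "B \<subseteq> ?Y" "independent B" "?Y \<subseteq> span B"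
      using maximal_independent_subset[of ?Y] by blast
    have "span B = UNIV" using sp B by (metis span_mono span_span top.extremum_uniqueI)
    then have cB: "card B = ?d" "finite B"
      using B(2) dim_eq_card_independent[OF B(2)] dim_span[of B] independent_imp_finite by auto
    obtain c where c: "t = (\<Sum>b\<in>B. c b *\<^sub>R b)"
      using \<open>span B = UNIV\<close> span_finite[OF cB(2)] by blast
    define m where "m = (\<Sum>b\<in>B. of_int \<lfloor>c b\<rfloor> *\<^sub>R b)"
    define s where "s = (\<Sum>b\<in>B. frac (c b) *\<^sub>R b)"
    have t: "t = m + s" unfolding c m_def s_def
      by (simp add: frac_def scaleR_diff_left flip: sum.distrib)
    have m: "m \<in> int_vectors"
      unfolding m_def using B(1) by (intro int_vectors_sum int_vectors_scale) (auto simp: lattice_box_def)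
    have bound: "norm (f s) \<le> ?d * r" if f: "linear f" "\<And>b. b \<in> B \<Longrightarrow> norm (f b) \<le> r" for f :: "real^'n \<Rightarrow> real^'n" and r :: real
    proof -
      have "norm (f s) \<le> (\<Sum>b\<in>B. norm (frac (c b) *\<^sub>R f b))"
        unfolding s_def linear_sum[OF f(1)] linear_cmul[OF f(1)] by (rule norm_sum)
      also have "\<dots> \<le> (\<Sum>b\<in>B. 1 * r)"
      proof (rule sum_mono)
        fix b assume "b \<in> B"
        then show "norm (frac (c b) *\<^sub>R f b) \<le> 1 * r"
          using mult_mono[of "frac (c b)" 1 "norm (f b)" r] f(2) frac_lt_1[of "c b"] by simp
      qed
      finally show ?thesis using cB by simp
    qed
    have "norm (pu s) \<le> ?d * (K ^ ?d * (real L ^ ?d + 1))"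
      using B(1) by (intro bound[OF linpu]) (auto simp: lattice_box_def)
    also have "\<dots> \<le> ?d * (K ^ ?d * (2 * Q ^ ?d / \<delta> ^ ?d))"
      using LQ K(1) by (intro mult_left_mono) auto
    also have "\<dots> = C / \<delta> ^ ?d" by (simp add: C_def)
    finally have pus: "norm (pu s) \<le> C / \<delta> ^ ?d" .
    have "norm (pw s) \<le> ?d * (K ^ ?d * \<delta>')"
      using B(1) by (intro bound[OF linpw]) (auto simp: lattice_box_def)
    then have pws: "norm (pw s) \<le> \<delta>" using \<delta>'(3) by (simp add: mult.assoc)
    have "t = m + pu s + pw s" using t pu_pw[of s] by (simp add: add.assoc)
    then show "\<exists>m\<in>int_vectors. \<exists>w\<in>U. \<exists>b\<in>W. t = m + w + b \<and> norm w \<le> C / \<delta> ^ ?d \<and> norm b \<le> \<delta>"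
      using m pus pws pu[of s] pw[of s] by blast
  qed
qed

end

section \<open>Haar measure on the torus\<close>

lemma abs_torus_eq_iff: "abs_torus x = abs_torus y \<longleftrightarrow> x - y \<in> int_vectors"
  by (simp add: torus.abs_eq_iff int_vectors_def)

lemma abs_torus_add: "abs_torus x + abs_torus y = abs_torus (x + y)"
  by (simp add: plus_torus.abs_eq)

lemma abs_torus_uminus: "- abs_torus x = abs_torus (- x)"
  by (simp add: uminus_torus.abs_eq)

lemma torus_map_abs: "torus_map S (abs_torus x) = abs_torus (map_matrix real_of_int S *v x)"
  by (simp add: torus_map.abs_eq)

definition cube :: "(real^'n) set"
  where "cube = {x. \<forall>i. 0 \<le> x $ i \<and> x $ i < 1}"

lift_definition torus_rep :: "'n::finite torus \<Rightarrow> real^'n" is "\<lambda>x. \<chi> i. frac (x $ i)"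
proof -
  fix x y :: "real^'n" assume *: "\<And>i. x $ i - y $ i \<in> \<int>"
  have "frac (x $ i) = frac (y $ i)" for i
  proof -
    obtain m where "x $ i - y $ i = of_int m" using *[of i] by (elim Ints_cases)
    then have "x $ i = y $ i + of_int m" by simp
    then show ?thesis by (simp add: frac_def)
  qed
  then show "(\<chi> i. frac (x $ i)) = (\<chi> i. frac (y $ i))" by simp
qed

lemma torus_rep_abs: "torus_rep (abs_torus x) = (\<chi> i. frac (x $ i))"
  by (simp add: torus_rep.abs_eq)

lemma torus_rep_cube: "torus_rep x \<in> cube"
  by transfer (simp add: cube_def frac_lt_1)

lemma abs_torus_rep [simp]: "abs_torus (torus_rep x) = x"
proof (induction x rule: torus.abs_induct)
  case (1 y)
  then show ?case by (auto simp: torus_rep_abs abs_torus_eq_iff int_vectors_def frac_def)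
qed

lemma torus_rep_abs_cube: "x \<in> cube \<Longrightarrow> torus_rep (abs_torus x) = x"
  by (simp add: torus_rep_abs vec_eq_iff cube_def frac_eq)

lemma cube_diff_int: "x \<in> cube \<Longrightarrow> y \<in> cube \<Longrightarrow> x - y \<in> int_vectors \<Longrightarrow> x = y"
  by (metis abs_torus_eq_iff torus_rep_abs_cube)

lemma abs_torus_add_int: "m \<in> int_vectors \<Longrightarrow> abs_torus (m + x) = abs_torus x"
  by (simp add: abs_torus_eq_iff)

lemma continuous_on_abs_torus: "continuous_on UNIV abs_torus"
  by (simp add: continuous_on_open_vimage open_torus_def)

lemma borel_measurable_abs_torus [measurable]: "abs_torus \<in> borel_measurable borel"
  by (rule borel_measurable_continuous_onI[OF continuous_on_abs_torus])

lemma open_frac_less: "open {x::real^'n. 0 < frac (x $ i) \<and> frac (x $ i) < a}"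
proof -
  have "{x::real^'n. 0 < frac (x $ i) \<and> frac (x $ i) < a}
    = (\<Union>m::int. {x. of_int m < x $ i} \<inter> {x. x $ i < of_int m + min a 1})"
  proof (intro set_eqI iffI)
    fix x :: "real^'n" assume "x \<in> {x. 0 < frac (x $ i) \<and> frac (x $ i) < a}"
    then show "x \<in> (\<Union>m::int. {x. of_int m < x $ i} \<inter> {x. x $ i < of_int m + min a 1})"
      using frac_lt_1[of "x $ i"] by (intro UN_I[of "\<lfloor>x $ i\<rfloor>"]) (auto simp: frac_def)
  next
    fix x :: "real^'n" assume "x \<in> (\<Union>m::int. {x. of_int m < x $ i} \<inter> {x. x $ i < of_int m + min a 1})"
    then obtain m :: int where m: "of_int m < x $ i" "x $ i < of_int m + min a 1" by auto
    then have "\<lfloor>x $ i\<rfloor> = m" by linarith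
    then show "x \<in> {x. 0 < frac (x $ i) \<and> frac (x $ i) < a}" using m by (auto simp: frac_def)
  qed
  moreover have "open (\<Union>m::int. {x::real^'n. of_int m < x $ i} \<inter> {x. x $ i < of_int m + min a 1})"
    by (intro open_UN ballI open_Int open_Collect_less continuous_intros)
  ultimately show ?thesis by simp
qed

text \<open>A component of the representative jumps where it is 0. The sets on which it lies
  strictly between 0 and a bound are open in the quotient topology, and its zero set is the
  complement of such a set with bound 1.\<close>

lemma borel_measurable_torus_rep [measurable]: "torus_rep \<in> borel_measurable borel"
proof -
  have "(\<lambda>x. torus_rep x $ i) \<in> borel_measurable borel" for i
  proof (subst borel_measurable_iff_less, intro allI)
    fix a :: real
    let ?O = "\<lambda>a. {x. 0 < torus_rep x $ i \<and> torus_rep x $ i < a}"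
    have op: "open (?O a)" for a
      unfolding open_torus_def using open_frac_less[of i a]
      by (simp add: vimage_def torus_rep_abs)
    have *: "torus_rep x $ i < a \<longleftrightarrow> x \<in> ?O a \<or> (0 < a \<and> x \<notin> ?O 1)" for x
    proof -
      have "0 \<le> torus_rep x $ i" "torus_rep x $ i < 1" using torus_rep_cube[of x] by (auto simp: cube_def)
      then show ?thesis by auto
    qed
    have "{x. torus_rep x $ i < a} = ?O a \<union> (if 0 < a then - ?O 1 else {})"
      using * by (auto split: if_splits)
    also have "\<dots> \<in> sets borel" using op by auto
    finally show "{w \<in> space borel. torus_rep w $ i < a} \<in> sets borel" by simp
  qed
  then show ?thesis
    by (subst borel_measurable_euclidean_space) (auto simp: Basis_vec_def inner_axis)
qed

lemma borel_measurable_torus_add [measurable]: "(\<lambda>(x, y). x + y :: 'n::finite torus) \<in> borel_measurable (borel \<Otimes>\<^sub>M borel)"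
proof -
  have "(\<lambda>z. abs_torus (torus_rep (fst z) + torus_rep (snd z :: 'n torus))) \<in> borel_measurable (borel \<Otimes>\<^sub>M borel)"
    by measurable
  then show ?thesis by (simp flip: abs_torus_add add: case_prod_beta)
qed

lemma borel_measurable_torus_translate [measurable]: "(\<lambda>x::'n::finite torus. x + a) \<in> borel_measurable borel"
proof -
  have "(\<lambda>x. abs_torus (torus_rep x + torus_rep a)) \<in> borel_measurable borel"
    by measurable
  then show ?thesis by (simp flip: abs_torus_add)
qed

lemma borel_measurable_torus_map [measurable]: "torus_map S \<in> borel_measurable borel"
proof -
  have "(\<lambda>x. abs_torus (map_matrix real_of_int S *v torus_rep x)) \<in> borel_measurable borel"
    by (intro measurable_compose[OF _ borel_measurable_abs_torus]
      measurable_compose[OF borel_measurable_torus_rep] borel_measurable_continuous_onI continuous_intros)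
  then show ?thesis by (simp flip: torus_map_abs)
qed

lemma cube_borel [measurable]: "(cube :: (real^'n) set) \<in> sets borel"
proof -
  have "cube = (\<Inter>i. {x::real^'n. 0 \<le> x $ i} \<inter> {x. x $ i < 1})" by (auto simp: cube_def)
  also have "\<dots> \<in> sets borel"
    by (intro sets.countable_INT' sets.Int borel_closed borel_open closed_Collect_le open_Collect_less continuous_intros) auto
  finally show ?thesis .
qed

lemma sets_torus_measure [simp, measurable_cong]: "sets torus_measure = sets borel"
  and space_torus_measure [simp]: "space torus_measure = UNIV"
  by (simp_all add: torus_measure_def)

lemma emeasure_torus_measure:
  assumes [measurable]: "A \<in> sets borel"
  shows "emeasure torus_measure A = emeasure lborel (cube \<inter> abs_torus -` A)"
proof -
  have "abs_torus \<in> borel_measurable (restrict_space lborel cube)"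
    by (rule measurable_restrict_space1) simp
  moreover have "abs_torus -` A \<in> sets borel"
    using measurable_sets[OF borel_measurable_abs_torus, of A] by simp
  ultimately show ?thesis
    unfolding torus_measure_def cube_def[symmetric]
    by (subst emeasure_distr) (simp_all add: emeasure_restrict_space space_restrict_space Int_commute)
qed

lemma emeasure_cube: "emeasure lborel (cube :: (real^'n::finite) set) = 1"
proof -
  let ?one = "(\<chi> i. 1) :: real^'n"
  have "box 0 ?one \<subseteq> cube" "cube \<subseteq> cbox 0 ?one"
    by (auto simp: cube_def mem_box_cart less_imp_le)
  then have "emeasure lborel (box 0 ?one) \<le> emeasure lborel (cube :: (real^'n) set)"
    "emeasure lborel (cube :: (real^'n) set) \<le> emeasure lborel (cbox 0 ?one)"
    by (intro emeasure_mono; simp)+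
  moreover have "(\<Prod>b\<in>Basis. ?one \<bullet> b) = 1"
    by (intro prod.neutral) (auto simp: Basis_vec_def inner_axis)
  moreover have "\<forall>b\<in>Basis. 0 \<le> ?one \<bullet> b"
    by (auto simp: Basis_vec_def inner_axis)
  ultimately show ?thesis
    by (simp add: emeasure_lborel_box_eq emeasure_lborel_cbox_eq)
qed

lemma prob_space_torus: "prob_space torus_measure"
  by standard (simp add: emeasure_torus_measure emeasure_cube)

interpretation torus: prob_space torus_measure
  by (rule prob_space_torus)

lemma countable_int_vectors: "countable (int_vectors :: (real^'n::finite) set)"
proof -
  have "int_vectors \<subseteq> range (\<lambda>f::'n \<Rightarrow> int. \<chi> i. real_of_int (f i))"
  proof
    fix x :: "real^'n" assume "x \<in> int_vectors"
    then show "x \<in> range (\<lambda>f::'n \<Rightarrow> int. \<chi> i. real_of_int (f i))"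
      by (intro range_eqI[where x = "\<lambda>i. \<lfloor>x $ i\<rfloor>"]) (simp add: int_vectors_def vec_eq_iff)
  qed
  then show ?thesis by (rule countable_subset) simp
qed

text \<open>The cube is cut according to the integer vector \<open>m\<close> that brings x + a back
  into it. On each piece the translation is x + (a - m) in the space itself, where Lebesgue measure
  is invariant, and there are countably many pieces.\<close>

lemma emeasure_torus_translate:
  fixes A :: "'n::finite torus set"
  assumes A [measurable]: "A \<in> sets borel"
  shows "emeasure torus_measure ((\<lambda>x. x + abs_torus a) -` A) = emeasure torus_measure A"
proof -
  have P [measurable]: "abs_torus -` A \<in> sets borel"
    using measurable_sets[OF borel_measurable_abs_torus, of A] by simp
  define E where "E m = {x. x \<in> cube \<and> x + (a - m) \<in> cube \<and> abs_torus (x + (a - m)) \<in> A}" for m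
  define G where "G m = {y. y \<in> cube \<and> y - (a - m) \<in> cube \<and> abs_torus y \<in> A}" for m
  have setsE [measurable]: "E m \<in> sets borel" for m
  proof -
    have "E m = {x \<in> space borel. x \<in> cube \<and> x + (a - m) \<in> cube \<and> x + (a - m) \<in> abs_torus -` A}"
      by (auto simp: E_def)
    then show ?thesis by simp
  qed
  have setsG [measurable]: "G m \<in> sets borel" for m
  proof -
    have "G m = {x \<in> space borel. x \<in> cube \<and> x - (a - m) \<in> cube \<and> x \<in> abs_torus -` A}"
      by (auto simp: G_def)
    then show ?thesis by simp
  qed
  have EG: "emeasure lborel (E m) = emeasure lborel (G m)" for m
  proof -
    have "E m = (+) (a - m) -` G m" by (auto simp: E_def G_def add.commute)
    then have "emeasure lborel (E m) = emeasure (distr lborel borel ((+) (a - m))) (G m)"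
      by (subst emeasure_distr) auto
    then show ?thesis by (simp add: lborel_distr_plus)
  qed
  have ex: "\<exists>m\<in>int_vectors. x - m \<in> cube" for x :: "real^'n"
    by (rule bexI[of _ "\<chi> i. of_int \<lfloor>x $ i\<rfloor>"])
       (auto simp: cube_def int_vectors_def of_int_floor_le less_diff_eq, linarith)
  have uniq: "m = m'" if "m \<in> int_vectors" "m' \<in> int_vectors" "x - m \<in> cube" "x - m' \<in> cube" for x m m' :: "real^'n"
    using cube_diff_int[OF that(3,4)] int_vectors_diff[OF that(2,1)] by simp
  have disjE: "disjoint_family_on E int_vectors"
    unfolding disjoint_family_on_def E_def using uniq[where x="_ + a"] by (fastforce simp: algebra_simps)
  have disjG: "disjoint_family_on G int_vectors"
  proof -
    have "m = m'" if "m \<in> int_vectors" "m' \<in> int_vectors" "y - (a - m) \<in> cube" "y - (a - m') \<in> cube" for y m m'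
      using cube_diff_int[OF that(3,4)] int_vectors_diff[OF that(1,2)] by simp
    then show ?thesis unfolding disjoint_family_on_def G_def by blast
  qed
  have perE: "abs_torus (x + (a - m)) = abs_torus x + abs_torus a" if "m \<in> int_vectors" for x m
    using that int_vectors_diff[OF int_vectors_zero that]
    by (simp add: abs_torus_add abs_torus_eq_iff)
  have UE: "cube \<inter> abs_torus -` ((\<lambda>x. x + abs_torus a) -` A) = (\<Union>m\<in>int_vectors. E m)"
  proof (intro set_eqI iffI)
    fix x assume x: "x \<in> cube \<inter> abs_torus -` ((\<lambda>x. x + abs_torus a) -` A)"
    obtain m where "m \<in> int_vectors" "x + a - m \<in> cube" using ex by blast
    then show "x \<in> (\<Union>m\<in>int_vectors. E m)" using x perE by (auto simp: E_def add_diff_eq)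
  next
    fix x assume "x \<in> (\<Union>m\<in>int_vectors. E m)"
    then show "x \<in> cube \<inter> abs_torus -` ((\<lambda>x. x + abs_torus a) -` A)" using perE by (auto simp: E_def)
  qed
  have UG: "cube \<inter> abs_torus -` A = (\<Union>m\<in>int_vectors. G m)"
  proof (intro set_eqI iffI)
    fix x assume x: "x \<in> cube \<inter> abs_torus -` A"
    obtain m where m: "m \<in> int_vectors" "x - a - m \<in> cube" using ex by blast
    then have "- m \<in> int_vectors" using int_vectors_diff[OF int_vectors_zero m(1)] by simp
    then show "x \<in> (\<Union>m\<in>int_vectors. G m)" using x m by (auto simp: G_def algebra_simps intro!: bexI[of _ "- m"])
  qed (auto simp: G_def)
  have [measurable]: "(\<lambda>x. x + abs_torus a) -` A \<in> sets borel"
    using measurable_sets[OF borel_measurable_torus_translate, of A] by simp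
  have "emeasure torus_measure ((\<lambda>x. x + abs_torus a) -` A) = (\<integral>\<^sup>+m. emeasure lborel (E m) \<partial>count_space int_vectors)"
    by (simp add: emeasure_torus_measure UE)
       (intro emeasure_UN_countable countable_int_vectors disjE, simp)
  also have "\<dots> = (\<integral>\<^sup>+m. emeasure lborel (G m) \<partial>count_space int_vectors)" by (simp add: EG)
  also have "\<dots> = emeasure torus_measure A"
    by (simp add: emeasure_torus_measure UG)
       (intro emeasure_UN_countable[symmetric] countable_int_vectors disjG, simp)
  finally show ?thesis .
qed

lemma distr_torus_translate:
  fixes a :: "'n::finite torus"
  shows "distr torus_measure torus_measure (\<lambda>x. x + a) = torus_measure"
proof (rule measure_eqI)
  fix A assume "A \<in> sets (distr torus_measure torus_measure (\<lambda>x. x + a))"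
  then have A: "A \<in> sets borel" by simp
  obtain b where b: "a = abs_torus b" by (metis abs_torus_rep)
  have "(\<lambda>x. x + a) \<in> torus_measure \<rightarrow>\<^sub>M torus_measure"
    by (simp add: measurable_cong_sets[OF sets_torus_measure sets_torus_measure])
  then show "emeasure (distr torus_measure torus_measure (\<lambda>x. x + a)) A = emeasure torus_measure A"
    using A emeasure_torus_translate[OF A, of b] b by (simp add: emeasure_distr)
qed simp

lemma integral_torus_translate:
  fixes f :: "'n::finite torus \<Rightarrow> real"
  assumes "f \<in> borel_measurable borel"
  shows "(\<integral>x. f (x + a) \<partial>torus_measure) = (\<integral>x. f x \<partial>torus_measure)"
proof -
  have "(\<integral>x. f x \<partial>torus_measure) = (\<integral>x. f x \<partial>distr torus_measure torus_measure (\<lambda>x. x + a))"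
    by (simp add: distr_torus_translate)
  also have "\<dots> = (\<integral>x. f (x + a) \<partial>torus_measure)"
    using assms by (subst integral_distr)
      (simp_all add: measurable_cong_sets[OF sets_torus_measure sets_torus_measure] measurable_cong_sets[OF sets_torus_measure refl])
  finally show ?thesis by simp
qed

section \<open>Real characters of the torus and an obstruction to ergodicity\<close>

definition torus_cos :: "real^'n \<Rightarrow> 'n::finite torus \<Rightarrow> real"
  where "torus_cos k x = cos (2 * pi * (k \<bullet> torus_rep x))"

lemma int_vectors_inner: "k \<in> int_vectors \<Longrightarrow> x \<in> int_vectors \<Longrightarrow> k \<bullet> x \<in> \<int>"
  by (auto simp: int_vectors_def inner_vec_def)

lemma cos_int_period: "n \<in> \<int> \<Longrightarrow> cos (2 * pi * (x + n)) = cos (2 * pi * x)"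
  by (auto simp: Ints_def distrib_left cos_add sin_int_2pin cos_int_2pin)

lemma torus_cos_abs:
  assumes "k \<in> int_vectors"
  shows "torus_cos k (abs_torus x) = cos (2 * pi * (k \<bullet> x))"
proof -
  have "torus_rep (abs_torus x) - x \<in> int_vectors" by (simp flip: abs_torus_eq_iff)
  then have "k \<bullet> (torus_rep (abs_torus x) - x) \<in> \<int>" using assms by (intro int_vectors_inner)
  from cos_int_period[OF this, of "k \<bullet> x"] show ?thesis
    by (simp add: torus_cos_def flip: inner_add_right)
qed

lemma borel_measurable_torus_cos [measurable]: "torus_cos k \<in> borel_measurable borel"
  unfolding torus_cos_def by measurable

text \<open>A translation by a vector \<open>t\<close> with inner product 1/2 with \<open>k\<close>
  changes the sign of the cosine but not the integral.\<close>

lemma integral_torus_cos: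
  fixes k :: "real^'n::finite"
  assumes k: "k \<in> int_vectors" "k \<noteq> 0"
  shows "(\<integral>x. torus_cos k x \<partial>torus_measure) = 0"
proof -
  define t where "t = (1 / (2 * (k \<bullet> k))) *\<^sub>R k"
  have t: "k \<bullet> t = 1 / 2" using k(2) by (simp add: t_def)
  have "torus_cos k (x + abs_torus t) = - torus_cos k x" for x
  proof -
    have "torus_cos k (x + abs_torus t) = cos (2 * pi * (k \<bullet> (torus_rep x + t)))"
      using torus_cos_abs[OF k(1), of "torus_rep x + t"] by (simp flip: abs_torus_add)
    also have "2 * pi * (k \<bullet> (torus_rep x + t)) = 2 * pi * (k \<bullet> torus_rep x) + pi"
      by (simp add: inner_add_right t distrib_left)
    finally show ?thesis by (simp add: torus_cos_def)
  qed
  then show ?thesis using integral_torus_translate[of "torus_cos k" "abs_torus t"] by simp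
qed

text \<open>Composition with the map replaces the frequency \<open>k\<close> by \<open>B k\<close>,
  so the sum of cosines along the periodic orbit of \<open>l\<close> is invariant. It is continuous,
  positive at the origin and has mean zero, so the set where it is positive has neither measure 0
  nor full measure.\<close>

lemma periodic_int_vector_not_ergodic:
  fixes S :: "int^'n::finite^'n" and l :: "real^'n"
  defines "B \<equiv> (*v) (transpose (map_matrix real_of_int S))"
  assumes l: "l \<in> int_vectors" "l \<noteq> 0" and P: "P > 0" "(B ^^ P) l = l"
  shows "\<not> ergodic torus_measure (torus_map S)"
proof
  assume erg: "ergodic torus_measure (torus_map S)"
  have B_int: "B x \<in> int_vectors" if "x \<in> int_vectors" for x
    using that unfolding B_def int_vectors_def
    by (auto simp: matrix_vector_mult_def transpose_def intro!: Ints_sum Ints_mult)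
  have Bl: "(B ^^ j) l \<in> int_vectors" for j using B_int l(1) by (intro funpow_invariant)
  have Bl0: "(B ^^ j) l \<noteq> 0" if "j < P" for j
  proof
    assume "(B ^^ j) l = 0"
    then have "(B ^^ (P - j)) ((B ^^ j) l) = 0"
      using linear_0[OF linear_funpow[of B]] by (simp add: B_def)
    moreover have "(B ^^ (P - j)) ((B ^^ j) l) = (B ^^ P) l"
      using that by (metis comp_apply funpow_add le_add_diff_inverse2 less_imp_le)
    ultimately show False using P(2) l(2) by simp
  qed
  define g where "g x = (\<Sum>j<P. torus_cos ((B ^^ j) l) x)" for x
  have cosT: "torus_cos k (torus_map S x) = torus_cos (B k) x" if k: "k \<in> int_vectors" for k x
  proof -
    have "torus_cos k (torus_map S x) = torus_cos k (abs_torus (map_matrix real_of_int S *v torus_rep x))"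
      by (metis torus_map_abs abs_torus_rep)
    also have "\<dots> = cos (2 * pi * (B k \<bullet> torus_rep x))"
      using torus_cos_abs[OF k] by (simp add: B_def dot_lmul_matrix)
    finally show ?thesis by (simp add: torus_cos_def)
  qed
  have gT: "g (torus_map S x) = g x" for x
  proof -
    have "g (torus_map S x) = (\<Sum>j<P. torus_cos ((B ^^ Suc j) l) x)"
      by (simp add: g_def cosT Bl)
    also have "\<dots> = (\<Sum>j<Suc P. torus_cos ((B ^^ j) l) x) - torus_cos l x"
      by (subst sum.lessThan_Suc_shift) simp
    also have "\<dots> = g x" using P(2) by (simp add: g_def)
    finally show ?thesis .
  qed
  have [measurable]: "g \<in> borel_measurable borel" unfolding g_def by measurable
  have gabs: "g (abs_torus x) = (\<Sum>j<P. cos (2 * pi * ((B ^^ j) l \<bullet> x)))" for x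
    by (simp add: g_def torus_cos_abs Bl)
  have bnd: "\<bar>torus_cos k x\<bar> \<le> 1" for k x by (simp add: torus_cos_def)
  have int_cos: "integrable torus_measure (torus_cos k)" for k :: "real^'n"
    using bnd by (intro torus.integrable_const_bound[of _ 1]) (auto simp: measurable_cong_sets[OF sets_torus_measure refl])
  have int_g: "integrable torus_measure g" unfolding g_def by (intro Bochner_Integration.integrable_sum int_cos)
  have int_g0: "(\<integral>x. g x \<partial>torus_measure) = 0"
    unfolding g_def using integral_torus_cos[OF Bl Bl0] by (simp add: Bochner_Integration.integral_sum int_cos)
  let ?A = "{x. g x > 0}"
  have A: "?A \<in> sets torus_measure"
    using borel_measurable_iff_greater[of g borel] by simp
  have inv: "torus_map S -` ?A \<inter> space torus_measure = ?A" by (simp add: vimage_def gT)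
  have "?A \<in> null_sets torus_measure \<or> space torus_measure - ?A \<in> null_sets torus_measure"
    using erg A inv unfolding ergodic_def by blast
  then show False
  proof
    assume null: "?A \<in> null_sets torus_measure"
    let ?O = "{x::real^'n. \<forall>i. 0 < x $ i \<and> x $ i < 1} \<inter> {x. 0 < g (abs_torus x)}"
    have "{x::real^'n. \<forall>i. 0 < x $ i \<and> x $ i < 1} = (\<Inter>i. {x. 0 < x $ i} \<inter> {x. x $ i < 1})" by auto
    moreover have "open \<dots>"
      by (intro open_INT ballI open_Int open_Collect_less continuous_intros) auto
    moreover have "open {x::real^'n. 0 < g (abs_torus x)}"
      unfolding gabs by (intro open_Collect_less continuous_intros)
    ultimately have op: "open ?O" by (simp only: open_Int)
    \<comment> \<open>At the origin the sum equals \<open>P\<close>. The origin is only a corner of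
      the cube, so interior points with a positive value are sought on the diagonal.\<close>
    have "((\<lambda>c::real. g (abs_torus (c *\<^sub>R (\<chi> i. 1)))) \<longlongrightarrow> (\<Sum>j<P. cos (2 * pi * ((B ^^ j) l \<bullet> (0 *\<^sub>R (\<chi> i. 1)))))) (at_right 0)"
      unfolding gabs by (intro tendsto_intros)
    then have "eventually (\<lambda>c::real. 0 < g (abs_torus (c *\<^sub>R (\<chi> i. 1)))) (at_right 0)"
      by (rule order_tendstoD(1)) (use P(1) in simp)
    moreover have "eventually (\<lambda>c::real. c \<in> {0<..<1}) (at_right 0)"
      by (rule eventually_at_right_real) simp
    ultimately have "eventually (\<lambda>c::real. 0 < g (abs_torus (c *\<^sub>R (\<chi> i. 1))) \<and> c \<in> {0<..<1}) (at_right 0)"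
      by (rule eventually_conj)
    then obtain c :: real where "0 < g (abs_torus (c *\<^sub>R (\<chi> i. 1)))" "c \<in> {0<..<1}"
      using eventually_happens'[OF trivial_limit_at_right_real] by blast
    then have "c *\<^sub>R (\<chi> i. 1) \<in> ?O" by simp
    then have "?O \<noteq> {}" by blast
    have "emeasure lborel ?O \<le> emeasure lborel (cube \<inter> abs_torus -` ?A)"
    proof (rule emeasure_mono)
      have "abs_torus -` ?A \<in> sets borel"
        using measurable_sets[OF borel_measurable_abs_torus, of ?A] A by simp
      then show "cube \<inter> abs_torus -` ?A \<in> sets lborel" by simp
    qed (auto simp: cube_def less_imp_le)
    also have "\<dots> = emeasure torus_measure ?A" using A by (intro emeasure_torus_measure[symmetric]) simp
    also have "\<dots> = 0" using null by (simp add: null_sets_def)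
    finally have "emeasure lborel ?O = 0" by simp
    then have "?O \<in> null_sets lborel" using op by (simp only: null_setsI[of lborel ?O] sets_lborel borel_open)
    then have "negligible ?O" by (simp add: negligible_iff_null_sets null_sets_completionI)
    then show False using open_not_negligible[OF op \<open>?O \<noteq> {}\<close>] by simp
  next
    assume "space torus_measure - ?A \<in> null_sets torus_measure"
    then have "AE x in torus_measure. x \<notin> space torus_measure - ?A" by (rule AE_not_in)
    then have pos: "AE x in torus_measure. g x > 0" by simp
    then have "AE x in torus_measure. 0 \<le> g x" by eventually_elim simp
    then have "AE x in torus_measure. g x = 0"
      using integral_nonneg_eq_0_iff_AE[OF int_g] int_g0 by blast
    with pos have "AE x :: 'n torus in torus_measure. False"
      by (rule eventually_elim2) simp
    then show False by (simp add: torus.AE_False)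
  qed
qed

section \<open>Growth on the spectral subspaces\<close>

lemma map_matrix_of_int_mult:
  "map_matrix of_int (M ** N) = (map_matrix of_int M ** map_matrix of_int N :: 'a::comm_ring_1^'n^'m)"
  by (simp add: vec_eq_iff matrix_matrix_mult_def)

lemma map_matrix_of_int_1: "map_matrix of_int (mat 1) = (mat 1 :: 'a::comm_ring_1^'n^'n)"
  by (simp add: vec_eq_iff mat_def)

lemma det_map_matrix_of_int: "det (map_matrix of_int M) = (of_int (det M) :: 'a::comm_ring_1)"
  by (simp add: det_def)

lemma integer_inverse:
  fixes S :: "int^'n::finite^'n"
  assumes "det S = 1 \<or> det S = - 1"
  obtains S' where "S ** S' = mat 1" "S' ** S = mat 1"
    "map_matrix real_of_int S' = matrix_inv (map_matrix real_of_int S)"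
proof -
  let ?M = "map_matrix real_of_int S"
  have dM: "det ?M = 1 \<or> det ?M = - 1" using assms by (auto simp: det_map_matrix_of_int)
  then have inv: "invertible ?M" by (auto simp: invertible_det_nz)
  have MI: "?M ** matrix_inv ?M = mat 1" "matrix_inv ?M ** ?M = mat 1"
    using someI_ex[OF inv[unfolded invertible_def]] by (simp_all add: matrix_inv_def)
  have int: "matrix_inv ?M $ i $ j \<in> \<int>" for i j
  proof -
    have col: "matrix_inv ?M $ i $ j = (matrix_inv ?M *v axis j 1) $ i"
      by (simp add: matrix_vector_mult_basis column_def)
    have "?M *v (matrix_inv ?M *v axis j 1) \<in> int_vectors"
      by (simp add: matrix_vector_mul_assoc MI axis_in_int_vectors)
    then have "matrix_inv ?M $ i $ j * det ?M \<in> \<int>"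
      unfolding col by (intro det_times_solution_Ints) auto
    then show ?thesis using dM by auto
  qed
  define S' where "S' = (\<chi> i j. \<lfloor>matrix_inv ?M $ i $ j\<rfloor>)"
  have S': "map_matrix real_of_int S' = matrix_inv ?M"
    using int by (simp add: S'_def vec_eq_iff)
  have inj: "X = Y" if "map_matrix real_of_int X = map_matrix real_of_int Y" for X Y :: "int^'n^'n"
    using that by (simp add: vec_eq_iff)
  show ?thesis
  proof (rule that[OF _ _ S'])
    show "S ** S' = mat 1" "S' ** S = mat 1"
      by (rule inj, simp add: map_matrix_of_int_mult map_matrix_of_int_1 S' MI)+
  qed
qed

text \<open>The eigenvalues are the roots of the characteristic polynomial, formed as a determinant
  over the polynomial ring. It is not the zero polynomial, because a number exceeding the sum of the
  moduli of all entries is not an eigenvalue.\<close>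

lemma finite_eigenvalues:
  fixes A :: "complex^'n::finite^'n"
  shows "finite {c. \<exists>z. z \<noteq> 0 \<and> A *v z = c *s z}"
proof -
  define D where "D c = (\<chi> i j. A $ i $ j - (if i = j then c else 0))" for c
  have Dz: "D c *v z = A *v z - c *s z" for c z
    by (simp add: D_def vec_eq_iff matrix_vector_mult_def left_diff_distrib sum_subtractf if_distrib[of "\<lambda>x. x * _"] cong: if_cong)
  define p where "p = det (\<chi> i j. [:A $ i $ j:] - (if i = j then [:0, 1:] else 0))"
  have p: "poly p c = det (D c)" for c
    by (simp add: p_def D_def det_def poly_sum poly_prod if_distrib[of "\<lambda>q. poly q c"] cong: if_cong)
  have ker: "det M \<noteq> 0 \<longleftrightarrow> (\<forall>z. M *v z = 0 \<longrightarrow> z = 0)" for M :: "complex^'n^'n"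
    by (metis invertible_det_nz invertible_left_inverse matrix_left_invertible_ker)
  have eig: "poly p c = 0 \<longleftrightarrow> (\<exists>z. z \<noteq> 0 \<and> A *v z = c *s z)" for c
    using ker[of "D c"] by (auto simp: p Dz)
  define s where "s = (\<Sum>i\<in>UNIV. \<Sum>j\<in>UNIV. cmod (A $ i $ j))"
  have s0: "s \<ge> 0" unfolding s_def by (intro sum_nonneg) auto
  have "z = 0" if z: "A *v z = of_real (s + 1) *s z" for z
  proof -
    let ?t = "\<Sum>i\<in>UNIV. cmod (z $ i)"
    have zt: "cmod (z $ j) \<le> ?t" for j by (rule member_le_sum) auto
    have "(s + 1) * ?t = (\<Sum>i\<in>UNIV. cmod ((of_real (s + 1) *s z) $ i))"
      using s0 by (simp add: norm_mult sum_distrib_left del: of_real_add)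
    also have "\<dots> = (\<Sum>i\<in>UNIV. cmod (\<Sum>j\<in>UNIV. A $ i $ j * z $ j))"
      unfolding z[symmetric] by (simp add: matrix_vector_mult_def)
    also have "\<dots> \<le> (\<Sum>i\<in>UNIV. \<Sum>j\<in>UNIV. cmod (A $ i $ j) * ?t)"
      by (intro sum_mono order_trans[OF norm_sum]) (auto simp: norm_mult intro!: mult_left_mono zt)
    also have "\<dots> = s * ?t" by (simp add: s_def sum_distrib_right)
    finally have "?t \<le> 0" by (simp add: algebra_simps)
    then have "cmod (z $ j) \<le> 0" for j using zt[of j] by linarith
    then show "z = 0" by (simp add: vec_eq_iff)
  qed
  then have "p \<noteq> 0" using eig[of "of_real (s + 1)"] by auto
  then show ?thesis using poly_roots_finite[of p] by (simp add: eig)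
qed

text \<open>Induction on the height \<open>k\<close> of the generalised eigenvector: with \<open>y = (M - c) z\<close> the
  orbit of \<open>z\<close> satisfies \<open>M\<^sup>n\<^sup>+\<^sup>1 z = c M\<^sup>n z + M\<^sup>n y\<close>.\<close>

lemma generalised_eigenvector_growth:
  fixes M :: "complex^'n::finite^'n"
  assumes c: "cmod c < \<theta>" and z: "((\<lambda>w. M *v w - c *s w) ^^ k) z = 0"
  shows "\<exists>C\<ge>0. \<forall>n i. cmod ((((*v) M ^^ n) z) $ i) \<le> C * \<theta> ^ n"
  using z
proof (induction k arbitrary: z)
  case 0
  have "((*v) M ^^ n) 0 = 0" for n by (induction n) auto
  then show ?case using 0 by (intro exI[of _ 0]) simp
next
  case (Suc k)
  define y where "y = M *v z - c *s z"
  have "((\<lambda>w. M *v w - c *s w) ^^ k) y = 0"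
    using Suc.prems by (simp add: funpow_Suc_right y_def del: funpow.simps)
  then obtain C where C: "C \<ge> 0" "\<And>n i. cmod ((((*v) M ^^ n) y) $ i) \<le> C * \<theta> ^ n"
    using Suc.IH by blast
  \<comment> \<open>The first term starts the induction on \<open>n\<close>; the second gives
    \<open>cmod c * D + C \<le> D * \<theta>\<close>, which the recursion needs.\<close>
  define D where "D = max (\<Sum>i\<in>UNIV. cmod (z $ i)) (C / (\<theta> - cmod c))"
  have \<theta>: "\<theta> > 0" using c norm_ge_zero[of c] by linarith
  have D: "C \<le> D * (\<theta> - cmod c)"
    using c by (simp add: D_def flip: pos_divide_le_eq)
  have step: "((*v) M ^^ Suc n) z = c *s ((*v) M ^^ n) z + ((*v) M ^^ n) y" for n
  proof (induction n)
    case (Suc n)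
    then show ?case
      by (metis funpow.simps(2) comp_apply matrix_vector_right_distrib vector_scalar_commute)
  qed (simp add: y_def)
  have "cmod ((((*v) M ^^ n) z) $ i) \<le> D * \<theta> ^ n" for n i
  proof (induction n)
    case 0
    have "cmod (z $ i) \<le> (\<Sum>i\<in>UNIV. cmod (z $ i))" by (rule member_le_sum) auto
    then show ?case by (simp add: D_def)
  next
    case (Suc n)
    have "cmod ((((*v) M ^^ Suc n) z) $ i) \<le> cmod c * cmod ((((*v) M ^^ n) z) $ i) + cmod ((((*v) M ^^ n) y) $ i)"
      unfolding step by (simp add: norm_triangle_le norm_mult flip: norm_mult)
    also have "\<dots> \<le> cmod c * (D * \<theta> ^ n) + C * \<theta> ^ n"
      using Suc C(2) by (intro add_mono mult_left_mono) auto
    also have "\<dots> = (cmod c * D + C) * \<theta> ^ n" by (simp add: algebra_simps)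
    also have "\<dots> \<le> (D * \<theta>) * \<theta> ^ n"
      using D \<theta> by (intro mult_right_mono) (auto simp: algebra_simps)
    finally show ?case by (simp add: mult_ac)
  qed
  moreover have "D \<ge> 0" unfolding D_def by (intro max.coboundedI1 sum_nonneg) auto
  ultimately show ?case by blast
qed

definition complexify :: "real^'n \<Rightarrow> complex^'n"
  where "complexify x = (\<chi> i. complex_of_real (x $ i))"

definition spectral_generators :: "(real \<Rightarrow> bool) \<Rightarrow> int^'n^'n \<Rightarrow> (complex^'n::finite) set"
  where "spectral_generators P S =
    {z. \<exists>c k. P (cmod c) \<and> ((\<lambda>w. map_matrix of_int S *v w - c *s w) ^^ k) z = 0}"

lemma spectral_subspace_iff:
  "x \<in> spectral_subspace P S \<longleftrightarrow> complexify x \<in> vec.span (spectral_generators P S)"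
  by (simp add: spectral_subspace_def complexify_def spectral_generators_def)

lemma complexify_mult:
  "complexify (map_matrix real_of_int M *v x) = map_matrix of_int M *v complexify x"
  by (simp add: complexify_def vec_eq_iff matrix_vector_mult_def)

lemma complexify_funpow:
  "complexify (((*v) (map_matrix real_of_int M) ^^ n) x) = ((*v) (map_matrix of_int M) ^^ n) (complexify x)"
  for M :: "int^'n::finite^'n"
  by (induction n) (simp_all add: complexify_mult)

lemma subspace_spectral_subspace: "subspace (spectral_subspace P S)"
proof (rule subspaceI)
  have 0: "complexify 0 = 0" by (simp add: complexify_def vec_eq_iff)
  show "0 \<in> spectral_subspace P S" by (simp add: spectral_subspace_iff 0 vec.span_zero)
  fix x y assume xy: "x \<in> spectral_subspace P S"
  have r: "complexify (c *\<^sub>R x) = of_real c *s complexify x" for c x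
    by (simp add: complexify_def vec_eq_iff)
  show "c *\<^sub>R x \<in> spectral_subspace P S" for c
    using xy by (simp add: spectral_subspace_iff r vec.span_scale)
  have a: "complexify (x + y) = complexify x + complexify y" for x y
    by (simp add: complexify_def vec_eq_iff)
  show "x + y \<in> spectral_subspace P S" if "y \<in> spectral_subspace P S"
    using xy that by (simp add: spectral_subspace_iff a vec.span_add)
qed

lemma funpow_shift_commute:
  fixes M N :: "complex^'n::finite^'n"
  assumes "M ** N = N ** M"
  shows "((\<lambda>w. M *v w - c *s w) ^^ k) (N *v z) = N *v ((\<lambda>w. M *v w - c *s w) ^^ k) z"
proof (induction k)
  case (Suc k)
  have "M *v (N *v w) = N *v (M *v w)" for w by (simp add: matrix_vector_mul_assoc assms)
  then show ?case
    by (simp add: Suc matrix_vector_mult_diff_distrib vector_scalar_commute)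
qed simp

text \<open>A matrix commuting with \<open>S\<close> maps generalised eigenvectors to generalised
  eigenvectors for the same eigenvalue. This form serves both \<open>S\<close> and its
  inverse.\<close>

lemma spectral_subspace_invariant:
  assumes "S ** N = N ** S" and x: "x \<in> spectral_subspace P S"
  shows "map_matrix real_of_int N *v x \<in> spectral_subspace P S"
proof -
  have comm: "map_matrix of_int S ** map_matrix of_int N = (map_matrix of_int N ** map_matrix of_int S :: complex^'a^'a)"
    using assms(1) by (simp flip: map_matrix_of_int_mult)
  let ?f = "(*v) (map_matrix of_int N :: complex^'a^'a)"
  have "?f z \<in> vec.span (spectral_generators P S)" if "z \<in> vec.span (spectral_generators P S)" for z
    using that
  proof (induction rule: vec.span_induct)
    case base
    show ?case
      by (auto intro!: vec.subspaceI simp: vec.span_zero matrix_vector_right_distrib vec.span_add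
          vector_scalar_commute vec.span_scale)
  next
    case (step z)
    then obtain c k where ck: "P (cmod c)" "((\<lambda>w. map_matrix of_int S *v w - c *s w) ^^ k) z = 0"
      by (auto simp: spectral_generators_def)
    have "((\<lambda>w. map_matrix of_int S *v w - c *s w) ^^ k) (?f z) = 0"
      by (simp add: funpow_shift_commute[OF comm] ck(2))
    then show ?case using ck(1) by (intro vec.span_base) (auto simp: spectral_generators_def)
  qed
  then show ?thesis using x by (simp add: spectral_subspace_iff complexify_mult)
qed

abbreviation (input) E_es :: "int^'n^'n \<Rightarrow> (real^'n::finite) set"
  where "E_es S \<equiv> {x + y | x y. x \<in> E_e S \<and> y \<in> E_s S}"

lemma E_es_invariant:
  assumes N: "S ** N = N ** S" and y: "y \<in> E_es S"
  shows "map_matrix real_of_int N *v y \<in> E_es S"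
proof -
  obtain a b where ab: "y = a + b" "a \<in> E_e S" "b \<in> E_s S" using y by blast
  have "map_matrix real_of_int N *v a \<in> E_e S" "map_matrix real_of_int N *v b \<in> E_s S"
    using ab(2,3) N unfolding E_e_def E_s_def by (simp_all add: spectral_subspace_invariant)
  then show ?thesis using ab(1) by (auto simp: matrix_vector_right_distrib)
qed

text \<open>The complex vectors with orbit bounded by a multiple of \<theta>^n form a subspace, so
  it is enough to bound the orbits of the generators.\<close>

lemma spectral_subspace_growth:
  fixes N :: "int^'n::finite^'n"
  assumes gen: "\<And>z. z \<in> spectral_generators P S \<Longrightarrow>
      \<exists>C\<ge>0. \<forall>n i. cmod ((((*v) (map_matrix of_int N) ^^ n) z) $ i) \<le> C * \<theta> ^ n"
    and x: "x \<in> spectral_subspace P S"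
  shows "\<exists>C\<ge>0. \<forall>n. norm (((*v) (map_matrix real_of_int N) ^^ n) x) \<le> C * \<theta> ^ n"
proof -
  let ?f = "\<lambda>n. (*v) (map_matrix of_int N :: complex^'n^'n) ^^ n"
  let ?G = "{z. \<exists>C\<ge>0. \<forall>n i. cmod ((?f n z) $ i) \<le> C * \<theta> ^ n}"
  have add: "?f n (y + z) = ?f n y + ?f n z" for n y z
    by (induction n) (simp_all add: matrix_vector_right_distrib)
  have scale: "?f n (c *s z) = c *s ?f n z" for n c z
    by (induction n) (simp_all add: vector_scalar_commute)
  have zero: "?f n 0 = 0" for n by (induction n) simp_all
  have "\<exists>C\<ge>0. \<forall>n i. cmod ((?f n z) $ i) \<le> C * \<theta> ^ n" if "z \<in> vec.span (spectral_generators P S)" for z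
    using that
  proof (induction rule: vec.span_induct)
    case base
    show ?case
    proof (rule vec.subspaceI)
      show "0 \<in> ?G"
        by (auto simp: zero intro!: exI[of _ 0])
    next
      fix y z assume "y \<in> ?G"
        and "z \<in> ?G"
      then obtain C D where CD: "C \<ge> 0" "D \<ge> 0" "\<And>n i. cmod ((?f n y) $ i) \<le> C * \<theta> ^ n"
          "\<And>n i. cmod ((?f n z) $ i) \<le> D * \<theta> ^ n" by auto
      have "cmod ((?f n (y + z)) $ i) \<le> (C + D) * \<theta> ^ n" for n i
        using norm_triangle_ineq[of "?f n y $ i" "?f n z $ i"] CD(3)[of n i] CD(4)[of n i]
        unfolding add by (simp add: algebra_simps)
      then show "y + z \<in> ?G"
        using CD(1,2) by (intro CollectI exI[of _ "C + D"]) auto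
    next
      fix c z assume "z \<in> ?G"
      then obtain C where C: "C \<ge> 0" "\<And>n i. cmod ((?f n z) $ i) \<le> C * \<theta> ^ n" by auto
      have "cmod ((?f n (c *s z)) $ i) \<le> (cmod c * C) * \<theta> ^ n" for n i
        using mult_left_mono[OF C(2)[of n i], of "cmod c"] unfolding scale by (simp add: norm_mult mult.assoc)
      then show "c *s z \<in> ?G"
        using C(1) by (intro CollectI exI[of _ "cmod c * C"]) auto
    qed
  next
    case (step z)
    then show ?case by (rule gen)
  qed
  then obtain C where C: "C \<ge> 0" "\<And>n i. cmod ((?f n (complexify x)) $ i) \<le> C * \<theta> ^ n"
    using x spectral_subspace_iff by blast
  have "norm (((*v) (map_matrix real_of_int N) ^^ n) x) \<le> (real CARD('n) * C) * \<theta> ^ n" for n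
  proof -
    have "norm (((*v) (map_matrix real_of_int N) ^^ n) x) \<le> (\<Sum>i\<in>UNIV. \<bar>((((*v) (map_matrix real_of_int N) ^^ n) x)) $ i\<bar>)"
      by (rule norm_le_l1_cart)
    also have "\<dots> \<le> (\<Sum>i\<in>(UNIV :: 'n set). C * \<theta> ^ n)"
    proof (rule sum_mono)
      fix i
      show "\<bar>((((*v) (map_matrix real_of_int N) ^^ n) x)) $ i\<bar> \<le> C * \<theta> ^ n"
        using C(2)[of n i] unfolding complexify_funpow[symmetric] by (simp add: complexify_def)
    qed
    finally show ?thesis by simp
  qed
  then show ?thesis using C(1) by (intro exI[of _ "real CARD('n) * C"]) auto
qed

text \<open>The constants of the vectors of an orthonormal basis are summed; coordinates in such a
  basis are bounded by the norm.\<close>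

lemma uniform_growth:
  fixes f :: "'a::euclidean_space \<Rightarrow> 'a"
  assumes lin: "linear f" and V: "subspace V" and \<theta>: "\<theta> \<ge> 0"
    and pt: "\<And>x. x \<in> V \<Longrightarrow> \<exists>C\<ge>0. \<forall>n. norm ((f ^^ n) x) \<le> C * \<theta> ^ n"
  shows "\<exists>C>0. \<forall>x\<in>V. \<forall>n. norm ((f ^^ n) x) \<le> C * \<theta> ^ n * norm x"
proof -
  obtain B where B: "B \<subseteq> V" "pairwise orthogonal B" "\<And>x. x \<in> B \<Longrightarrow> norm x = 1" "independent B" "span B = V"
    using orthonormal_basis_subspace[OF V] by metis
  have finB: "finite B" using B(4) by (rule independent_imp_finite)
  obtain C where C: "\<And>b. b \<in> B \<Longrightarrow> C b \<ge> 0" "\<And>b n. b \<in> B \<Longrightarrow> norm ((f ^^ n) b) \<le> C b * \<theta> ^ n"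
    using pt B(1) by (metis subsetD)
  define D where "D = (\<Sum>b\<in>B. C b) + 1"
  have D: "D > 0" using C(1) sum_nonneg[of B C] by (simp add: D_def add_nonneg_pos)
  have "norm ((f ^^ n) x) \<le> D * \<theta> ^ n * norm x" if x: "x \<in> V" for x n
  proof -
    have "(\<Sum>b\<in>B. (x \<bullet> b) *\<^sub>R b) = x"
    proof -
      obtain c where c: "x = (\<Sum>b\<in>B. c b *\<^sub>R b)" using x B(5) span_finite[OF finB] by auto
      have "x \<bullet> b = c b" if "b \<in> B" for b
      proof -
        have "x \<bullet> b = (\<Sum>b'\<in>B. c b' * (b' \<bullet> b))" unfolding c by (simp add: inner_sum_left)
        also have "\<dots> = (\<Sum>b'\<in>B. if b' = b then c b else 0)"
          using B(2,3) that by (intro sum.cong) (auto simp: pairwise_def orthogonal_def dot_square_norm)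
        also have "\<dots> = c b" using that finB by simp
        finally show ?thesis .
      qed
      then show ?thesis by (subst (2) c) (intro sum.cong, auto)
    qed
    then have "(f ^^ n) x = (\<Sum>b\<in>B. (x \<bullet> b) *\<^sub>R (f ^^ n) b)"
      by (metis (mono_tags, lifting) linear_cmul[OF linear_funpow[OF lin]] linear_sum[OF linear_funpow[OF lin]] sum.cong)
    also have "norm \<dots> \<le> (\<Sum>b\<in>B. norm x * (C b * \<theta> ^ n))"
    proof (rule order_trans[OF norm_sum], rule sum_mono)
      fix b assume b: "b \<in> B"
      have "\<bar>x \<bullet> b\<bar> \<le> norm x" using Cauchy_Schwarz_ineq2[of x b] B(3)[OF b] by simp
      then show "norm ((x \<bullet> b) *\<^sub>R (f ^^ n) b) \<le> norm x * (C b * \<theta> ^ n)"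
        using C(2)[OF b] by (simp add: mult_mono)
    qed
    also have "\<dots> = (\<Sum>b\<in>B. C b) * (\<theta> ^ n * norm x)"
      by (simp add: sum_distrib_right sum_distrib_left mult_ac)
    also have "\<dots> \<le> D * (\<theta> ^ n * norm x)"
      using \<theta> by (intro mult_right_mono) (auto simp: D_def)
    finally show ?thesis by (simp add: mult_ac)
  qed
  then show ?thesis using D by blast
qed

section \<open>Spectral rates on the unstable space and on its complement\<close>

text \<open>Since \<open>N\<close> is the inverse of \<open>M\<close>, N - 1/c equals -(1/c) N (M -
  c), and \<open>N\<close> commutes with M - c.\<close>

lemma inverse_generalised_eigenvector:
  fixes M N :: "complex^'n::finite^'n"
  assumes MN: "M ** N = mat 1" "N ** M = mat 1" and c: "c \<noteq> 0"
    and z: "((\<lambda>w. M *v w - c *s w) ^^ k) z = 0"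
  shows "((\<lambda>w. N *v w - (1 / c) *s w) ^^ k) z = 0"
  using z
proof (induction k arbitrary: z)
  case (Suc k)
  let ?y = "M *v z - c *s z"
  have y: "((\<lambda>w. M *v w - c *s w) ^^ k) ?y = 0"
    using Suc.prems by (simp add: funpow_Suc_right del: funpow.simps)
  have eq: "N *v z - (1 / c) *s z = N *v ((- 1 / c) *s ?y)"
  proof -
    have "N *v (M *v z) = z" by (simp add: matrix_vector_mul_assoc MN)
    then show ?thesis using c
      by (simp add: vector_scalar_commute matrix_vector_mult_diff_distrib vec_eq_iff field_simps)
  qed
  have scal: "((\<lambda>w. M *v w - c *s w) ^^ k) (a *s w) = a *s ((\<lambda>w. M *v w - c *s w) ^^ k) w" for a w
  proof (induction k)
    case (Suc k)
    then show ?case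
      by (simp add: vector_scalar_commute[symmetric] vector_ssub_ldistrib vector_smult_assoc mult.commute)
  qed simp
  have "M ** N = N ** M" using MN by simp
  then have "((\<lambda>w. M *v w - c *s w) ^^ k) (N *v ((- 1 / c) *s ?y)) = 0"
    by (simp only: funpow_shift_commute scal y) simp
  then show ?case
    using Suc.IH[of "N *v z - (1 / c) *s z"] by (simp add: eq funpow_Suc_right del: funpow.simps)
qed simp

abbreviation (input) unstable_rate :: "int^'n::finite^'n \<Rightarrow> real"
  where "unstable_rate S \<equiv> spectral_radius_on (matrix_inv (map_matrix real_of_int S)) (E_u S)"

text \<open>The last nonzero vector in the chain of \<open>z\<close> is an eigenvector
  \<open>w\<close>. Its conjugate is an eigenvector for the conjugate eigenvalue, of the same
  modulus, so the real and imaginary parts of \<open>w\<close> lie in \<open>E_u S\<close>. Thus 1/c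
  belongs to the finite set over which the maximum is taken.\<close>

lemma inverse_eigenvalue_le_spectral_radius:
  fixes S S' :: "int^'n::finite^'n"
  assumes S': "S ** S' = mat 1" "S' ** S = mat 1" "map_matrix real_of_int S' = matrix_inv (map_matrix real_of_int S)"
    and c: "cmod c > 1" and z: "((\<lambda>w. map_matrix of_int S *v w - c *s w) ^^ k) z = 0" "z \<noteq> 0"
  shows "cmod (1 / c) \<le> unstable_rate S"
proof -
  let ?M = "map_matrix of_int S :: complex^'n^'n" and ?N = "map_matrix of_int S' :: complex^'n^'n"
  have MN: "?M ** ?N = mat 1" "?N ** ?M = mat 1"
    using S'(1,2) by (simp_all add: map_matrix_of_int_1 flip: map_matrix_of_int_mult)
  have N: "map_matrix complex_of_real (matrix_inv (map_matrix real_of_int S)) = ?N"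
    by (simp add: vec_eq_iff flip: S'(3))
  have "((\<lambda>w. ?M *v w - c *s w) ^^ 0) z \<noteq> 0" using z by simp
  then obtain j where j: "((\<lambda>w. ?M *v w - c *s w) ^^ j) z \<noteq> 0" "((\<lambda>w. ?M *v w - c *s w) ^^ Suc j) z = 0"
    using ex_least_nat_less[of "\<lambda>j. ((\<lambda>w. ?M *v w - c *s w) ^^ j) z = 0" k] z(1) by blast
  define w where "w = ((\<lambda>w. ?M *v w - c *s w) ^^ j) z"
  have w: "w \<noteq> 0" "?M *v w = c *s w" using j by (simp_all add: w_def)
  have c0: "c \<noteq> 0" using c by auto
  have Nw: "?N *v w = (1 / c) *s w"
    using inverse_generalised_eigenvector[OF MN c0, of 1 w] w by simp
  define wc where "wc = (\<chi> i. cnj (w $ i))"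
  have wc: "?M *v wc = cnj c *s wc"
  proof -
    have "(?M *v wc) $ i = cnj ((?M *v w) $ i)" for i
      by (simp add: wc_def matrix_vector_mult_def)
    then show ?thesis unfolding w(2) by (simp add: vec_eq_iff wc_def)
  qed
  have gw: "w \<in> spectral_generators (\<lambda>r. r > 1) S" unfolding spectral_generators_def
    using w(2) c by (intro CollectI exI[of _ c] exI[of _ "1::nat"]) simp
  have gwc: "wc \<in> spectral_generators (\<lambda>r. r > 1) S" unfolding spectral_generators_def
    using wc c by (intro CollectI exI[of _ "cnj c"] exI[of _ "1::nat"]) simp
  have Re: "complexify (\<chi> i. Re (w $ i)) = (1 / 2) *s (w + wc)"
    by (simp add: complexify_def vec_eq_iff wc_def complex_eq_iff)
  have Im: "complexify (\<chi> i. Im (w $ i)) = (- \<i> / 2) *s (w - wc)"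
    by (simp add: complexify_def vec_eq_iff wc_def complex_eq_iff)
  have "(\<chi> i. Re (w $ i)) \<in> E_u S" "(\<chi> i. Im (w $ i)) \<in> E_u S"
    unfolding E_u_def spectral_subspace_iff Re Im
    by (intro vec.span_scale vec.span_add vec.span_diff vec.span_base gw gwc)+
  then have mem: "1 / c \<in> {c. \<exists>z :: complex^'n. z \<noteq> 0 \<and> (\<chi> i. Re (z $ i)) \<in> E_u S \<and> (\<chi> i. Im (z $ i)) \<in> E_u S \<and>
      ?N *v z = c *s z}" (is "_ \<in> ?E")
    using w Nw by blast
  have "finite ?E" by (rule finite_subset[OF _ finite_eigenvalues[of ?N]]) auto
  then show ?thesis unfolding spectral_radius_on_def N using mem by (intro Max_ge) auto
qed

lemma E_u_contraction:
  fixes S S' :: "int^'n::finite^'n"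
  assumes S': "S ** S' = mat 1" "S' ** S = mat 1" "map_matrix real_of_int S' = matrix_inv (map_matrix real_of_int S)"
    and \<rho>: "unstable_rate S < \<rho>" "\<rho> > 0"
  shows "\<exists>C>0. \<forall>x\<in>E_u S. \<forall>n. norm (((*v) (map_matrix real_of_int S') ^^ n) x) \<le> C * \<rho> ^ n * norm x"
proof (rule uniform_growth)
  show "linear ((*v) (map_matrix real_of_int S'))" by simp
  show "subspace (E_u S)" unfolding E_u_def by (rule subspace_spectral_subspace)
  show "\<rho> \<ge> 0" using \<rho> by simp
  let ?M = "map_matrix of_int S :: complex^'n^'n" and ?N = "map_matrix of_int S' :: complex^'n^'n"
  have MN: "?M ** ?N = mat 1" "?N ** ?M = mat 1"
    using S'(1,2) by (simp_all add: map_matrix_of_int_1 flip: map_matrix_of_int_mult)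
  fix x assume x: "x \<in> E_u S"
  show "\<exists>C\<ge>0. \<forall>n. norm (((*v) (map_matrix real_of_int S') ^^ n) x) \<le> C * \<rho> ^ n"
  proof (rule spectral_subspace_growth)
    show "x \<in> spectral_subspace (\<lambda>r. r > 1) S" using x by (simp add: E_u_def)
    fix z assume "z \<in> spectral_generators (\<lambda>r. r > 1) S"
    then obtain c k where ck: "cmod c > 1" "((\<lambda>w. ?M *v w - c *s w) ^^ k) z = 0"
      by (auto simp: spectral_generators_def)
    show "\<exists>C\<ge>0. \<forall>n i. cmod ((((*v) ?N ^^ n) z) $ i) \<le> C * \<rho> ^ n"
    proof (cases "z = 0")
      case True
      have "((*v) ?N ^^ n) 0 = 0" for n by (induction n) simp_all
      then show ?thesis using True by (intro exI[of _ 0]) simp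
    next
      case False
      have "cmod (1 / c) < \<rho>"
        using inverse_eigenvalue_le_spectral_radius[OF S' ck False] \<rho>(1) by simp
      moreover have "((\<lambda>w. ?N *v w - (1 / c) *s w) ^^ k) z = 0"
        using ck by (intro inverse_generalised_eigenvector[OF MN]) auto
      ultimately show ?thesis by (rule generalised_eigenvector_growth)
    qed
  qed
qed

text \<open>A nonzero \<open>E_u S\<close> forces a nonzero generator, so the maximum is over a
  nonempty set and is at least the modulus of some 1/c.\<close>

lemma E_u_nonzero_spectral_radius_pos:
  fixes S S' :: "int^'n::finite^'n"
  assumes S': "S ** S' = mat 1" "S' ** S = mat 1" "map_matrix real_of_int S' = matrix_inv (map_matrix real_of_int S)"
    and "E_u S \<noteq> {0}"
  shows "unstable_rate S > 0"
proof -
  have "\<exists>z\<in>spectral_generators (\<lambda>r. r > 1) S. z \<noteq> 0"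
  proof (rule ccontr)
    assume "\<not> ?thesis"
    then have "spectral_generators (\<lambda>r. r > 1) S \<subseteq> {0}" by blast
    then have "vec.span (spectral_generators (\<lambda>r. r > 1) S) \<subseteq> {0}"
      by (rule vec.span_minimal) (rule vec.subspace_single_0)
    then have "complexify x = 0" if "x \<in> E_u S" for x
      using that unfolding E_u_def spectral_subspace_iff by blast
    then have "E_u S \<subseteq> {0}" by (auto simp: complexify_def vec_eq_iff)
    moreover have "0 \<in> E_u S" unfolding E_u_def by (rule subspace_0[OF subspace_spectral_subspace])
    ultimately show False using assms(4) by blast
  qed
  then obtain z c k where z: "z \<noteq> 0" and c: "cmod c > 1"
    and ck: "((\<lambda>w. map_matrix of_int S *v w - c *s w) ^^ k) z = 0"
    unfolding spectral_generators_def by blast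
  have "0 < cmod (1 / c)" using c by (auto simp: norm_divide)
  then show ?thesis
    using inverse_eigenvalue_le_spectral_radius[OF S' c ck z] by linarith
qed

text \<open>The eigenvalues have modulus at most 1, strictly below \<theta>; this gap absorbs the
  polynomial factors of the Jordan blocks.\<close>

lemma E_es_growth:
  fixes S :: "int^'n::finite^'n"
  assumes \<theta>: "\<theta> > 1"
  shows "\<exists>C>0. \<forall>x\<in>E_es S. \<forall>n.
    norm (((*v) (map_matrix real_of_int S) ^^ n) x) \<le> C * \<theta> ^ n * norm x"
proof (rule uniform_growth)
  let ?A = "(*v) (map_matrix real_of_int S)"
  show lin: "linear ?A" by simp
  show "subspace (E_es S)"
    unfolding E_e_def E_s_def by (intro subspace_sums subspace_spectral_subspace)
  show "\<theta> \<ge> 0" using \<theta> by simp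
  fix x assume "x \<in> E_es S"
  then obtain a b where ab: "x = a + b" "a \<in> E_e S" "b \<in> E_s S" by blast
  have gr: "\<exists>C\<ge>0. \<forall>n. norm ((?A ^^ n) x) \<le> C * \<theta> ^ n"
    if P: "\<And>r. P r \<Longrightarrow> r \<le> 1" and x: "x \<in> spectral_subspace P S" for x P
  proof (rule spectral_subspace_growth[OF _ x])
    fix z assume "z \<in> spectral_generators P S"
    then obtain c k where ck: "P (cmod c)" "((\<lambda>w. map_matrix of_int S *v w - c *s w) ^^ k) z = 0"
      by (auto simp: spectral_generators_def)
    have "cmod c < \<theta>" using P[OF ck(1)] \<theta> by simp
    then show "\<exists>C\<ge>0. \<forall>n i. cmod ((((*v) (map_matrix of_int S) ^^ n) z) $ i) \<le> C * \<theta> ^ n"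
      using ck(2) by (rule generalised_eigenvector_growth)
  qed
  obtain C where C: "C \<ge> 0" "\<And>n. norm ((?A ^^ n) a) \<le> C * \<theta> ^ n"
    using gr[of "\<lambda>r. r = 1" a] ab(2) by (auto simp: E_e_def)
  obtain D where D: "D \<ge> 0" "\<And>n. norm ((?A ^^ n) b) \<le> D * \<theta> ^ n"
    using gr[of "\<lambda>r. r < 1" b] ab(3) by (auto simp: E_s_def)
  have "norm ((?A ^^ n) x) \<le> (C + D) * \<theta> ^ n" for n
    using norm_triangle_ineq[of "(?A ^^ n) a" "(?A ^^ n) b"] C(2)[of n] D(2)[of n]
    unfolding ab(1) linear_add[OF linear_funpow[OF lin]] by (simp add: algebra_simps)
  then show "\<exists>C\<ge>0. \<forall>n. norm ((?A ^^ n) x) \<le> C * \<theta> ^ n"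
    using C(1) D(1) by (intro exI[of _ "C + D"]) auto
qed

section \<open>The splitting given by an adapted basis\<close>

lemma map_matrix_of_int_inverse:
  "M ** N = mat 1 \<Longrightarrow> map_matrix of_int M ** map_matrix of_int N = (mat 1 :: 'a::comm_ring_1^'n^'n)"
  by (simp only: map_matrix_of_int_mult[symmetric] map_matrix_of_int_1)

lemma basis_coordinates:
  fixes v :: "'n::finite \<Rightarrow> real^'n"
  assumes det: "det (\<chi> i j. v j $ i) = 1"
  obtains c where "\<And>i. linear (\<lambda>y. c y i)" "\<And>y. y = (\<Sum>i\<in>UNIV. c y i *\<^sub>R v i)"
    "\<And>a i. c (\<Sum>i\<in>UNIV. a i *\<^sub>R v i) i = a i"
    "\<And>y. basis_norm v y = (MAX i. \<bar>c y i\<bar>)"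
proof -
  define M :: "real^'n^'n" where "M = (\<chi> i j. v j $ i)"
  have dM: "det M = 1" using det by (simp add: M_def)
  then obtain N where N: "M ** N = mat 1" "N ** M = mat 1"
    by (metis invertible_det_nz invertible_def zero_neq_one)
  define c where "c y i = (N *v y) $ i" for y i
  have colM: "column i M = v i" for i by (simp add: column_def M_def)
  have Mv: "M *v x = (\<Sum>i\<in>UNIV. x $ i *\<^sub>R v i)" for x
    by (simp add: matrix_mult_sum colM scalar_mult_eq_scaleR)
  have lin: "linear (\<lambda>y. c y i)" for i
    unfolding c_def by (intro linearI) (simp_all add: matrix_vector_right_distrib matrix_vector_mult_scaleR)
  have expand: "y = (\<Sum>i\<in>UNIV. c y i *\<^sub>R v i)" for y
  proof -
    have "M *v (N *v y) = y" by (simp add: matrix_vector_mul_assoc N)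
    then show ?thesis by (simp add: Mv c_def)
  qed
  have coord: "c (\<Sum>i\<in>UNIV. a i *\<^sub>R v i) i = a i" for a i
  proof -
    have "N *v (M *v (\<chi> i. a i)) = (\<chi> i. a i)" by (simp add: matrix_vector_mul_assoc N)
    then show ?thesis by (simp add: Mv c_def vec_eq_iff)
  qed
  have "inj v"
  proof (rule injI, rule ccontr)
    fix i j assume ij: "v i = v j" "i \<noteq> j"
    then have "det M = 0" using det_identical_columns[of i j M] by (simp add: colM)
    then show False using dM by simp
  qed
  have cols: "columns M = range v" by (auto simp: columns_def colM)
  have "vec.independent (columns M)" using det_dependent_columns[of M] dM by auto
  then have ind: "independent (range v)"
    by (simp add: cols dependent_vec_eq)
  have rep: "representation (range v) y (v i) = c y i" for y i
  proof -
    have "representation (range v) y (v i) = representation (range v) (\<Sum>j\<in>UNIV. c y j *\<^sub>R v j) (v i)"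
      by (subst expand) simp
    also have "\<dots> = (\<Sum>j\<in>UNIV. c y j * representation (range v) (v j) (v i))"
      by (subst representation_sum[OF ind])
         (auto simp: representation_scale[OF ind span_base] intro: span_base span_scale)
    also have "\<dots> = (\<Sum>j\<in>UNIV. if j = i then c y j else 0)"
      using \<open>inj v\<close> by (intro sum.cong) (auto simp: representation_basis[OF ind] inj_eq)
    finally show ?thesis by simp
  qed
  show ?thesis
    by (rule that[of c]) (auto simp: lin coord basis_norm_def rep expand[symmetric])
qed

text \<open>Such a nonzero \<open>k\<close> would feel only the component along
  \<open>E_es S\<close>, where iterates of \<open>S\<close> grow subexponentially. Then
  \<open>periodic_int_vector\<close> provides a nonzero integer vector periodic under the transposed
  matrix, which ergodicity forbids.\<close>

lemma ergodic_nonresonance: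
  fixes S S' :: "int^'n::finite^'n" and pw :: "real^'n \<Rightarrow> real^'n"
  assumes erg: "ergodic torus_measure (torus_map S)"
    and S': "S ** S' = mat 1" "S' ** S = mat 1"
    and pw: "linear pw" "\<And>x. x - pw x \<in> E_u S" "\<And>x. pw x \<in> E_es S"
    and k: "k \<in> int_vectors" "\<And>x. x \<in> E_u S \<Longrightarrow> k \<bullet> x = 0"
  shows "k = 0"
proof (rule ccontr)
  assume k0: "k \<noteq> 0"
  let ?A = "map_matrix real_of_int S" and ?A' = "map_matrix real_of_int S'"
  have AA': "?A ** ?A' = mat 1" by (rule map_matrix_of_int_inverse[OF S'(1)])
  have tint: "transpose (map_matrix real_of_int N) *v x \<in> int_vectors" if "x \<in> int_vectors" for N :: "int^'n^'n" and x
    using that unfolding int_vectors_def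
    by (auto simp: matrix_vector_mult_def transpose_def intro!: Ints_sum Ints_mult)
  obtain P l where "P > 0" "l \<in> int_vectors" "l \<noteq> 0" "((*v) (transpose ?A) ^^ P) l = l"
  proof (rule periodic_int_vector)
    show "linear ((*v) ?A)" "linear ((*v) (transpose ?A))" "linear ((*v) (transpose ?A'))"
      by (rule matrix_vector_mul_linear)+
    show "transpose ?A' *v (transpose ?A *v x) = x" for x
      by (simp only: matrix_vector_mul_assoc matrix_transpose_mul[symmetric] AA' transpose_mat matrix_vector_mul_lid)
    show "(transpose ?A *v x) \<bullet> y = x \<bullet> (?A *v y)" for x y
      by (simp add: dot_lmul_matrix)
    show "transpose ?A *v x \<in> int_vectors" "transpose ?A' *v x \<in> int_vectors" if "x \<in> int_vectors" for x
      using that by (rule tint)+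
    show "subspace (E_u S)" unfolding E_u_def by (rule subspace_spectral_subspace)
    show "?A *v x \<in> E_u S" if "x \<in> E_u S" for x
      using that unfolding E_u_def by (intro spectral_subspace_invariant) simp
    show "x - pw x \<in> E_u S" for x by (rule pw)
    show "\<exists>C. \<forall>x n. norm (((*v) ?A ^^ n) (pw x)) \<le> C * \<theta> ^ n * norm x" if \<theta>: "\<theta> > 1" for \<theta>
    proof -
      obtain C where C: "C > 0" "\<And>x n. x \<in> E_es S \<Longrightarrow>
          norm (((*v) ?A ^^ n) x) \<le> C * \<theta> ^ n * norm x"
        using E_es_growth[OF \<theta>, of S] by blast
      obtain K where K: "K > 0" "\<And>x. norm (pw x) \<le> K * norm x" using linear_bounded_pos[OF pw(1)] by blast
      have "norm (((*v) ?A ^^ n) (pw x)) \<le> (C * K) * \<theta> ^ n * norm x" for x n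
      proof -
        have "norm (((*v) ?A ^^ n) (pw x)) \<le> C * \<theta> ^ n * norm (pw x)" by (rule C(2)[OF pw(3)])
        also have "\<dots> \<le> C * \<theta> ^ n * (K * norm x)" using C(1) \<theta> K(2) by (intro mult_left_mono) auto
        finally show ?thesis by (simp add: mult_ac)
      qed
      then show ?thesis by blast
    qed
    show "k \<in> int_vectors" "k \<noteq> 0" "\<And>x. x \<in> E_u S \<Longrightarrow> k \<bullet> x = 0" using k k0 by auto
  qed (use that in blast)
  then show False using periodic_int_vector_not_ergodic erg by blast
qed

text \<open>Going n steps back and n steps forward returns \<open>x\<close>. The first move
  contracts by \<rho>^n and the second expands by at most \<theta>^n, up to constants, and \<theta>
  * \<rho> < 1.\<close>

lemma E_u_inter_E_es:
  fixes S S' :: "int^'n::finite^'n"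
  assumes S': "S ** S' = mat 1" "S' ** S = mat 1" "map_matrix real_of_int S' = matrix_inv (map_matrix real_of_int S)"
    and \<rho>: "unstable_rate S < 1"
    and x: "x \<in> E_u S" "x \<in> E_es S"
  shows "x = 0"
proof -
  let ?A = "map_matrix real_of_int S" and ?A' = "map_matrix real_of_int S'"
  let ?W = "E_es S"
  \<comment> \<open>As \<open>E_u S\<close> could still be trivial here, the sign of the rate is
    unknown; the maximum with 0 secures \<rho> > 0.\<close>
  define \<rho> where "\<rho> = (max 0 (unstable_rate S) + 1) / 2"
  have \<rho>': "\<rho> > 0" "\<rho> < 1" "unstable_rate S < \<rho>"
    using \<rho> by (auto simp: \<rho>_def)
  obtain C where C: "C > 0" "\<And>x n. x \<in> E_u S \<Longrightarrow> norm (((*v) ?A' ^^ n) x) \<le> C * \<rho> ^ n * norm x"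
    using E_u_contraction[OF S' \<rho>'(3,1)] by blast
  define \<theta> where "\<theta> = 2 / (1 + \<rho>)"
  have \<theta>: "\<theta> > 1" "\<theta> * \<rho> < 1" "\<theta> > 0" using \<rho>' by (auto simp: \<theta>_def field_simps)
  obtain D where D: "D > 0" "\<And>x n. x \<in> ?W \<Longrightarrow> norm (((*v) ?A ^^ n) x) \<le> D * \<theta> ^ n * norm x"
    using E_es_growth[OF \<theta>(1), of S] by blast
  have AA': "?A ** ?A' = mat 1" by (rule map_matrix_of_int_inverse[OF S'(1)])
  have W_inv: "?A' *v y \<in> ?W" if "y \<in> ?W" for y
    using that S'(1,2) by (intro E_es_invariant) simp_all
  have bound: "norm x \<le> D * C * norm x * (\<theta> * \<rho>) ^ n" for n
  proof -
    have "x = ((*v) ?A ^^ n) (((*v) ?A' ^^ n) x)"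
      by (rule funpow_inverse[symmetric]) (simp add: matrix_vector_mul_assoc AA')
    also have "norm \<dots> \<le> D * \<theta> ^ n * norm (((*v) ?A' ^^ n) x)"
      by (intro D(2) funpow_invariant W_inv x(2))
    also have "\<dots> \<le> D * \<theta> ^ n * (C * \<rho> ^ n * norm x)"
      using C(2)[OF x(1)] D(1) \<theta> by (intro mult_left_mono) auto
    finally show ?thesis by (simp add: power_mult_distrib mult_ac)
  qed
  have "(\<lambda>n. D * C * norm x * (\<theta> * \<rho>) ^ n) \<longlonglongrightarrow> D * C * norm x * 0"
    using \<theta> \<rho>' by (intro tendsto_mult_left LIMSEQ_power_zero) auto
  then have "norm x \<le> 0" using bound by (intro LIMSEQ_le_const) auto
  then show ?thesis by simp
qed

lemma adapted_basis_cases: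
  fixes v :: "'n::finite \<Rightarrow> real^'n"
  assumes "adapted_basis S e v"
  shows "v i \<in> E_u S \<or> v i \<in> E_e S \<or> v i \<in> E_s S"
proof -
  have "i \<in> e ` {1..CARD('n)}" using assms by (auto simp: adapted_basis_def bij_betw_def)
  then obtain k where k: "k \<in> {1..CARD('n)}" "i = e k" by blast
  consider "k \<in> {1..dim (E_u S)}" | "k \<in> {dim (E_u S) + 1..dim (E_u S) + dim (E_e S)}"
    | "k \<in> {dim (E_u S) + dim (E_e S) + 1..CARD('n)}"
    using k(1) by fastforce
  then show ?thesis using assms k(2) by cases (auto simp: adapted_basis_def)
qed

text \<open>The projections are partial sums of the expansion in the adapted basis; that the sum of
  \<open>E_u S\<close> and \<open>W\<close> is direct follows from their opposite growth.
  \<open>K\<close> bounds all coordinates by the Euclidean norm, which turns Euclidean bounds into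
  membership in the balls of \<open>basis_norm\<close>.\<close>

theorem adapted_basis_splitting:
  fixes S :: "int^'n::finite^'n"
  assumes det: "det S = 1 \<or> det S = - 1"
    and erg: "ergodic torus_measure (torus_map S)"
    and basis: "adapted_basis S e v"
    and \<rho>\<^sub>u: "unstable_rate S < \<rho>\<^sub>u" "\<rho>\<^sub>u < 1"
  obtains S' pu pw W Cu \<rho> K where
    "toral_splitting ((*v) (map_matrix real_of_int S)) ((*v) (map_matrix real_of_int S')) pu pw (E_u S) W Cu \<rho>"
    "\<rho> < \<rho>\<^sub>u" "K > 0"
    "\<And>x \<delta>. x \<in> E_u S \<Longrightarrow> K * norm x \<le> \<delta> \<Longrightarrow> x \<in> ball_in v (E_u S) \<delta>"
    "\<And>x \<delta>. x \<in> W \<Longrightarrow> K * norm x \<le> \<delta> \<Longrightarrow> \<exists>h\<in>ball_in v (E_s S) \<delta>. \<exists>h'\<in>ball_in v (E_e S) \<delta>. x = h + h'"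
proof -
  obtain S' where S': "S ** S' = mat 1" "S' ** S = mat 1" "map_matrix real_of_int S' = matrix_inv (map_matrix real_of_int S)"
    using integer_inverse[OF det] by blast
  let ?A = "map_matrix real_of_int S" and ?A' = "map_matrix real_of_int S'"
  have AA': "?A ** ?A' = mat 1" "?A' ** ?A = mat 1"
    by (intro map_matrix_of_int_inverse S')+
  define W where "W = E_es S"
  have detv: "det (\<chi> i j. v j $ i) = 1" using basis by (simp add: adapted_basis_def)
  obtain c where c: "\<And>i. linear (\<lambda>y. c y i)" "\<And>y. y = (\<Sum>i\<in>UNIV. c y i *\<^sub>R v i)"
    "\<And>a i. c (\<Sum>i\<in>UNIV. a i *\<^sub>R v i) i = a i" "\<And>y. basis_norm v y = (MAX i. \<bar>c y i\<bar>)"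
    by (rule basis_coordinates[OF detv]) blast
  have sub: "subspace (E_u S)" "subspace (E_e S)" "subspace (E_s S)"
    unfolding E_u_def E_e_def E_s_def by (rule subspace_spectral_subspace)+
  have subW: "subspace W" unfolding W_def by (rule subspace_sums[OF sub(2,3)])
  \<comment> \<open>Removing the earlier index sets makes the three of them disjoint by
    construction, whatever the numbering \<open>e\<close>.\<close>
  define Iu where "Iu = {i. v i \<in> E_u S}"
  define Ie where "Ie = {i. v i \<in> E_e S} - Iu"
  define Is where "Is = - (Iu \<union> Ie)"
  have I: "v i \<in> E_u S" if "i \<in> Iu" for i using that by (simp add: Iu_def)
  have Ie: "v i \<in> E_e S" if "i \<in> Ie" for i using that by (simp add: Ie_def)
  have Is: "v i \<in> E_s S" if "i \<in> Is" for i
    using that adapted_basis_cases[OF basis, of i] by (auto simp: Is_def Ie_def Iu_def)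
  define part where "part J y = (\<Sum>i\<in>J. c y i *\<^sub>R v i)" for J y
  have linpart: "linear (part J)" for J
    unfolding part_def
    by (intro linear_compose_sum ballI linearI)
       (simp_all add: linear_add[OF c(1)] linear_cmul[OF c(1)] scaleR_add_left)
  have part_sum: "y = part Iu y + part Ie y + part Is y" for y
  proof -
    have "part UNIV y = part (Iu \<union> Ie) y + part Is y"
      unfolding part_def Is_def Compl_partition[of "Iu \<union> Ie", symmetric] by (intro sum.union_disjoint) auto
    also have "part (Iu \<union> Ie) y = part Iu y + part Ie y"
      unfolding part_def Ie_def by (intro sum.union_disjoint) auto
    finally show ?thesis using c(2)[of y] by (simp add: part_def)
  qed
  have partu: "part Iu y \<in> E_u S" and parte: "part Ie y \<in> E_e S" and parts: "part Is y \<in> E_s S" for y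
    unfolding part_def using I Ie Is by (auto intro!: subspace_sum subspace_scale sub)
  define pu where "pu = part Iu"
  define pw where "pw y = part Ie y + part Is y" for y
  have linpu: "linear pu" unfolding pu_def by (rule linpart)
  have linpw: "linear pw" unfolding pw_def by (intro linear_compose_add linpart)
  have split: "pu y + pw y = y" for y using part_sum[of y] by (simp add: pu_def pw_def add.assoc)
  have pu: "pu y \<in> E_u S" for y by (simp add: pu_def partu)
  have pw: "pw y \<in> W" for y unfolding W_def pw_def using parte parts by blast
  have nonres: "k = 0" if "k \<in> int_vectors" "\<And>x. x \<in> E_u S \<Longrightarrow> k \<bullet> x = 0" for k
  proof (rule ergodic_nonresonance[OF erg S'(1,2) linpw _ _ that])
    show "x - pw x \<in> E_u S" for x using split[of x] pu[of x] by (metis add_diff_cancel_right')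
    show "pw x \<in> E_es S" for x using pw by (simp add: W_def)
  qed
  \<comment> \<open>Every integer vector is orthogonal to the zero space, so a unit vector would
    contradict nonresonance.\<close>
  have "E_u S \<noteq> {0}"
  proof
    assume E0: "E_u S = {0}"
    have "(axis undefined 1 :: real^'n) = 0"
      by (rule nonres) (auto simp: E0 axis_in_int_vectors)
    then show False by simp
  qed
  let ?r = "spectral_radius_on (matrix_inv ?A) (E_u S)"
  have r: "?r > 0" by (rule E_u_nonzero_spectral_radius_pos[OF S' \<open>E_u S \<noteq> {0}\<close>])
  \<comment> \<open>Above the spectral radius, so that the contraction estimate holds; below
    \<open>\<rho>\<^sub>u\<close>, so that later constants are outweighed by powers of the
    quotient.\<close>
  define \<rho> where "\<rho> = (?r + \<rho>\<^sub>u) / 2"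
  have \<rho>: "?r < \<rho>" "\<rho> > 0" "\<rho> < \<rho>\<^sub>u" "\<rho> < 1" using r \<rho>\<^sub>u by (auto simp: \<rho>_def)
  obtain Cu where Cu: "Cu > 0" "\<And>x n. x \<in> E_u S \<Longrightarrow> norm (((*v) ?A' ^^ n) x) \<le> Cu * \<rho> ^ n * norm x"
    using E_u_contraction[OF S' \<rho>(1,2)] by blast
  have UW: "x = 0" if "x \<in> E_u S" "x \<in> W" for x
    using E_u_inter_E_es[OF S' _ that(1)] that(2) \<rho>\<^sub>u by (simp add: W_def)
  have pwU: "pw x = 0" if "x \<in> E_u S" for x
  proof (rule UW)
    have "pw x = x - pu x" using split[of x] by (simp add: algebra_simps)
    then show "pw x \<in> E_u S" using subspace_diff[OF sub(1) that pu] by simp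
  qed (rule pw)
  have puW: "pu x = 0" if "x \<in> W" for x
  proof (rule UW)
    have "pu x = x - pw x" using split[of x] by (simp add: algebra_simps)
    then show "pu x \<in> W" using subspace_diff[OF subW that pw] by simp
  qed (rule pu)
  have U_inv: "map_matrix real_of_int N *v y \<in> E_u S" if "S ** N = N ** S" "y \<in> E_u S" for N y
    using that unfolding E_u_def by (rule spectral_subspace_invariant)
  have int: "map_matrix real_of_int N *v x \<in> int_vectors" if "x \<in> int_vectors" for N :: "int^'n^'n" and x
    using that unfolding int_vectors_def
    by (auto simp: matrix_vector_mult_def intro!: Ints_sum Ints_mult)
  have splitting: "toral_splitting ((*v) ?A) ((*v) ?A') pu pw (E_u S) W Cu \<rho>"
  proof (rule toral_splitting.intro)
    show "linear ((*v) ?A)" "linear ((*v) ?A')" by (rule matrix_vector_mul_linear)+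
    show "linear pu" "linear pw" by (fact linpu linpw)+
    show "?A *v (?A' *v x) = x" "?A' *v (?A *v x) = x" for x by (simp_all add: matrix_vector_mul_assoc AA')
    show "?A *v x \<in> int_vectors" "?A' *v x \<in> int_vectors" if "x \<in> int_vectors" for x using that by (rule int)+
    show "pu x + pw x = x" "pu x \<in> E_u S" "pw x \<in> W" for x by (fact split pu pw)+
    show "subspace (E_u S)" "subspace W" by (fact sub subW)+
    show "x \<in> E_u S \<Longrightarrow> pw x = 0" "x \<in> W \<Longrightarrow> pu x = 0" for x by (fact pwU puW)+
    show "x \<in> E_u S \<Longrightarrow> ?A *v x \<in> E_u S" "x \<in> E_u S \<Longrightarrow> ?A' *v x \<in> E_u S" for x
      using S'(1,2) by (simp_all add: U_inv)
    show "x \<in> W \<Longrightarrow> ?A *v x \<in> W" for x unfolding W_def by (intro E_es_invariant) simp_all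
    show "0 < \<rho>" "\<rho> < 1" "Cu > 0" by (fact \<rho> Cu)+
    show "x \<in> E_u S \<Longrightarrow> norm (((*v) ?A' ^^ n) x) \<le> Cu * \<rho> ^ n * norm x" for x n by (rule Cu)
    show "\<exists>C. \<forall>x\<in>W. \<forall>n. norm (((*v) ?A ^^ n) x) \<le> C * \<theta> ^ n * norm x" if "\<theta> > 1" for \<theta>
      using E_es_growth[OF that, of S] unfolding W_def by blast
    show "k = 0" if "k \<in> int_vectors" "\<And>x. x \<in> E_u S \<Longrightarrow> k \<bullet> x = 0" for k using that by (rule nonres)
  qed
  have "\<exists>K>0. \<forall>x. \<bar>c x i\<bar> \<le> K * norm x" for i
    using linear_bounded_pos[OF c(1)[of i]] by auto
  then obtain K' where K': "\<And>i. K' i > 0" "\<And>i x. \<bar>c x i\<bar> \<le> K' i * norm x" by metis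
  define K where "K = (\<Sum>i\<in>UNIV. K' i)"
  have K: "K > 0" using K'(1) unfolding K_def by (intro sum_pos) auto
  have cK: "\<bar>c x i\<bar> \<le> K * norm x" for x i
  proof -
    have "K' i \<le> K" unfolding K_def using K'(1) by (intro member_le_sum) (auto intro: less_imp_le)
    then show ?thesis using K'(2)[of x i] mult_right_mono[of "K' i" K "norm x"] by simp
  qed
  have cpart: "c (part J y) i = (if i \<in> J then c y i else 0)" for J y i
  proof -
    have "part J y = (\<Sum>i\<in>UNIV. (if i \<in> J then c y i else 0) *\<^sub>R v i)"
      unfolding part_def by (intro sum.mono_neutral_cong_left) auto
    then show ?thesis by (simp add: c(3))
  qed
  have bn: "basis_norm v y \<le> \<delta>" if "\<And>i. \<bar>c y i\<bar> \<le> \<delta>" for y \<delta>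
    unfolding c(4) using that by (intro Max.boundedI) auto
  show ?thesis
  proof (rule that[OF splitting \<rho>(3) K])
    fix x :: "real^'n" and \<delta> assume x: "K * norm x \<le> \<delta>"
    then have xi: "\<bar>c x i\<bar> \<le> \<delta>" for i using cK[of x i] by linarith
    then have "0 \<le> \<delta>" using abs_ge_zero order_trans by blast
    show "x \<in> ball_in v (E_u S) \<delta>" if "x \<in> E_u S"
      using that bn xi by (simp add: ball_in_def)
    assume "x \<in> W"
    then have "x = part Is x + part Ie x" using split[of x] puW[of x] by (simp add: pw_def add.commute)
    moreover have "part Is x \<in> ball_in v (E_s S) \<delta>" "part Ie x \<in> ball_in v (E_e S) \<delta>"
      using xi \<open>0 \<le> \<delta>\<close> parts parte by (auto simp: ball_in_def cpart intro!: bn)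
    ultimately show "\<exists>h\<in>ball_in v (E_s S) \<delta>. \<exists>h'\<in>ball_in v (E_e S) \<delta>. x = h + h'" by blast
  qed
qed

section \<open>Conditional expectations\<close>

lemma measurable_torus_measure1 [simp]: "f \<in> torus_measure \<rightarrow>\<^sub>M N \<longleftrightarrow> f \<in> borel \<rightarrow>\<^sub>M N"
  by (simp add: measurable_cong_sets[OF sets_torus_measure refl])

lemma measurable_torus_measure2 [simp]: "f \<in> N \<rightarrow>\<^sub>M torus_measure \<longleftrightarrow> f \<in> N \<rightarrow>\<^sub>M borel"
  by (simp add: measurable_cong_sets[OF refl sets_torus_measure])

lemma integrable_torus_bounded:
  fixes f :: "'n::finite torus \<Rightarrow> real"
  assumes "f \<in> borel_measurable borel" "\<And>x. \<bar>f x\<bar> \<le> B"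
  shows "integrable torus_measure f"
  using assms by (intro torus.integrable_const_bound[of _ B]) auto

lemma sigma_finite_subalgebra_torus:
  "subalgebra torus_measure F \<Longrightarrow> sigma_finite_subalgebra torus_measure F"
  by (intro finite_measure_subalgebra_is_sigma_finite finite_measure_subalgebra.intro
      finite_measure_subalgebra_axioms.intro) (rule torus.finite_measure_axioms)

text \<open>The hypothesis is tested on the part of \<open>V\<close> where the conditional
  expectation exceeds c + E, and on the part where it is below c - E. Both are in \<open>F\<close>,
  and on each a positive function has integral at most 0, so both are null.\<close>

lemma cond_exp_close_on:
  assumes "finite_measure M" and subalg: "subalgebra M F" and f: "integrable M f" and V: "V \<in> sets F"
    and close: "\<And>D. D \<in> sets F \<Longrightarrow> D \<subseteq> V \<Longrightarrow> \<bar>(\<integral>x\<in>D. f x \<partial>M) - c * measure M D\<bar> \<le> E * measure M D"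
  shows "AE x in M. x \<in> V \<longrightarrow> \<bar>real_cond_exp M F f x - c\<bar> \<le> E"
proof -
  interpret finite_measure M by fact
  interpret sigma_finite_subalgebra M F
    by (intro finite_measure_subalgebra_is_sigma_finite finite_measure_subalgebra.intro assms finite_measure_subalgebra_axioms.intro)
  let ?g = "real_cond_exp M F f"
  have g: "integrable M ?g" using f by (rule real_cond_exp_int)
  have FM: "A \<in> sets M" if "A \<in> sets F" for A using that subalg by (auto simp: subalgebra_def)
  have spF: "space F = space M" using subalg by (simp add: subalgebra_def)
  have *: "AE x in M. x \<notin> {x \<in> V. h x > 0}"
    if h: "h = (\<lambda>x. ?g x - (c + E)) \<or> h = (\<lambda>x. (c - E) - ?g x)" for h
  proof -
    let ?D = "{x \<in> V. h x > 0}"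
    have hF: "h \<in> borel_measurable F" using h by auto
    have "?D = V \<inter> {x \<in> space F. h x > 0}" using sets.sets_into_space[OF V] by auto
    then have D: "?D \<in> sets F" using V hF by simp
    have [measurable]: "?D \<in> sets M" by (rule FM[OF D])
    have "integrable M h" using h g by auto
    then have int: "set_integrable M ?D h"
      unfolding set_integrable_def by (intro integrable_mult_indicator) simp_all
    have cl: "\<bar>(\<integral>x\<in>?D. ?g x \<partial>M) - c * measure M ?D\<bar> \<le> E * measure M ?D"
      using close[OF D] real_cond_exp_intA[OF f D] by auto
    have si: "set_integrable M ?D ?g" "set_integrable M ?D (\<lambda>x. a)" for a :: real
      unfolding set_integrable_def
      by (fact integrable_mult_indicator[OF \<open>?D \<in> sets M\<close> g]
          integrable_mult_indicator[OF \<open>?D \<in> sets M\<close> integrable_const])+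
    have sc: "(\<integral>x\<in>?D. a \<partial>M) = a * measure M ?D" for a
      by (simp add: set_lebesgue_integral_def)
    have le: "(\<integral>x\<in>?D. h x \<partial>M) \<le> 0"
      using h
    proof
      assume "h = (\<lambda>x. ?g x - (c + E))"
      then have "(\<integral>x\<in>?D. h x \<partial>M) = (\<integral>x\<in>?D. ?g x \<partial>M) - (c + E) * measure M ?D"
        using set_integral_diff(2)[OF si(1) si(2)[of "c + E"]] sc[of "c + E"] by simp
      then show ?thesis using cl by (simp add: algebra_simps)
    next
      assume "h = (\<lambda>x. (c - E) - ?g x)"
      then have "(\<integral>x\<in>?D. h x \<partial>M) = (c - E) * measure M ?D - (\<integral>x\<in>?D. ?g x \<partial>M)"
        using set_integral_diff(2)[OF si(2)[of "c - E"] si(1)] sc[of "c - E"] by simp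
      then show ?thesis using cl by (simp add: algebra_simps)
    qed
    have nn: "AE x in M. 0 \<le> indicator ?D x *\<^sub>R h x"
      by (intro AE_I2) (auto simp: indicator_def)
    have "(\<integral>x. indicator ?D x *\<^sub>R h x \<partial>M) = 0"
      using le integral_nonneg_AE[OF nn] unfolding set_lebesgue_integral_def by linarith
    then have "AE x in M. indicator ?D x *\<^sub>R h x = 0"
      using integral_nonneg_eq_0_iff_AE[OF int[unfolded set_integrable_def] nn] by blast
    then show ?thesis by (rule eventually_mono) (auto simp: indicator_def split: if_splits)
  qed
  have "AE x in M. x \<notin> {x \<in> V. ?g x - (c + E) > 0}" using *[OF disjI1[OF refl]] .
  moreover have "AE x in M. x \<notin> {x \<in> V. (c - E) - ?g x > 0}" using *[OF disjI2[OF refl]] .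
  ultimately show ?thesis by eventually_elim auto
qed

text \<open>The supremum of \<open>\<phi>\<close> over the fibres of \<open>\<Psi>\<close> need not be Borel measurable. Instead, if
  \<open>\<phi> > c + \<omega>\<close> and the conditional expectation is below \<open>c\<close> on a set of positive measure, the image
  under \<open>\<Psi>\<close> of a compact subset is compact, hence its preimage is in \<open>F\<close>; there
  \<open>\<phi> > c\<close>, which contradicts the value of the integral.\<close>

lemma cond_exp_fibre_oscillation_upper:
  fixes \<Psi> :: "'n::finite torus \<Rightarrow> 'b::{t2_space}"
  assumes \<Psi>: "\<Psi> \<in> borel_measurable borel"
    and F: "subalgebra torus_measure F" "sets F = {\<Psi> -` H | H. H \<in> sets borel}"
    and G0: "G0 \<in> sets borel" "AE x in torus_measure. x \<in> G0"
      "continuous_on (abs_torus -` G0) (\<lambda>x. \<Psi> (abs_torus x))"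
    and \<phi>: "\<phi> \<in> borel_measurable borel" "integrable torus_measure \<phi>"
    and osc: "\<And>x y. \<Psi> x = \<Psi> y \<Longrightarrow> \<phi> x \<le> \<phi> y + \<omega>"
  shows "AE x in torus_measure. \<phi> x \<le> real_cond_exp torus_measure F \<phi> x + \<omega>"
proof -
  interpret sigma_finite_subalgebra torus_measure F
    using F(1) by (rule sigma_finite_subalgebra_torus)
  let ?E = "real_cond_exp torus_measure F \<phi>"
  have E_F: "?E \<in> borel_measurable F" by (rule borel_measurable_cond_exp)
  have E_M [measurable]: "?E \<in> borel_measurable borel"
    using borel_measurable_cond_exp2[of torus_measure F \<phi>] by simp
  note \<phi>(1) [measurable] G0(1) [measurable]
  have spF: "space F = UNIV" using F(1) by (simp add: subalgebra_def)
  have "AE x in torus_measure. \<not> (?E x < c \<and> c + \<omega> < \<phi> x)" for c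
  proof (rule ccontr)
    let ?B = "{x. ?E x < c \<and> c + \<omega> < \<phi> x}"
    assume neg: "\<not> ?thesis"
    have B [measurable]: "?B \<in> sets borel" by simp
    have "emeasure torus_measure (?B \<inter> G0) \<noteq> 0"
    proof
      assume "emeasure torus_measure (?B \<inter> G0) = 0"
      then have "?B \<inter> G0 \<in> null_sets torus_measure" by (intro null_setsI) simp_all
      then have "AE x in torus_measure. x \<notin> ?B \<inter> G0" by (rule AE_not_in)
      then have "AE x in torus_measure. \<not> (?E x < c \<and> c + \<omega> < \<phi> x)"
        using G0(2) by eventually_elim auto
      then show False using neg by contradiction
    qed
    moreover have BG [measurable]: "?B \<inter> G0 \<in> sets borel" by simp
    define B0 where "B0 = cube \<inter> abs_torus -` (?B \<inter> G0)"
    have B0 [measurable]: "B0 \<in> sets borel"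
      unfolding B0_def using measurable_sets[OF borel_measurable_abs_torus BG] by (simp only: space_borel Int_UNIV_right) auto
    ultimately have pos: "emeasure lborel B0 \<noteq> 0"
      using emeasure_torus_measure[OF BG] by (simp add: B0_def)
    have fin: "emeasure lborel B0 \<le> 1"
      unfolding emeasure_cube[where 'n='n, symmetric] by (rule emeasure_mono) (auto simp: B0_def)
    define m where "m = measure lborel B0"
    have m: "emeasure lborel B0 = ennreal m"
      unfolding m_def using fin by (intro emeasure_eq_ennreal_measure) (auto simp: top_unique)
    have m0: "m > 0" using pos m by (metis ennreal_0 ennreal_neg linorder_not_le order_le_less)
    have "B0 \<in> sets lebesgue" using B0 by (simp add: sets_completionI_sets)
    \<comment> \<open>The part left out has measure less than that of \<open>B0\<close>, so the
      compact set \<open>K\<close> keeps positive measure, and it avoids the discontinuities of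
      \<Psi>.\<close>
    then obtain K where K: "closed K" "K \<subseteq> B0" "B0 - K \<in> lmeasurable" "emeasure lebesgue (B0 - K) < ennreal m"
      using sets_lebesgue_inner_closed[of B0 m] m0 by blast
    have K_pos: "emeasure lborel K \<noteq> 0"
    proof
      assume K0: "emeasure lborel K = 0"
      have [measurable]: "K \<in> sets borel" using K(1) by (rule borel_closed)
      have "emeasure lborel B0 = emeasure lborel (B0 - K) + emeasure lborel K"
        using K(2) by (subst plus_emeasure) (auto simp: Un_absorb2)
      then show False using K(4) K0 m by simp
    qed
    have "bounded K"
    proof (rule bounded_subset)
      show "K \<subseteq> cbox 0 (\<chi> i. 1)" using K(2) by (auto simp: B0_def cube_def mem_box_cart less_imp_le)
    qed (rule bounded_cbox)
    then have "compact K" using K(1) by (simp add: compact_eq_bounded_closed)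
    have "continuous_on K (\<lambda>x. \<Psi> (abs_torus x))"
      by (rule continuous_on_subset[OF G0(3)]) (use K(2) in \<open>auto simp: B0_def\<close>)
    then have "compact ((\<lambda>x. \<Psi> (abs_torus x)) ` K)" using \<open>compact K\<close> by (rule compact_continuous_image)
    then have H: "(\<lambda>x. \<Psi> (abs_torus x)) ` K \<in> sets borel" by (rule borel_compact)
    \<comment> \<open>The union of the fibres meeting \<open>K\<close>, cut down to a set of
      \<open>F\<close>. It contains the image of \<open>K\<close>, so it has positive measure, and
      on it the conditional expectation is below c while \<phi> exceeds c.\<close>
    let ?D = "\<Psi> -` (\<lambda>x. \<Psi> (abs_torus x)) ` K \<inter> {x. ?E x < c}"
    have "\<Psi> -` (\<lambda>x. \<Psi> (abs_torus x)) ` K \<in> sets F" using H F(2) by blast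
    moreover have "{x. ?E x < c} \<in> sets F" using borel_measurable_iff_less[of ?E F] E_F spF by simp
    ultimately have D: "?D \<in> sets F" by blast
    then have DM [measurable]: "?D \<in> sets borel" using F(1) by (auto simp: subalgebra_def)
    have "emeasure lborel K \<le> emeasure lborel (cube \<inter> abs_torus -` ?D)"
    proof (rule emeasure_mono)
      show "K \<subseteq> cube \<inter> abs_torus -` ?D" using K(2) by (auto simp: B0_def)
      have "abs_torus -` ?D \<in> sets borel" using measurable_sets[OF borel_measurable_abs_torus DM] by simp
      then show "cube \<inter> abs_torus -` ?D \<in> sets lborel" by (simp only: sets_lborel) (intro sets.Int cube_borel)
    qed
    then have D_pos: "emeasure torus_measure ?D \<noteq> 0"
      using K_pos emeasure_torus_measure[OF DM] by auto
    have gt: "\<phi> y > c" if y: "y \<in> ?D" for y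
    proof -
      obtain x where x: "x \<in> K" "\<Psi> y = \<Psi> (abs_torus x)" using y by blast
      have "c + \<omega> < \<phi> (abs_torus x)" using x(1) K(2) by (auto simp: B0_def)
      also have "\<dots> \<le> \<phi> y + \<omega>" using osc x(2) by simp
      finally show ?thesis by simp
    qed
    let ?h = "\<lambda>x. indicator ?D x *\<^sub>R (\<phi> x - ?E x)"
    have intE: "integrable torus_measure ?E" using \<phi>(2) by (rule real_cond_exp_int)
    have inth: "integrable torus_measure ?h"
      using DM by (intro integrable_mult_indicator Bochner_Integration.integrable_diff intE \<phi>(2)) simp
    have nn: "AE x in torus_measure. 0 \<le> ?h x"
      using gt by (intro AE_I2) (fastforce simp: indicator_def)
    have "(\<integral>x. ?h x \<partial>torus_measure) = (\<integral>x\<in>?D. \<phi> x \<partial>torus_measure) - (\<integral>x\<in>?D. ?E x \<partial>torus_measure)"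
      unfolding set_lebesgue_integral_def scaleR_diff_right
      using DM by (intro Bochner_Integration.integral_diff integrable_mult_indicator intE \<phi>(2)) simp_all
    also have "\<dots> = 0" using real_cond_exp_intA[OF \<phi>(2) D] by simp
    finally have "AE x in torus_measure. ?h x = 0"
      using integral_nonneg_eq_0_iff_AE[OF inth nn] by blast
    then have "AE x in torus_measure. x \<notin> ?D"
    proof (rule eventually_mono)
      fix x assume "?h x = 0"
      then show "x \<notin> ?D" using gt[of x] by (auto simp: indicator_def split: if_splits)
    qed
    then have "emeasure torus_measure ?D = 0"
      using DM by (subst (asm) AE_iff_null_sets[symmetric]) (auto simp: null_sets_def)
    then show False using D_pos by contradiction
  qed
  \<comment> \<open>Any point violating the claim is detected by a rational level c, so countably
    many null sets suffice.\<close>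
  then have "AE x in torus_measure. \<forall>q::rat. \<not> (?E x < of_rat q \<and> of_rat q + \<omega> < \<phi> x)"
    by (simp add: AE_all_countable)
  then show ?thesis
  proof (rule eventually_mono)
    fix x assume *: "\<forall>q::rat. \<not> (?E x < of_rat q \<and> of_rat q + \<omega> < \<phi> x)"
    show "\<phi> x \<le> ?E x + \<omega>"
    proof (rule ccontr)
      assume "\<not> ?thesis"
      then obtain q where "?E x < of_rat q" "of_rat q < \<phi> x - \<omega>" using of_rat_dense[of "?E x" "\<phi> x - \<omega>"] by auto
      then show False using * by (metis less_diff_eq)
    qed
  qed
qed

lemma cond_exp_fibre_oscillation:
  fixes \<Psi> :: "'n::finite torus \<Rightarrow> 'b::{t2_space}"
  assumes \<Psi>: "\<Psi> \<in> borel_measurable borel"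
    and F: "subalgebra torus_measure F" "sets F = {\<Psi> -` H | H. H \<in> sets borel}"
    and G0: "G0 \<in> sets borel" "AE x in torus_measure. x \<in> G0"
      "continuous_on (abs_torus -` G0) (\<lambda>x. \<Psi> (abs_torus x))"
    and \<phi>: "\<phi> \<in> borel_measurable borel" "integrable torus_measure \<phi>"
    and osc: "\<And>x y. \<Psi> x = \<Psi> y \<Longrightarrow> \<bar>\<phi> x - \<phi> y\<bar> \<le> \<omega>"
  shows "AE x in torus_measure. \<bar>real_cond_exp torus_measure F \<phi> x - \<phi> x\<bar> \<le> \<omega>"
proof -
  interpret sigma_finite_subalgebra torus_measure F
    using F(1) by (rule sigma_finite_subalgebra_torus)
  have o1: "\<phi> x \<le> \<phi> y + \<omega>" if "\<Psi> x = \<Psi> y" for x y using osc[OF that] by linarith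
  have o2: "(- 1) * \<phi> x \<le> (- 1) * \<phi> y + \<omega>" if "\<Psi> x = \<Psi> y" for x y using osc[OF that] by linarith
  have "AE x in torus_measure. \<phi> x \<le> real_cond_exp torus_measure F \<phi> x + \<omega>"
    by (rule cond_exp_fibre_oscillation_upper[OF \<Psi> F G0 \<phi> o1])
  moreover have "AE x in torus_measure. (- 1) * \<phi> x \<le> real_cond_exp torus_measure F (\<lambda>x. (- 1) * \<phi> x) x + \<omega>"
    by (rule cond_exp_fibre_oscillation_upper[OF \<Psi> F G0 _ _ o2]) (use \<phi> in auto)
  moreover have "AE x in torus_measure. real_cond_exp torus_measure F (\<lambda>x. (- 1) * \<phi> x) x = (- 1) * real_cond_exp torus_measure F \<phi> x"
    using \<phi>(2) by (rule real_cond_exp_cmult)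
  ultimately show ?thesis by eventually_elim auto
qed

lemma borel_torus_rep_component [measurable]: "(\<lambda>x. torus_rep x $ i) \<in> borel_measurable borel"
proof -
  have "(\<lambda>x. torus_rep x \<bullet> axis i 1) \<in> borel_measurable borel" by measurable
  then show ?thesis by (simp add: inner_axis)
qed

lemma emeasure_torus_rep_less:
  fixes i :: "'n::finite"
  assumes "0 \<le> c"
  shows "emeasure torus_measure {x. torus_rep x $ i < c} \<le> ennreal c"
    and "emeasure torus_measure {x. 1 - c \<le> torus_rep x $ i} \<le> ennreal c"
proof -
  have box: "emeasure lborel (cbox a b) = ennreal c"
    if ab: "\<And>j. b $ j - a $ j = (if j = i then c else 1)" for a b :: "real^'n"
  proof -
    have inn: "(b - a) \<bullet> axis j 1 = (if j = i then c else 1)" for j using ab[of j] by (simp add: inner_axis)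
    have "\<forall>u\<in>Basis. a \<bullet> u \<le> b \<bullet> u"
      using inn assms by (auto simp: Basis_vec_def inner_diff_left) (smt (verit))
    moreover have "(\<Prod>u\<in>Basis. (b - a) \<bullet> u) = (\<Prod>j\<in>UNIV. (b - a) \<bullet> axis j 1)"
    proof -
      have eq: "(Basis :: (real^'n) set) = range (\<lambda>j. axis j 1)" by (auto simp: Basis_vec_def)
      show ?thesis unfolding eq by (subst prod.reindex) (auto simp: inj_on_def axis_eq_axis)
    qed
    moreover have "\<dots> = c" unfolding inn by simp
    ultimately show ?thesis by (simp add: emeasure_lborel_cbox_eq)
  qed
  have s1: "{x. torus_rep x $ i < c} \<in> sets borel" "{x. 1 - c \<le> torus_rep x $ i} \<in> sets borel" by simp_all
  have "cube \<inter> abs_torus -` {x. torus_rep x $ i < c} \<subseteq> cbox 0 (\<chi> j. if j = i then c else 1)"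
    by (auto simp: mem_box_cart torus_rep_abs_cube) (auto simp: cube_def less_imp_le)
  then have "emeasure torus_measure {x. torus_rep x $ i < c} \<le> emeasure lborel (cbox 0 (\<chi> j. if j = i then c else 1))"
    unfolding emeasure_torus_measure[OF s1(1)] by (rule emeasure_mono) simp
  also have "\<dots> = ennreal c" by (rule box) simp
  finally show "emeasure torus_measure {x. torus_rep x $ i < c} \<le> ennreal c" .
  have "cube \<inter> abs_torus -` {x. 1 - c \<le> torus_rep x $ i} \<subseteq> cbox (\<chi> j. if j = i then 1 - c else 0) (\<chi> j. 1)"
    by (auto simp: mem_box_cart torus_rep_abs_cube) (auto simp: cube_def less_imp_le)
  then have "emeasure torus_measure {x. 1 - c \<le> torus_rep x $ i}
      \<le> emeasure lborel (cbox (\<chi> j. if j = i then 1 - c else 0) (\<chi> j. 1))"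
    unfolding emeasure_torus_measure[OF s1(2)] by (rule emeasure_mono) simp
  also have "\<dots> = ennreal c" by (rule box) simp
  finally show "emeasure torus_measure {x. 1 - c \<le> torus_rep x $ i} \<le> ennreal c" .
qed

section \<open>The filtration\<close>

lemma torus_map_add: "torus_map S (x + y) = torus_map S x + torus_map S y"
proof -
  have "torus_map S (abs_torus (torus_rep x) + abs_torus (torus_rep y))
    = torus_map S (abs_torus (torus_rep x)) + torus_map S (abs_torus (torus_rep y))"
    unfolding abs_torus_add torus_map_abs by (simp add: matrix_vector_right_distrib)
  then show ?thesis by simp
qed

lemma funpow_torus_map_add: "(torus_map S ^^ n) (x + y) = (torus_map S ^^ n) x + (torus_map S ^^ n) y"
  by (induction n) (simp_all add: torus_map_add)

lemma funpow_torus_map_abs: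
  "(torus_map S ^^ n) (abs_torus x) = abs_torus (((*v) (map_matrix real_of_int S) ^^ n) x)"
  by (induction n) (simp_all add: torus_map_abs)

lemma borel_measurable_funpow_torus_map [measurable]: "torus_map S ^^ n \<in> borel_measurable borel"
  by (induction n) (auto intro: measurable_comp borel_measurable_torus_map simp: id_def)

lemma emeasure_funpow_vimage:
  assumes pres: "\<And>A. A \<in> sets borel \<Longrightarrow> emeasure torus_measure (torus_map S -` A) = emeasure torus_measure A"
    and A: "A \<in> sets borel"
  shows "emeasure torus_measure ((torus_map S ^^ k) -` A) = emeasure torus_measure A"
proof (induction k)
  case (Suc k)
  have eq: "(torus_map S ^^ Suc k) -` A = torus_map S -` ((torus_map S ^^ k) -` A)"
    by (simp only: funpow_Suc_right vimage_comp)
  have "(torus_map S ^^ k) -` A \<in> sets borel"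
    using measurable_sets[OF borel_measurable_funpow_torus_map A] by simp
  then show ?case unfolding eq using pres Suc by simp
qed simp

lemma torus_map_inverse:
  assumes "\<And>x. map_matrix real_of_int S *v (map_matrix real_of_int S' *v x) = x"
  shows "torus_map S (torus_map S' x) = x"
proof -
  have "torus_map S (torus_map S' (abs_torus (torus_rep x))) = abs_torus (torus_rep x)"
    unfolding torus_map_abs assms ..
  then show ?thesis by simp
qed

locale toral_filtration =
  toral_splitting "(*v) (map_matrix real_of_int S)" "(*v) (map_matrix real_of_int S')" pu pw U W Cu \<rho>
  for S S' :: "int^'n::finite^'n" and pu pw U W Cu \<rho> +
  assumes preserving: "distr torus_measure torus_measure (torus_map S) = torus_measure"
begin

abbreviation "T \<equiv> torus_map S"
abbreviation "T' \<equiv> torus_map S'"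

lemma TT': "T (T' x) = x" and T'T: "T' (T x) = x"
  by (auto intro!: torus_map_inverse AA' A'A)

lemma inv_T: "inv T = T'"
  by (rule inv_unique_comp) (auto simp: TT' T'T)

lemma emeasure_T: "A \<in> sets borel \<Longrightarrow> emeasure torus_measure (T -` A) = emeasure torus_measure A"
  by (subst (2) preserving[symmetric], subst emeasure_distr) simp_all

lemma emeasure_T':
  assumes A: "A \<in> sets borel"
  shows "emeasure torus_measure (T' -` A) = emeasure torus_measure A"
proof -
  have "T' -` A \<in> sets borel" using measurable_sets[OF borel_measurable_torus_map A] by simp
  then have "emeasure torus_measure (T -` T' -` A) = emeasure torus_measure (T' -` A)" by (rule emeasure_T)
  moreover have "T -` T' -` A = A" by (auto simp: T'T)
  ultimately show ?thesis by simp
qed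

lemma emeasure_T_funpow: "A \<in> sets borel \<Longrightarrow> emeasure torus_measure ((T ^^ k) -` A) = emeasure torus_measure A"
  by (rule emeasure_funpow_vimage) (simp_all add: emeasure_T)

lemma emeasure_T'_funpow: "A \<in> sets borel \<Longrightarrow> emeasure torus_measure ((T' ^^ k) -` A) = emeasure torus_measure A"
  by (rule emeasure_funpow_vimage) (simp_all add: emeasure_T')

text \<open>Two points have the same itinerary iff, for every \<open>k\<close>, the representatives in the cube of their
  images under \<open>T\<^sup>-\<^sup>k\<close> lie on the same translate of \<open>U\<close>.\<close>

definition itinerary :: "'n torus \<Rightarrow> nat \<Rightarrow> real^'n"
  where "itinerary x k = pw (torus_rep ((T' ^^ k) x))"

text \<open>The sequences carry the product topology. It is Hausdorff, as
  \<open>cond_exp_fibre_oscillation\<close> requires, and lets continuity and measurability of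
  \<open>itinerary\<close> be checked coordinate by coordinate.\<close>

definition F0 :: "'n torus measure"
  where "F0 = vimage_algebra UNIV itinerary borel"

lemma borel_measurable_itinerary [measurable]: "itinerary \<in> borel_measurable borel"
proof (rule measurable_coordinatewise_then_product)
  fix k
  have "pw \<in> borel_measurable borel"
    by (rule borel_measurable_continuous_onI[OF linear_continuous_on]) (use linpw in \<open>simp add: linear_conv_bounded_linear\<close>)
  then show "(\<lambda>x. itinerary x k) \<in> borel_measurable borel"
    unfolding itinerary_def by measurable
qed

lemma sets_F0: "sets F0 = {itinerary -` H | H. H \<in> sets borel}"
  unfolding F0_def by (subst sets_vimage_algebra2) auto

lemma space_F0: "space F0 = UNIV"
  by (simp add: F0_def)

lemma borel_measurable_iterate: "int_iterate T k \<in> borel_measurable borel"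
  by (simp add: int_iterate_def inv_T)

lemma sets_pullback: "sets (pullback_algebra T F0 k) = {(\<lambda>x. itinerary (int_iterate T k x)) -` H | H. H \<in> sets borel}"
proof -
  have eq: "(\<lambda>x. itinerary (int_iterate T k x)) -` H = int_iterate T k -` itinerary -` H" for H by auto
  show ?thesis
    unfolding pullback_algebra_def space_F0 eq
    by (subst sets_vimage_algebra2) (auto simp: space_F0 sets_F0)
qed

lemma subalgebra_pullback: "subalgebra torus_measure (pullback_algebra T F0 k)"
proof -
  have "(\<lambda>x. itinerary (int_iterate T k x)) -` H \<in> sets borel" if "H \<in> sets borel" for H
  proof -
    have "(\<lambda>x. itinerary (int_iterate T k x)) \<in> borel_measurable borel"
      using borel_measurable_iterate by (rule measurable_compose[OF _ borel_measurable_itinerary])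
    from measurable_sets[OF this that] show ?thesis by simp
  qed
  then show ?thesis
    by (auto simp: subalgebra_def sets_pullback) (simp add: pullback_algebra_def space_F0)
qed

lemma subalgebra_F0: "subalgebra torus_measure F0"
  using measurable_sets[OF borel_measurable_itinerary] by (auto simp: subalgebra_def space_F0 sets_F0)

text \<open>The itinerary of \<open>x\<close> is that of \<open>T x\<close> with the entry at 0
  deleted.\<close>

lemma F0_increasing: "sets F0 \<subseteq> sets (pullback_algebra T F0 1)"
proof
  define shift where "shift f k = f (Suc k)" for f :: "nat \<Rightarrow> real^'n" and k
  have shift [measurable]: "shift \<in> borel_measurable borel"
    unfolding shift_def
    by (intro borel_measurable_continuous_onI continuous_on_coordinatewise_then_product continuous_on_product_coordinates)
  have eq: "itinerary x = shift (itinerary (int_iterate T 1 x))" for x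
    by (rule ext) (simp add: shift_def itinerary_def int_iterate_def funpow_Suc_right T'T del: funpow.simps)
  fix A assume "A \<in> sets F0"
  then obtain H where H: "H \<in> sets borel" "A = itinerary -` H" by (auto simp: sets_F0)
  have "A = (\<lambda>x. itinerary (int_iterate T 1 x)) -` (shift -` H)"
    unfolding H(2) by (auto simp: eq[symmetric])
  moreover have "shift -` H \<in> sets borel" using measurable_sets[OF shift H(1)] by simp
  ultimately show "A \<in> sets (pullback_algebra T F0 1)" unfolding sets_pullback by blast
qed

text \<open>On the covering space each entry is a linear map followed by fractional parts and
  \<open>pw\<close>; only an integer coordinate can cause a jump, and those points are
  excluded.\<close>

lemma itinerary_continuous:
  "continuous_on (abs_torus -` {x. \<forall>k i. torus_rep ((T' ^^ k) ((T ^^ n) x)) $ i \<noteq> 0})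
    (\<lambda>x. itinerary ((T ^^ n) (abs_torus x)))"
proof (rule continuous_on_coordinatewise_then_product)
  fix k
  let ?L = "\<lambda>x. ((*v) (map_matrix real_of_int S') ^^ k) (((*v) (map_matrix real_of_int S) ^^ n) x)"
  let ?X = "abs_torus -` {x. \<forall>k i. torus_rep ((T' ^^ k) ((T ^^ n) x)) $ i \<noteq> 0}"
  have L: "(T' ^^ k) ((T ^^ n) (abs_torus x)) = abs_torus (?L x)" for x
    by (simp add: funpow_torus_map_abs)
  have "linear ?L"
    using linear_compose[OF linear_funpow[OF linA, of n] linear_funpow[OF linA', of k]] by (simp add: comp_def)
  then have contL: "continuous_on X ?L" for X
    by (intro linear_continuous_on) (simp add: linear_conv_bounded_linear)
  have "continuous_on ?X (\<lambda>x. frac (?L x $ i))" for i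
  proof (rule continuous_on_compose2[of "- \<int>" frac])
    show "continuous_on (- \<int>) (frac :: real \<Rightarrow> real)"
      by (intro continuous_at_imp_continuous_on ballI continuous_frac) auto
    show "continuous_on ?X (\<lambda>x. ?L x $ i)" by (intro continuous_intros contL)
    show "(\<lambda>x. ?L x $ i) ` ?X \<subseteq> - \<int>"
    proof (rule image_subsetI)
      fix x assume "x \<in> ?X"
      then have "torus_rep ((T' ^^ k) ((T ^^ n) (abs_torus x))) $ i \<noteq> 0" by auto
      then have "frac (?L x $ i) \<noteq> 0" unfolding L by (simp add: torus_rep_abs)
      then show "?L x $ i \<in> - \<int>" by (simp add: frac_eq_0_iff)
    qed
  qed
  then have "continuous_on ?X (\<lambda>x. \<chi> i. frac (?L x $ i))" by (intro continuous_on_vec_lambda)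
  then have "continuous_on ?X (\<lambda>x. pw (\<chi> i. frac (?L x $ i)))"
    by (rule continuous_on_compose2[of UNIV pw, rotated])
       (use linpw in \<open>auto intro!: linear_continuous_on simp: linear_conv_bounded_linear\<close>)
  then show "continuous_on ?X (\<lambda>x. itinerary ((T ^^ n) (abs_torus x)) k)"
    unfolding itinerary_def L torus_rep_abs .
qed

lemma AE_interior:
  "AE x in torus_measure. x \<in> {x. \<forall>k i. torus_rep ((T' ^^ k) ((T ^^ n) x)) $ i \<noteq> 0}"
proof -
  have "AE x in torus_measure. torus_rep ((T' ^^ k) ((T ^^ n) x)) $ i \<noteq> 0" for k i
  proof -
    let ?Z = "{x :: 'n torus. torus_rep x $ i = 0}"
    have Z [measurable]: "?Z \<in> sets borel" by simp
    have "emeasure torus_measure ?Z \<le> ennreal c" if "c > 0" for c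
    proof -
      have "emeasure torus_measure ?Z \<le> emeasure torus_measure {x. torus_rep x $ i < c}"
        using that by (intro emeasure_mono) auto
      also have "\<dots> \<le> ennreal c" using that by (intro emeasure_torus_rep_less) simp
      finally show ?thesis .
    qed
    then have "emeasure torus_measure ?Z \<le> 0 + ennreal c" if "c > 0" for c using that by simp
    then have "emeasure torus_measure ?Z \<le> 0" by (rule ennreal_le_epsilon)
    then have Z0: "emeasure torus_measure ?Z = 0" by (simp only: le_zero_eq)
    have Z': "(T' ^^ k) -` ?Z \<in> sets borel"
      using measurable_sets[OF borel_measurable_funpow_torus_map Z] by simp
    have "emeasure torus_measure ((T ^^ n) -` (T' ^^ k) -` ?Z) = 0"
      unfolding emeasure_T_funpow[OF Z'] emeasure_T'_funpow[OF Z] by (rule Z0)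
    moreover have "(T ^^ n) -` (T' ^^ k) -` ?Z \<in> sets borel"
      using measurable_sets[OF borel_measurable_funpow_torus_map Z'] by simp
    ultimately have "(T ^^ n) -` (T' ^^ k) -` ?Z \<in> null_sets torus_measure" by (intro null_setsI) simp_all
    from AE_not_in[OF this] show ?thesis by eventually_elim auto
  qed
  then show ?thesis by (simp add: AE_all_countable)
qed

lemma norm_cube_diff:
  assumes "x \<in> cube" "y \<in> (cube :: (real^'n) set)"
  shows "norm (x - y) \<le> real CARD('n)"
proof -
  have "norm (x - y) \<le> (\<Sum>i\<in>UNIV. \<bar>(x - y) $ i\<bar>)" by (rule norm_le_l1_cart)
  also have "\<dots> \<le> (\<Sum>i\<in>(UNIV::'n set). 1)"
  proof (rule sum_mono)
    fix i
    have "0 \<le> x $ i" "x $ i < 1" "0 \<le> y $ i" "y $ i < 1" using assms by (auto simp: cube_def)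
    then show "\<bar>(x - y) $ i\<bar> \<le> 1" by simp
  qed
  finally show ?thesis by simp
qed

text \<open>The entry at 0 alone is used: the representatives of the images under T^n differ by a
  vector of \<open>U\<close> no longer than the difference of two cube points, and n steps back
  contract it.\<close>

lemma itinerary_fibre:
  assumes "itinerary ((T ^^ n) x) = itinerary ((T ^^ n) y)"
  shows "\<exists>h\<in>U. norm h \<le> Cu * \<rho> ^ n * real CARD('n) \<and> y = x + abs_torus h"
proof -
  let ?x = "torus_rep ((T ^^ n) x)" and ?y = "torus_rep ((T ^^ n) y)"
  define s where "s = ?y - ?x"
  have "itinerary ((T ^^ n) x) 0 = itinerary ((T ^^ n) y) 0" using assms by simp
  then have "pw ?x = pw ?y" by (simp add: itinerary_def)
  then have "pw s = 0" unfolding s_def by (simp add: linear_diff[OF linpw])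
  then have sU: "s \<in> U" using pu_pw[of s] pu[of s] by simp
  let ?h = "((*v) (map_matrix real_of_int S') ^^ n) s"
  have T'Tn: "(T' ^^ n) ((T ^^ n) z) = z" for z by (rule funpow_inverse) (rule T'T)
  have "(T ^^ n) y = (T ^^ n) x + abs_torus s"
  proof -
    have "abs_torus ?x + abs_torus s = abs_torus ?y" unfolding abs_torus_add s_def by simp
    then show ?thesis by (simp only: abs_torus_rep)
  qed
  then have "(T' ^^ n) ((T ^^ n) y) = (T' ^^ n) ((T ^^ n) x) + abs_torus ?h"
    by (simp only: funpow_torus_map_add funpow_torus_map_abs)
  then have y: "y = x + abs_torus ?h" by (simp only: T'Tn)
  have "norm ?h \<le> Cu * \<rho> ^ n * norm s" by (rule contraction[OF sU])
  also have "\<dots> \<le> Cu * \<rho> ^ n * real CARD('n)"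
    unfolding s_def using Cu \<rho> by (intro mult_left_mono norm_cube_diff torus_rep_cube) auto
  finally have "norm ?h \<le> Cu * \<rho> ^ n * real CARD('n)" .
  moreover have "?h \<in> U" using A'_U sU by (rule funpow_invariant)
  ultimately show ?thesis using y by blast
qed

lemma cond_exp_forward:
  assumes \<phi>: "\<phi> \<in> borel_measurable borel" "\<And>x. \<bar>\<phi> x\<bar> \<le> B"
    and osc: "\<And>x h. h \<in> U \<Longrightarrow> norm h \<le> Cu * \<rho> ^ n * real CARD('n) \<Longrightarrow> \<bar>\<phi> x - \<phi> (x + abs_torus h)\<bar> \<le> \<omega>"
  shows "AE x in torus_measure. \<bar>real_cond_exp torus_measure (pullback_algebra T F0 (int n)) \<phi> x - \<phi> x\<bar> \<le> \<omega>"
proof (rule cond_exp_fibre_oscillation)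
  show "(\<lambda>x. itinerary ((T ^^ n) x)) \<in> borel_measurable borel" by measurable
  show "subalgebra torus_measure (pullback_algebra T F0 (int n))" by (rule subalgebra_pullback)
  show "sets (pullback_algebra T F0 (int n)) = {(\<lambda>x. itinerary ((T ^^ n) x)) -` H | H. H \<in> sets borel}"
    by (simp add: sets_pullback int_iterate_def)
  show "{x. \<forall>k i. torus_rep ((T' ^^ k) ((T ^^ n) x)) $ i \<noteq> 0} \<in> sets borel"
  proof -
    have "{x \<in> space borel. \<forall>k i. torus_rep ((T' ^^ k) ((T ^^ n) x)) $ i \<noteq> 0} \<in> sets borel" by measurable
    then show ?thesis by simp
  qed
  show "\<bar>\<phi> x - \<phi> y\<bar> \<le> \<omega>" if "itinerary ((T ^^ n) x) = itinerary ((T ^^ n) y)" for x y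
    using itinerary_fibre[OF that] osc by blast
qed (rule AE_interior itinerary_continuous \<phi>(1) integrable_torus_bounded[OF \<phi>])+

section \<open>Stability of itineraries under unstable translations\<close>

text \<open>The width \<open>Cu * \<rho> ^ k * \<eta>\<close> bounds the length, after k steps back,
  of a vector of \<open>U\<close> of length at most \<eta>. Outside this set no such vector can push
  the point at time -k across a face of the cube.\<close>

definition bad :: "real \<Rightarrow> 'n torus set"
  where "bad \<eta> = (\<Union>k. (T' ^^ k) -` (\<Union>i. {x. torus_rep x $ i < Cu * \<rho> ^ k * \<eta>} \<union> {x. 1 - Cu * \<rho> ^ k * \<eta> \<le> torus_rep x $ i}))"

lemma borel_bad [measurable]: "bad \<eta> \<in> sets borel"
proof -
  have "(T' ^^ k) -` A \<in> sets borel" if "A \<in> sets borel" for k and A :: "'n torus set"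
    using measurable_sets[OF borel_measurable_funpow_torus_map that] by simp
  then show ?thesis unfolding bad_def
    by (intro sets.countable_UN image_subsetI) (simp add: sets.finite_UN)
qed

text \<open>Two slabs for each coordinate at each time, carried by a measure preserving map; the
  widths form a geometric series.\<close>

lemma emeasure_bad:
  assumes "\<eta> \<ge> 0"
  shows "emeasure torus_measure (bad \<eta>) \<le> ennreal (2 * real CARD('n) * Cu / (1 - \<rho>) * \<eta>)"
proof -
  let ?c = "\<lambda>k. Cu * \<rho> ^ k * \<eta>"
  let ?S = "\<lambda>k i. {x :: 'n torus. torus_rep x $ i < ?c k} \<union> {x. 1 - ?c k \<le> torus_rep x $ i}"
  have c0: "?c k \<ge> 0" for k using Cu \<rho> assms by simp
  have S [measurable]: "?S k i \<in> sets borel" for k i by simp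
  have US: "(\<Union>i. ?S k i) \<in> sets borel" for k by (intro sets.finite_UN) auto
  have sm: "emeasure torus_measure (?S k i) \<le> ennreal (2 * ?c k)" for k i
  proof -
    have "emeasure torus_measure (?S k i) \<le> emeasure torus_measure {x. torus_rep x $ i < ?c k}
        + emeasure torus_measure {x. 1 - ?c k \<le> torus_rep x $ i}"
      by (rule emeasure_subadditive) simp_all
    also have "\<dots> \<le> ennreal (?c k) + ennreal (?c k)"
      using c0 by (intro add_mono emeasure_torus_rep_less)
    also have "\<dots> = ennreal (?c k + ?c k)" by (rule ennreal_plus[symmetric, OF c0 c0])
    also have "?c k + ?c k = 2 * ?c k" by simp
    finally show ?thesis .
  qed
  have Um: "emeasure torus_measure (\<Union>i. ?S k i) \<le> ennreal (2 * real CARD('n) * ?c k)" for k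
  proof -
    have "emeasure torus_measure (\<Union>i. ?S k i) \<le> (\<Sum>i\<in>UNIV. emeasure torus_measure (?S k i))"
      by (rule emeasure_subadditive_finite) auto
    also have "\<dots> \<le> (\<Sum>i\<in>(UNIV::'n set). ennreal (2 * ?c k))" by (intro sum_mono sm)
    also have "\<dots> = ennreal (2 * real CARD('n) * ?c k)"
    proof -
      have "(\<Sum>i\<in>(UNIV::'n set). ennreal (2 * ?c k)) = ennreal (\<Sum>i\<in>(UNIV::'n set). 2 * ?c k)"
        using c0[of k] by (intro sum_ennreal) simp
      also have "(\<Sum>i\<in>(UNIV::'n set). 2 * ?c k) = 2 * real CARD('n) * ?c k" by simp
      finally show ?thesis .
    qed
    finally show ?thesis .
  qed
  have "emeasure torus_measure (bad \<eta>) \<le> (\<Sum>k. emeasure torus_measure ((T' ^^ k) -` (\<Union>i. ?S k i)))"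
    unfolding bad_def
  proof (rule emeasure_subadditive_countably, rule image_subsetI)
    fix k
    show "(T' ^^ k) -` (\<Union>i. ?S k i) \<in> sets torus_measure"
      using measurable_sets[OF borel_measurable_funpow_torus_map US] by simp
  qed
  also have "\<dots> \<le> (\<Sum>k. ennreal (2 * real CARD('n) * ?c k))"
    unfolding emeasure_T'_funpow[OF US] by (intro suminf_le Um summableI)
  also have "\<dots> = ennreal (\<Sum>k. 2 * real CARD('n) * ?c k)"
  proof (rule suminf_ennreal2)
    show "summable (\<lambda>k. 2 * real CARD('n) * ?c k)"
      using \<rho> by (intro summable_mult summable_mult2 summable_geometric) auto
  qed (use c0 in simp)
  also have "(\<Sum>k. 2 * real CARD('n) * ?c k) = 2 * real CARD('n) * Cu / (1 - \<rho>) * \<eta>"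
  proof -
    have "(\<lambda>k. (2 * real CARD('n) * Cu * \<eta>) * \<rho> ^ k) sums ((2 * real CARD('n) * Cu * \<eta>) * (1 / (1 - \<rho>)))"
      using \<rho> by (intro sums_mult geometric_sums) auto
    then show ?thesis by (auto dest!: sums_unique simp: mult_ac)
  qed
  finally show ?thesis .
qed

text \<open>At each time the representative is moved, without leaving the cube, by a vector of
  \<open>U\<close>, and \<open>pw\<close> does not see such a vector.\<close>

lemma itinerary_shift:
  assumes s: "s \<in> U" "norm s \<le> \<eta>" and x: "x \<notin> bad \<eta>"
  shows "itinerary (x + abs_torus s) = itinerary x"
proof
  fix k
  let ?a = "((*v) (map_matrix real_of_int S') ^^ k) s" and ?r = "torus_rep ((T' ^^ k) x)"
  have aU: "?a \<in> U" using A'_U s(1) by (rule funpow_invariant)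
  have "norm ?a \<le> Cu * \<rho> ^ k * norm s" by (rule contraction[OF s(1)])
  also have "\<dots> \<le> Cu * \<rho> ^ k * \<eta>" using s(2) Cu \<rho> by (intro mult_left_mono) auto
  finally have a: "\<bar>?a $ i\<bar> \<le> Cu * \<rho> ^ k * \<eta>" for i using component_le_norm_cart[of ?a i] by linarith
  have r: "Cu * \<rho> ^ k * \<eta> \<le> ?r $ i" "?r $ i < 1 - Cu * \<rho> ^ k * \<eta>" for i
    using x unfolding bad_def by (auto simp: not_less not_le)
  have "0 \<le> (?r + ?a) $ i \<and> (?r + ?a) $ i < 1" for i
    using a[of i] r[of i] unfolding vector_add_component by linarith
  then have cube: "?r + ?a \<in> cube" by (simp add: cube_def)
  have "(T' ^^ k) (x + abs_torus s) = abs_torus (?r + ?a)"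
    by (simp add: funpow_torus_map_add funpow_torus_map_abs flip: abs_torus_add)
  then have "torus_rep ((T' ^^ k) (x + abs_torus s)) = ?r + ?a" by (simp add: torus_rep_abs_cube[OF cube])
  then show "itinerary (x + abs_torus s) k = itinerary x k"
    by (simp add: itinerary_def linear_add[OF linpw] pw_U[OF aU])
qed

end

section \<open>Equidistribution\<close>

text \<open>Fubini's theorem: for fixed \<open>x\<close> the inner integral over \<open>y\<close> is
  the mean of \<phi>, by invariance under translation.\<close>

lemma integral_torus_average:
  fixes \<phi> :: "'n::finite torus \<Rightarrow> real"
  assumes \<phi>: "\<phi> \<in> borel_measurable borel" "\<And>x. \<bar>\<phi> x\<bar> \<le> B" and D: "D \<in> sets borel"
  shows "(\<integral>y. (\<integral>x. indicator D x * \<phi> (x + y) \<partial>torus_measure) \<partial>torus_measure)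
    = measure torus_measure D * (\<integral>x. \<phi> x \<partial>torus_measure)" (is ?eq)
    and "integrable torus_measure (\<lambda>y. \<integral>x. indicator D x * \<phi> (x + y) \<partial>torus_measure)" (is ?int)
proof -
  interpret pair_sigma_finite "torus_measure :: 'n torus measure" "torus_measure :: 'n torus measure" ..
  interpret P: prob_space "torus_measure \<Otimes>\<^sub>M torus_measure :: ('n torus \<times> 'n torus) measure"
    by (rule prob_space_pair[OF prob_space_torus prob_space_torus])
  note \<phi>(1) [measurable] D [measurable]
  let ?f = "\<lambda>(x, y). indicator D x * \<phi> (x + y)"
  have sets2: "sets (torus_measure \<Otimes>\<^sub>M torus_measure :: ('n torus \<times> 'n torus) measure) = sets (borel \<Otimes>\<^sub>M borel)"
    by (rule sets_pair_measure_cong) simp_all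
  have add: "(\<lambda>z. fst z + snd z :: 'n torus) \<in> borel_measurable (borel \<Otimes>\<^sub>M borel)"
    using borel_measurable_torus_add by (simp add: case_prod_beta')
  have f: "?f \<in> borel_measurable (torus_measure \<Otimes>\<^sub>M torus_measure)"
    unfolding case_prod_beta' measurable_cong_sets[OF sets2 refl]
    by (intro borel_measurable_times measurable_compose[OF measurable_fst] borel_measurable_indicator
        measurable_compose[OF add] \<phi>(1) D)
  have int: "integrable (torus_measure \<Otimes>\<^sub>M torus_measure) ?f"
  proof (rule P.integrable_const_bound[of _ B])
    have "\<bar>indicator D x * \<phi> (x + y)\<bar> \<le> B" for x y
      using \<phi>(2)[of "x + y"] order_trans[OF abs_ge_zero \<phi>(2)[of x]] by (simp add: indicator_def)
    then show "AE z in torus_measure \<Otimes>\<^sub>M torus_measure. norm (?f z) \<le> B" by (intro AE_I2) auto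
  qed (rule f)
  have "(\<integral>y. (\<integral>x. ?f (x, y) \<partial>torus_measure) \<partial>torus_measure) = (\<integral>x. (\<integral>y. ?f (x, y) \<partial>torus_measure) \<partial>torus_measure)"
    using Fubini_integral[of "\<lambda>x y. ?f (x, y)"] int by simp
  also have "\<dots> = (\<integral>x. indicator D x * (\<integral>y. \<phi> y \<partial>torus_measure) \<partial>torus_measure)"
    using integral_torus_translate[OF \<phi>(1)] by (simp add: add.commute)
  also have "\<dots> = measure torus_measure D * (\<integral>x. \<phi> x \<partial>torus_measure)" using D by simp
  finally show ?eq by simp
  show ?int using integrable_snd[of "\<lambda>x y. ?f (x, y)"] int by simp
qed

lemma measure_torus_UNIV [simp]: "measure (torus_measure :: 'n::finite torus measure) UNIV = 1"
  using torus.prob_space[where 'a = 'n] by simp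

lemma abs_integral_le:
  fixes f g :: "'a \<Rightarrow> real"
  assumes "AE x in M. \<bar>f x\<bar> \<le> g x" "integrable M f" "integrable M g"
  shows "\<bar>\<integral>x. f x \<partial>M\<bar> \<le> (\<integral>x. g x \<partial>M)"
proof -
  have "\<bar>\<integral>x. f x \<partial>M\<bar> \<le> (\<integral>x. \<bar>f x\<bar> \<partial>M)" by (rule integral_abs_bound)
  also have "\<dots> \<le> (\<integral>x. g x \<partial>M)" using assms by (intro integral_mono_AE) auto
  finally show ?thesis .
qed

context toral_filtration
begin

abbreviation (input) "past n \<equiv> pullback_algebra T F0 (- int n)"

text \<open>The sets of \<open>past n\<close> are read off from the itinerary of T^(-n) x, so the
  bad set is pulled back to that time. Here \<eta> bounds the length of the translation after these
  n steps back.\<close>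

definition bad_n :: "nat \<Rightarrow> real \<Rightarrow> 'n torus set"
  where "bad_n n \<eta> = (T' ^^ n) -` bad \<eta>"

lemma borel_bad_n [measurable]: "bad_n n \<eta> \<in> sets borel"
  using measurable_sets[OF borel_measurable_funpow_torus_map borel_bad] by (simp add: bad_n_def)

abbreviation (input) "bad_prob n \<eta> \<equiv> real_cond_exp torus_measure (past n) (indicator (bad_n n \<eta>))"

text \<open>\<open>bad_n n \<eta>\<close> has measure of order \<eta>. The threshold
  \<open>sqrt \<eta>\<close> splits this evenly: by Markov's inequality the complement has measure
  of order \<open>sqrt \<eta>\<close>, and within the set the proportion of bad points is at most
  \<open>sqrt \<eta>\<close>.\<close>

definition good :: "nat \<Rightarrow> real \<Rightarrow> 'n torus set"
  where "good n \<eta> = {x. bad_prob n \<eta> x \<le> sqrt \<eta>}"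

lemma sets_backward:
  "sets (past n) = {(\<lambda>x. itinerary ((T' ^^ n) x)) -` H | H. H \<in> sets borel}"
proof -
  have "int_iterate T (- int n) = T' ^^ n" by (cases "n = 0") (simp_all add: int_iterate_def inv_T)
  then show ?thesis by (simp add: sets_pullback)
qed

lemma sigma_finite_pullback: "sigma_finite_subalgebra torus_measure (pullback_algebra T F0 k)"
  by (rule sigma_finite_subalgebra_torus[OF subalgebra_pullback])

lemma good_in_pullback: "good n \<eta> \<in> sets (past n)"
proof -
  let ?F = "past n"
  let ?g = "bad_prob n \<eta>"
  have "space ?F = UNIV"
    using subalgebra_pullback[of "- int n"] by (simp add: subalgebra_def)
  moreover have "?g \<in> borel_measurable ?F" by (rule borel_measurable_cond_exp)
  ultimately show ?thesis
    unfolding good_def using borel_measurable_iff_le[of ?g ?F] by simp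
qed

lemma pullback_borel: "A \<in> sets (pullback_algebra T F0 k) \<Longrightarrow> A \<in> sets borel"
  using subalgebra_pullback[of k] by (auto simp: subalgebra_def)

lemma borel_good: "good n \<eta> \<in> sets borel"
  using good_in_pullback by (rule pullback_borel)

lemma integrable_indicator_torus: "A \<in> sets borel \<Longrightarrow> integrable torus_measure (indicator A :: 'n torus \<Rightarrow> real)"
  by (rule integrable_torus_bounded[of _ 1]) (auto simp: indicator_def)

lemma measure_good:
  assumes \<eta>: "\<eta> > 0"
  shows "measure torus_measure (- good n \<eta>) \<le> 2 * real CARD('n) * Cu / (1 - \<rho>) * sqrt \<eta>"
proof -
  interpret sigma_finite_subalgebra torus_measure "past n"
    by (rule sigma_finite_pullback)
  let ?g = "bad_prob n \<eta>"
  let ?c = "2 * real CARD('n) * Cu / (1 - \<rho>)"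
  have c0: "?c \<ge> 0" using Cu \<rho> by simp
  have int: "integrable torus_measure (indicator (bad_n n \<eta>) :: 'n torus \<Rightarrow> real)"
    by (rule integrable_indicator_torus) simp
  have intg: "integrable torus_measure ?g" using int by (rule real_cond_exp_int)
  have pos: "AE x in torus_measure. ?g x \<ge> 0"
    by (rule real_cond_exp_pos) (auto simp: indicator_def)
  have "measure torus_measure (bad_n n \<eta>) = measure torus_measure (bad \<eta>)"
    unfolding bad_n_def measure_def by (subst emeasure_T'_funpow) simp_all
  also have "\<dots> \<le> ?c * \<eta>"
  proof -
    have "ennreal (measure torus_measure (bad \<eta>)) \<le> ennreal (?c * \<eta>)"
      using emeasure_bad[of \<eta>] \<eta> by (simp add: torus.emeasure_eq_measure)
    then show ?thesis using mult_nonneg_nonneg[OF c0 less_imp_le[OF \<eta>]] by (simp only: ennreal_le_iff)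
  qed
  finally have m: "measure torus_measure (bad_n n \<eta>) \<le> ?c * \<eta>" .
  have "(\<integral>x. ?g x \<partial>torus_measure) = measure torus_measure (bad_n n \<eta>)"
    using real_cond_exp_int(2)[OF int] by simp
  then have intle: "(\<integral>x. ?g x \<partial>torus_measure) \<le> ?c * \<eta>" using m by simp
  have "measure torus_measure {x \<in> space torus_measure. ?g x \<ge> sqrt \<eta>} \<le> (\<integral>x. ?g x \<partial>torus_measure) / sqrt \<eta>"
    using intg pos \<eta> by (intro integral_Markov_inequality_measure[where A = "{}"]) auto
  also have "\<dots> \<le> (?c * \<eta>) / sqrt \<eta>" using intle \<eta> by (intro divide_right_mono) auto
  also have "\<dots> = ?c * sqrt \<eta>" using \<eta> by (simp add: real_div_sqrt flip: times_divide_eq_right)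
  finally have "measure torus_measure {x \<in> space torus_measure. ?g x \<ge> sqrt \<eta>} \<le> ?c * sqrt \<eta>" .
  moreover have "measure torus_measure (- good n \<eta>) \<le> measure torus_measure {x \<in> space torus_measure. ?g x \<ge> sqrt \<eta>}"
  proof (rule torus.finite_measure_mono)
    show "- good n \<eta> \<subseteq> {x \<in> space torus_measure. ?g x \<ge> sqrt \<eta>}" by (auto simp: good_def)
    have "?g \<in> borel_measurable borel" using borel_measurable_cond_exp2[of torus_measure] by simp
    then show "{x \<in> space torus_measure. ?g x \<ge> sqrt \<eta>} \<in> sets torus_measure"
      using borel_measurable_iff_ge[of ?g borel] by simp
  qed
  ultimately show ?thesis by linarith
qed

lemma itinerary_backward_shift:
  assumes w: "w \<in> U" "Cu * \<rho> ^ n * norm w \<le> \<eta>" and x: "x \<notin> bad_n n \<eta>"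
  shows "itinerary ((T' ^^ n) (x + abs_torus w)) = itinerary ((T' ^^ n) x)"
proof -
  let ?a = "((*v) (map_matrix real_of_int S') ^^ n) w"
  have "?a \<in> U" using A'_U w(1) by (rule funpow_invariant)
  moreover have "norm ?a \<le> \<eta>" using contraction[OF w(1), of n] w(2) by linarith
  ultimately show ?thesis
    using x unfolding bad_n_def funpow_torus_map_add funpow_torus_map_abs
    by (intro itinerary_shift) auto
qed

lemma measure_bad_inter:
  assumes D: "D \<in> sets (past n)" "D \<subseteq> good n \<eta>"
  shows "measure torus_measure (D \<inter> bad_n n \<eta>) \<le> sqrt \<eta> * measure torus_measure D"
proof -
  interpret sigma_finite_subalgebra torus_measure "past n"
    by (rule sigma_finite_pullback)
  let ?g = "bad_prob n \<eta>"
  have Db [measurable]: "D \<in> sets borel" using D(1) by (rule pullback_borel)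
  have int: "integrable torus_measure (indicator (bad_n n \<eta>) :: 'n torus \<Rightarrow> real)"
    by (rule integrable_indicator_torus) simp
  have "measure torus_measure (D \<inter> bad_n n \<eta>) = (\<integral>x. indicator (D \<inter> bad_n n \<eta>) x \<partial>torus_measure)"
    by simp
  also have "\<dots> = (\<integral>x\<in>D. indicator (bad_n n \<eta>) x \<partial>torus_measure)"
    unfolding set_lebesgue_integral_def by (simp add: indicator_inter_arith)
  also have "\<dots> = (\<integral>x\<in>D. ?g x \<partial>torus_measure)" using int D(1) by (rule real_cond_exp_intA)
  also have "\<dots> \<le> (\<integral>x. sqrt \<eta> * indicator D x \<partial>torus_measure)"
    unfolding set_lebesgue_integral_def
  proof (rule integral_mono)
    show "integrable torus_measure (\<lambda>x. indicator D x *\<^sub>R ?g x)"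
      using real_cond_exp_int(1)[OF int] by (intro integrable_mult_indicator) simp_all
    show "integrable torus_measure (\<lambda>x. sqrt \<eta> * indicator D x)"
      by (intro integrable_mult_right integrable_indicator_torus) simp
    show "indicator D x *\<^sub>R ?g x \<le> sqrt \<eta> * indicator D x" for x
      using D(2) by (auto simp: good_def indicator_def)
  qed
  finally show ?thesis by simp
qed

text \<open>Moving \<phi> by \<open>w\<close> amounts to moving \<open>D\<close> by
  \<open>w\<close>, which changes \<open>D\<close> only at bad points and their translates. The
  pointwise bound \<open>B\<close> serves for integrability; the estimate involves the essential
  bound \<open>M\<close>, as the final statement uses the essential supremum.\<close>

lemma integral_unstable_shift:
  assumes \<phi>: "\<phi> \<in> borel_measurable borel" "\<And>x. \<bar>\<phi> x\<bar> \<le> B" "AE x in torus_measure. \<bar>\<phi> x\<bar> \<le> M"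
    and w: "w \<in> U" "Cu * \<rho> ^ n * norm w \<le> \<eta>"
    and D: "D \<in> sets (past n)" "D \<subseteq> good n \<eta>"
  shows "\<bar>(\<integral>x. indicator D x * \<phi> (x + abs_torus w) \<partial>torus_measure) - (\<integral>x. indicator D x * \<phi> x \<partial>torus_measure)\<bar>
    \<le> 2 * M * sqrt \<eta> * measure torus_measure D"
proof -
  have Db [measurable]: "D \<in> sets borel" using D(1) by (rule pullback_borel)
  obtain H where H: "D = (\<lambda>x. itinerary ((T' ^^ n) x)) -` H" using D(1) by (auto simp: sets_backward)
  note \<phi>(1) [measurable]
  let ?b = "\<lambda>x. indicator (D \<inter> bad_n n \<eta>) x :: real" and ?w = "abs_torus w"
  have Dw: "x + abs_torus u \<in> D \<longleftrightarrow> x \<in> D" if "x \<notin> bad_n n \<eta>" "u \<in> U" "norm u = norm w" for x u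
    using itinerary_backward_shift[OF that(2) _ that(1)] w(2) that(3) by (simp add: H)
  have B0: "0 \<le> B" using order_trans[OF abs_ge_zero \<phi>(2)[of undefined]] .
  have tr: "x + abs_torus (- w) = x - ?w" for x by (simp flip: abs_torus_uminus)
  have meas_tr [measurable]: "(\<lambda>x. x - ?w) \<in> borel_measurable borel"
    using borel_measurable_torus_translate[of "abs_torus (- w)"] unfolding tr .
  have ibd: "\<bar>indicator A x * \<phi> y\<bar> \<le> B" for A :: "'n torus set" and x y
    using \<phi>(2)[of y] B0 by (simp add: indicator_def)
  have int1: "integrable torus_measure (\<lambda>x. indicator D (x - ?w) * \<phi> x)"
    by (rule integrable_torus_bounded[where B = B]) (use ibd in auto)
  have int2: "integrable torus_measure (\<lambda>x. indicator D x * \<phi> x)"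
    by (rule integrable_torus_bounded[where B = B]) (use ibd in auto)
  have intb: "integrable torus_measure ?b" by (rule integrable_indicator_torus) simp
  have bm: "?b \<in> borel_measurable borel" by simp
  have intb': "integrable torus_measure (\<lambda>x. ?b (x - ?w))"
    by (rule integrable_torus_bounded[where B = 1]) (auto simp: indicator_def)
  have ib': "(\<integral>x. ?b (x - ?w) \<partial>torus_measure) = measure torus_measure (D \<inter> bad_n n \<eta>)"
    using integral_torus_translate[OF bm, of "abs_torus (- w)"] unfolding tr by simp
  have M0: "0 \<le> M"
  proof -
    have "AE x :: 'n torus in torus_measure. 0 \<le> M" using \<phi>(3) by (rule eventually_mono) linarith
    then show ?thesis by simp
  qed
  have "(\<integral>x. indicator D x * \<phi> (x + ?w) \<partial>torus_measure) = (\<integral>x. indicator D (x - ?w) * \<phi> x \<partial>torus_measure)"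
    using integral_torus_translate[of "\<lambda>x. indicator D (x - ?w) * \<phi> x" ?w] by simp
  then have "(\<integral>x. indicator D x * \<phi> (x + ?w) \<partial>torus_measure) - (\<integral>x. indicator D x * \<phi> x \<partial>torus_measure)
    = (\<integral>x. indicator D (x - ?w) * \<phi> x - indicator D x * \<phi> x \<partial>torus_measure)"
    using int1 int2 by simp
  also have "\<bar>\<dots>\<bar> \<le> (\<integral>x. M * (?b x + ?b (x - ?w)) \<partial>torus_measure)"
  proof (rule abs_integral_le)
    have "\<bar>indicator D (x - ?w) * \<phi> x - indicator D x * \<phi> x\<bar> \<le> M * (?b x + ?b (x - ?w))" if "\<bar>\<phi> x\<bar> \<le> M" for x
    proof -
      \<comment> \<open>If x is in \<open>D\<close> but x - w is not, then x is bad, as seen from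
        the shift by -w; in the opposite case x - w is bad.\<close>
      have "\<bar>indicator D (x - ?w) - indicator D x :: real\<bar> \<le> ?b x + ?b (x - ?w)"
      proof (cases "x \<in> D")
        case True
        then show ?thesis using Dw[of x "- w"] subspace_neg[OF subspaceU w(1)] unfolding tr
          by (auto simp: indicator_def)
      next
        case False
        then show ?thesis using Dw[of "x - ?w" w] w(1) by (auto simp: indicator_def)
      qed
      then have "\<bar>\<phi> x\<bar> * \<bar>indicator D (x - ?w) - indicator D x :: real\<bar> \<le> M * (?b x + ?b (x - ?w))"
        using that M0 by (intro mult_mono) auto
      then show ?thesis by (simp add: abs_mult[symmetric] algebra_simps)
    qed
    then show "AE x in torus_measure. \<bar>indicator D (x - ?w) * \<phi> x - indicator D x * \<phi> x\<bar> \<le> M * (?b x + ?b (x - ?w))"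
      using \<phi>(3) by (auto elim: eventually_mono)
  qed (use int1 int2 intb intb' in auto)
  also have "\<dots> = M * (measure torus_measure (D \<inter> bad_n n \<eta>) + measure torus_measure (D \<inter> bad_n n \<eta>))"
    using intb intb' ib' by simp
  also have "\<dots> \<le> M * (sqrt \<eta> * measure torus_measure D + sqrt \<eta> * measure torus_measure D)"
    using M0 measure_bad_inter[OF D] by (intro mult_left_mono add_mono)
  finally show ?thesis by (simp add: algebra_simps)
qed

text \<open>Every translation of the torus is a translation by a not too long vector of \<open>U\<close>, which nearly
  preserves the sets of the \<open>\<sigma>\<close>-algebra, followed by one by a short vector of \<open>W\<close>, which changes
  \<open>\<phi>\<close> by at most \<open>\<omega>\<close>. So the integral of \<open>\<phi>\<close> is nearly the average of those of its
  translates.\<close>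

lemma integral_near_mean:
  assumes \<phi>: "\<phi> \<in> borel_measurable borel" "\<And>x. \<bar>\<phi> x\<bar> \<le> B" "AE x in torus_measure. \<bar>\<phi> x\<bar> \<le> M"
    and dens: "\<And>t. \<exists>m\<in>int_vectors. \<exists>w\<in>U. \<exists>b\<in>W. t = m + w + b \<and> Cu * \<rho> ^ n * norm w \<le> \<eta> \<and> norm b \<le> \<delta>"
    and osc: "\<And>x b. b \<in> W \<Longrightarrow> norm b \<le> \<delta> \<Longrightarrow> \<bar>\<phi> x - \<phi> (x + abs_torus b)\<bar> \<le> \<omega>"
    and D: "D \<in> sets (past n)" "D \<subseteq> good n \<eta>"
  shows "\<bar>(\<integral>x\<in>D. \<phi> x \<partial>torus_measure) - (\<integral>x. \<phi> x \<partial>torus_measure) * measure torus_measure D\<bar>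
    \<le> (2 * M * sqrt \<eta> + \<omega>) * measure torus_measure D"
proof -
  have Db [measurable]: "D \<in> sets borel" using D(1) by (rule pullback_borel)
  note \<phi>(1) [measurable]
  define f where "f y = (\<integral>x. indicator D x * \<phi> (x + y) \<partial>torus_measure)" for y
  have B0: "0 \<le> B" using order_trans[OF abs_ge_zero \<phi>(2)[of undefined]] .
  have int: "integrable torus_measure (\<lambda>x. indicator D x * \<phi> (x + y))" for y
    by (rule integrable_torus_bounded[where B = B]) (use \<phi>(2) B0 in \<open>auto simp: indicator_def\<close>)
  let ?E = "(2 * M * sqrt \<eta> + \<omega>) * measure torus_measure D"
  have near: "\<bar>f y - f 0\<bar> \<le> ?E" for y
  proof -
    obtain m w b where t: "m \<in> int_vectors" "w \<in> U" "b \<in> W" "torus_rep y = m + w + b"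
      "Cu * \<rho> ^ n * norm w \<le> \<eta>" "norm b \<le> \<delta>" using dens[of "torus_rep y"] by blast
    have "abs_torus (torus_rep y) = abs_torus w + abs_torus b"
      unfolding t(4) abs_torus_add add.assoc by (rule abs_torus_add_int[OF t(1)])
    then have y: "y = abs_torus w + abs_torus b" by simp
    have 1: "\<bar>f (abs_torus w) - f 0\<bar> \<le> 2 * M * sqrt \<eta> * measure torus_measure D"
      using integral_unstable_shift[OF \<phi> t(2,5) D] by (simp add: f_def)
    have "\<bar>f y - f (abs_torus w)\<bar>
      = \<bar>\<integral>x. indicator D x * \<phi> (x + y) - indicator D x * \<phi> (x + abs_torus w) \<partial>torus_measure\<bar>"
      unfolding f_def using int by simp
    also have "\<dots> \<le> (\<integral>x. \<omega> * indicator D x \<partial>torus_measure)"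
    proof (rule abs_integral_le)
      have "\<bar>indicator D x * \<phi> (x + y) - indicator D x * \<phi> (x + abs_torus w)\<bar> \<le> \<omega> * indicator D x" for x
        using osc[OF t(3,6), of "x + abs_torus w"] by (simp add: y indicator_def add.assoc abs_minus_commute)
      then show "AE x in torus_measure. \<bar>indicator D x * \<phi> (x + y) - indicator D x * \<phi> (x + abs_torus w)\<bar> \<le> \<omega> * indicator D x"
        by (intro AE_I2)
    qed (use int integrable_indicator_torus[OF Db] in auto)
    also have "\<dots> = \<omega> * measure torus_measure D" by simp
    finally show ?thesis using 1 by (simp add: algebra_simps)
  qed
  have fm: "(\<integral>y. f y \<partial>torus_measure) = measure torus_measure D * (\<integral>x. \<phi> x \<partial>torus_measure)"
    unfolding f_def using \<phi>(1,2) Db by (rule integral_torus_average(1))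
  have f0: "f 0 = (\<integral>x\<in>D. \<phi> x \<partial>torus_measure)" by (simp add: f_def set_lebesgue_integral_def)
  have "integrable torus_measure f"
    unfolding f_def using \<phi>(1,2) Db by (rule integral_torus_average(2))
  then have "\<bar>(\<integral>y. f y \<partial>torus_measure) - f 0\<bar> = \<bar>\<integral>y. f y - f 0 \<partial>torus_measure\<bar>"
    by simp
  also have "\<dots> \<le> (\<integral>y. ?E \<partial>(torus_measure :: 'n torus measure))"
    by (rule abs_integral_le) (use \<open>integrable torus_measure f\<close> near in auto)
  also have "\<dots> = ?E" by simp
  finally show ?thesis by (simp add: fm f0 abs_minus_commute mult.commute)
qed

lemma cond_exp_backward:
  assumes \<phi>: "\<phi> \<in> borel_measurable borel" "\<And>x. \<bar>\<phi> x\<bar> \<le> B" "AE x in torus_measure. \<bar>\<phi> x\<bar> \<le> M"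
    and dens: "\<And>t. \<exists>m\<in>int_vectors. \<exists>w\<in>U. \<exists>b\<in>W. t = m + w + b \<and> Cu * \<rho> ^ n * norm w \<le> \<eta> \<and> norm b \<le> \<delta>"
    and osc: "\<And>x b. b \<in> W \<Longrightarrow> norm b \<le> \<delta> \<Longrightarrow> \<bar>\<phi> x - \<phi> (x + abs_torus b)\<bar> \<le> \<omega>"
  shows "AE x in torus_measure. x \<in> good n \<eta> \<longrightarrow>
    \<bar>real_cond_exp torus_measure (past n) \<phi> x - (\<integral>x. \<phi> x \<partial>torus_measure)\<bar> \<le> 2 * M * sqrt \<eta> + \<omega>"
  by (rule cond_exp_close_on[OF torus.finite_measure_axioms subalgebra_pullback integrable_torus_bounded[OF \<phi>(1,2)] good_in_pullback])
     (rule integral_near_mean[OF \<phi> dens osc])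

end

section \<open>Choice of the constants and assembly\<close>

text \<open>The exponent is at most 1/d and the base is below 1, so \<zeta> exceeds the d-th root of
  \<rho>. This makes the ratio q in the main proof less than 1.\<close>

lemma power_gt_of_root_bound:
  fixes \<rho> \<zeta> :: real and d D :: nat
  assumes \<rho>: "0 < \<rho>" "\<rho> < 1" and d: "d \<ge> 1"
    and \<zeta>: "\<rho> powr (1 / (3 * (real d + 2) * real D)) < \<zeta>"
  shows "\<rho> < \<zeta> ^ d"
proof -
  have "1 / (3 * (real d + 2) * real D) \<le> 1 / real d"
  \<comment> \<open>For \<open>D = 0\<close> the quotient is 0 by convention, hence also at most
    1/d.\<close>
  proof (cases "D = 0")
    case False
    have "real d * 1 \<le> (3 * (real d + 2)) * real D" using False by (intro mult_mono) auto
    then show ?thesis using d by (intro divide_left_mono) auto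
  qed simp
  then have "\<rho> powr (1 / real d) \<le> \<rho> powr (1 / (3 * (real d + 2) * real D))"
    using \<rho> by (intro powr_mono') auto
  then have "\<rho> powr (1 / real d) < \<zeta>" using \<zeta> by simp
  then have "(\<rho> powr (1 / real d)) ^ d < \<zeta> ^ d" using d by (intro power_strict_mono) auto
  moreover have "(\<rho> powr (1 / real d)) ^ d = \<rho>"
    using \<rho> d by (simp add: powr_realpow[symmetric] powr_powr)
  ultimately show ?thesis by simp
qed

lemma Linf_norm_bounded:
  fixes \<phi> :: "'n::finite torus \<Rightarrow> real"
  assumes \<phi>: "\<phi> \<in> borel_measurable borel" "\<And>x. \<bar>\<phi> x\<bar> \<le> B"
  obtains M where "Linf_norm torus_measure \<phi> = ereal M" "0 \<le> M" "AE x in torus_measure. \<bar>\<phi> x\<bar> \<le> M"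
proof -
  let ?f = "\<lambda>x. ereal \<bar>\<phi> x\<bar>"
  note \<phi>(1) [measurable]
  have f: "?f \<in> borel_measurable torus_measure" by simp
  have "esssup torus_measure ?f \<le> ereal B" using f \<phi>(2) by (intro esssup_I AE_I2) auto
  moreover have "0 \<le> esssup torus_measure ?f"
  proof -
    have "emeasure (torus_measure :: 'n torus measure) (space torus_measure) \<noteq> 0"
      using torus.emeasure_space_1[where 'a = 'n] by simp
    then have "0 = esssup (torus_measure :: 'n torus measure) (\<lambda>x. 0 :: ereal)" by (simp add: esssup_const)
    also have "\<dots> \<le> esssup torus_measure ?f" by (rule esssup_mono) auto
    finally show ?thesis .
  qed
  ultimately obtain M where M: "esssup torus_measure ?f = ereal M" "0 \<le> M"
    by (cases "esssup torus_measure ?f") auto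
  have "AE x in torus_measure. ?f x \<le> esssup torus_measure ?f" by (rule esssup_AE)
  then have "AE x in torus_measure. \<bar>\<phi> x\<bar> \<le> M" unfolding M by simp
  then show ?thesis using that[of M] M by (simp add: Linf_norm_def)
qed

lemma omega_u_upper:
  assumes \<phi>: "\<And>x. \<bar>\<phi> x\<bar> \<le> B" and h: "h \<in> ball_in v (E_u S) \<delta>"
  shows "\<bar>\<phi> x - \<phi> (x + abs_torus h)\<bar> \<le> omega_u S v \<phi> \<delta>"
  unfolding omega_u_def
proof (rule cSup_upper)
  have "\<bar>\<phi> y - \<phi> z\<bar> \<le> 2 * B" for y z using \<phi>[of y] \<phi>[of z] by linarith
  then show "bdd_above {\<bar>\<phi> x - \<phi> (x + abs_torus h)\<bar> | x h. h \<in> ball_in v (E_u S) \<delta>}"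
    by (intro bdd_aboveI[of _ "2 * B"]) auto
qed (use h in blast)

lemma omega_se_upper:
  assumes \<phi>: "\<And>x. \<bar>\<phi> x\<bar> \<le> B" and h: "h \<in> ball_in v (E_s S) \<delta>" "h' \<in> ball_in v (E_e S) \<delta>"
  shows "\<bar>\<phi> x - \<phi> (x + abs_torus (h + h'))\<bar> \<le> omega_se S v \<phi> \<delta>"
  unfolding omega_se_def
proof (rule cSup_upper)
  have "\<bar>\<phi> y - \<phi> z\<bar> \<le> 2 * B" for y z using \<phi>[of y] \<phi>[of z] by linarith
  then show "bdd_above {\<bar>\<phi> x - \<phi> (x + abs_torus h + abs_torus h')\<bar> | x h h'.
      h \<in> ball_in v (E_s S) \<delta> \<and> h' \<in> ball_in v (E_e S) \<delta>}"
    by (intro bdd_aboveI[of _ "2 * B"]) auto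
  have "x + abs_torus (h + h') = x + abs_torus h + abs_torus h'"
    by (simp add: add.assoc abs_torus_add)
  then show "\<bar>\<phi> x - \<phi> (x + abs_torus (h + h'))\<bar> \<in> {\<bar>\<phi> x - \<phi> (x + abs_torus h + abs_torus h')\<bar> | x h h'.
      h \<in> ball_in v (E_s S) \<delta> \<and> h' \<in> ball_in v (E_e S) \<delta>}"
    using h by (simp only: mem_Collect_eq) blast
qed

theorem theorem19:
  fixes S :: "int^'n::finite^'n"
    and e :: "nat \<Rightarrow> 'n"
    and v :: "'n \<Rightarrow> real^'n"
    and \<rho>\<^sub>u \<zeta> :: real
  defines "T \<equiv> torus_map S"
    and "d \<equiv> CARD('n)"
    and "r\<^sub>u \<equiv> spectral_radius_on (matrix_inv (map_matrix real_of_int S)) (E_u S)"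
  assumes "d \<ge> 2"
    and "det S = 1 \<or> det S = - 1"
    and "ergodic torus_measure T"
    and "adapted_basis S e v"
    and "\<rho>\<^sub>u \<in> {r\<^sub>u<..<1}"
    and "\<zeta> \<in> {\<rho>\<^sub>u powr (1 / (3 * (real d + 2) * real (dim (E_e S) + dim (E_s S))))<..<1}"
  shows "\<exists>C>0. \<exists>N::nat. \<exists>\<xi>\<in>{0<..<1::real}. \<exists>(V :: nat \<Rightarrow> 'n torus set) (F\<^sub>0 :: 'n torus measure).
    (\<forall>n. V n \<in> sets torus_measure) \<and>
    subalgebra torus_measure F\<^sub>0 \<and>
    sets F\<^sub>0 \<subseteq> sets (pullback_algebra T F\<^sub>0 1) \<and>
    (\<forall>(\<phi> :: 'n torus \<Rightarrow> real) n.
      \<phi> \<in> borel_measurable torus_measure \<and> bounded (range \<phi>) \<and> n \<ge> N \<longrightarrow>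
        Linf_norm torus_measure
          (\<lambda>x. real_cond_exp torus_measure (pullback_algebra T F\<^sub>0 (int n)) \<phi> x - \<phi> x)
          \<le> ereal (omega_u S v \<phi> (\<rho>\<^sub>u ^ n)) \<and>
        (AE x in torus_measure. x \<in> V n \<longrightarrow>
          ereal \<bar>real_cond_exp torus_measure (pullback_algebra T F\<^sub>0 (- int n)) \<phi> x
                  - integral\<^sup>L torus_measure \<phi>\<bar>
          \<le> ereal C * (Linf_norm torus_measure \<phi> * ereal (\<xi> ^ n)
                        + ereal (omega_se S v \<phi> (\<zeta> ^ n)))) \<and>
        measure torus_measure (space torus_measure - V n) \<le> C * \<xi> ^ n)"
proof -
  obtain S' pu pw W Cu \<rho> K where
    split: "toral_splitting ((*v) (map_matrix real_of_int S)) ((*v) (map_matrix real_of_int S')) pu pw (E_u S) W Cu \<rho>"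
    and \<rho>\<rho>\<^sub>u: "\<rho> < \<rho>\<^sub>u" and K: "K > 0"
    and ball_u: "\<And>x \<delta>. x \<in> E_u S \<Longrightarrow> K * norm x \<le> \<delta> \<Longrightarrow> x \<in> ball_in v (E_u S) \<delta>"
    and ball_se: "\<And>x \<delta>. x \<in> W \<Longrightarrow> K * norm x \<le> \<delta> \<Longrightarrow>
      \<exists>h\<in>ball_in v (E_s S) \<delta>. \<exists>h'\<in>ball_in v (E_e S) \<delta>. x = h + h'"
    using adapted_basis_splitting[of S e v \<rho>\<^sub>u] assms(4-) unfolding T_def r\<^sub>u_def by (metis greaterThanLessThan_iff)
  interpret toral_filtration S S' pu pw "E_u S" W Cu \<rho>
  proof (intro toral_filtration.intro split toral_filtration_axioms.intro)
    show "distr torus_measure torus_measure (torus_map S) = torus_measure"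
      using assms(6) by (simp add: ergodic_def T_def)
  qed
  have \<rho>\<^sub>u: "0 < \<rho>\<^sub>u" "\<rho>\<^sub>u < 1" using \<rho>\<rho>\<^sub>u \<rho> assms(8) by auto
  have \<zeta>1: "\<zeta> < 1" using assms(9) by simp
  have \<rho>\<zeta>: "\<rho>\<^sub>u < \<zeta> ^ d"
    using power_gt_of_root_bound[OF \<rho>\<^sub>u, of d "dim (E_e S) + dim (E_s S)" \<zeta>] assms(4,9) by simp
  have \<zeta>0: "\<zeta> > 0"
    using assms(9) by (meson greaterThanLessThan_iff le_less_trans powr_ge_zero)
  obtain Cd where Cd: "Cd > 0"
    "\<And>\<delta> t. 0 < \<delta> \<Longrightarrow> \<delta> \<le> 1 \<Longrightarrow> \<exists>m\<in>int_vectors. \<exists>w\<in>E_u S. \<exists>b\<in>W. t = m + w + b \<and> norm w \<le> Cd / \<delta> ^ d \<and> norm b \<le> \<delta>"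
    using density unfolding d_def by blast
  \<comment> \<open>Vectors of \<open>W\<close> of Euclidean length at most
    \<open>\<zeta> ^ n / K1\<close> split into vectors of the balls of radius
    \<open>\<zeta> ^ n\<close>; the maximum with 1 keeps this length within the range of
    \<open>density\<close>.\<close>
  define K1 where "K1 = max K 1"
  \<comment> \<open>The vectors of \<open>U\<close> from \<open>density\<close> have length at most
    \<open>Cd / (\<zeta> ^ n / K1) ^ d\<close>. Contracting them for n steps gives
    \<open>C1 * q ^ n\<close>, the value taken for \<open>\<eta> n\<close>.\<close>
  define q where "q = \<rho>\<^sub>u / \<zeta> ^ d"
  define C1 where "C1 = Cu * Cd * K1 ^ d"
  define \<eta> where "\<eta> n = C1 * q ^ n" for n
  define \<xi> where "\<xi> = sqrt q"
  define C2 where "C2 = 2 * real CARD('n) * Cu / (1 - \<rho>)"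
  \<comment> \<open>The three summands serve the modulus of continuity, the term with the norm of
    \<phi>, and the measure of the exceptional set.\<close>
  define C where "C = 1 + 2 * sqrt C1 + C2 * sqrt C1"
  have K1: "K1 \<ge> 1" "K \<le> K1" by (simp_all add: K1_def)
  have q: "0 < q" "q < 1" using \<rho>\<^sub>u \<rho>\<zeta> \<zeta>0 by (simp_all add: q_def)
  have C1: "C1 > 0" using Cu Cd(1) K1(1) by (simp add: C1_def)
  have C2: "C2 \<ge> 0" using Cu \<rho> by (simp add: C2_def)
  have \<xi>: "0 < \<xi>" "\<xi> < 1" using q by (simp_all add: \<xi>_def)
  have C_ge: "C \<ge> 1" "C \<ge> 2 * sqrt C1" "C \<ge> C2 * sqrt C1" "C > 0"
    using C1 C2 by (simp_all add: C_def add_nonneg_nonneg add_pos_nonneg)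
  have \<eta>: "\<eta> n > 0" "sqrt (\<eta> n) = sqrt C1 * \<xi> ^ n" for n
    using C1 q by (simp_all add: \<eta>_def \<xi>_def real_sqrt_mult real_sqrt_power)
  have dens: "\<exists>m\<in>int_vectors. \<exists>w\<in>E_u S. \<exists>b\<in>W. t = m + w + b \<and> Cu * \<rho> ^ n * norm w \<le> \<eta> n \<and> norm b \<le> \<zeta> ^ n / K1" for t n
  proof -
    have "\<zeta> ^ n \<le> 1" using \<zeta>0 \<zeta>1 by (intro power_le_one) auto
    then have "0 < \<zeta> ^ n / K1" "\<zeta> ^ n / K1 \<le> 1" using K1(1) \<zeta>0 by simp_all
    then obtain m w b where mwb: "m \<in> int_vectors" "w \<in> E_u S" "b \<in> W" "t = m + w + b"
      "norm w \<le> Cd / (\<zeta> ^ n / K1) ^ d" "norm b \<le> \<zeta> ^ n / K1" using Cd(2) by blast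
    have "Cu * \<rho> ^ n * norm w \<le> Cu * \<rho>\<^sub>u ^ n * (Cd / (\<zeta> ^ n / K1) ^ d)"
      using mwb(5) Cu \<rho> \<rho>\<rho>\<^sub>u by (intro mult_mono power_mono) auto
    also have "\<dots> = \<eta> n"
    proof -
      have "(\<zeta> ^ n) ^ d = (\<zeta> ^ d) ^ n" by (simp add: power_mult[symmetric] mult.commute)
      then show ?thesis by (simp add: \<eta>_def q_def C1_def power_divide)
    qed
    finally show ?thesis using mwb by blast
  qed
  \<comment> \<open>\<open>N\<close> is taken so large that the gap between \<rho> and
    \<open>\<rho>\<^sub>u\<close> outweighs the diameter of the atoms, the contraction constant and
    the change of norm.\<close>
  have "(\<lambda>n. (K * Cu * real CARD('n)) * (\<rho> / \<rho>\<^sub>u) ^ n) \<longlonglongrightarrow> (K * Cu * real CARD('n)) * 0"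
    using \<rho> \<rho>\<rho>\<^sub>u \<rho>\<^sub>u by (intro tendsto_mult_left LIMSEQ_power_zero) auto
  then have "eventually (\<lambda>n. (K * Cu * real CARD('n)) * (\<rho> / \<rho>\<^sub>u) ^ n < 1) sequentially"
    by (intro order_tendstoD(2)) auto
  then obtain N where N: "\<And>n. n \<ge> N \<Longrightarrow> (K * Cu * real CARD('n)) * (\<rho> / \<rho>\<^sub>u) ^ n < 1"
    by (auto simp: eventually_sequentially)
  have N': "K * (Cu * \<rho> ^ n * real CARD('n)) \<le> \<rho>\<^sub>u ^ n" if "n \<ge> N" for n
  proof -
    have "K * (Cu * \<rho> ^ n * real CARD('n)) = (K * Cu * real CARD('n)) * (\<rho> / \<rho>\<^sub>u) ^ n * \<rho>\<^sub>u ^ n"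
      using \<rho>\<^sub>u by (simp add: power_divide)
    also have "\<dots> \<le> 1 * \<rho>\<^sub>u ^ n" using N[OF that] \<rho>\<^sub>u by (intro mult_right_mono) auto
    finally show ?thesis by simp
  qed
  let ?E = "\<lambda>k. real_cond_exp torus_measure (pullback_algebra T F0 k)"
  have forward: "Linf_norm torus_measure
      (\<lambda>x. ?E (int n) \<phi> x - \<phi> x)
      \<le> ereal (omega_u S v \<phi> (\<rho>\<^sub>u ^ n))"
    if \<phi>: "\<phi> \<in> borel_measurable borel" "\<And>x. \<bar>\<phi> x\<bar> \<le> B" and n: "n \<ge> N" for \<phi> :: "'n torus \<Rightarrow> real" and n B
  proof -
    have "AE x in torus_measure. \<bar>?E (int n) \<phi> x - \<phi> x\<bar> \<le> omega_u S v \<phi> (\<rho>\<^sub>u ^ n)"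
      unfolding T_def
    proof (rule cond_exp_forward[OF \<phi>])
      fix x h assume h: "h \<in> E_u S" "norm h \<le> Cu * \<rho> ^ n * real CARD('n)"
      have "K * norm h \<le> \<rho>\<^sub>u ^ n" using mult_left_mono[OF h(2), of K] K N'[OF n] by linarith
      then show "\<bar>\<phi> x - \<phi> (x + abs_torus h)\<bar> \<le> omega_u S v \<phi> (\<rho>\<^sub>u ^ n)"
        using \<phi>(2) h(1) by (intro omega_u_upper ball_u)
    qed
    moreover have "(\<lambda>x. ?E (int n) \<phi> x) \<in> borel_measurable borel"
      using borel_measurable_cond_exp2[of torus_measure] by simp
    ultimately show ?thesis
      unfolding Linf_norm_def using \<phi>(1) by (intro esssup_I) auto
  qed
  have backward: "AE x in torus_measure. x \<in> good n (\<eta> n) \<longrightarrow>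
      ereal \<bar>?E (- int n) \<phi> x - integral\<^sup>L torus_measure \<phi>\<bar>
      \<le> ereal C * (Linf_norm torus_measure \<phi> * ereal (\<xi> ^ n) + ereal (omega_se S v \<phi> (\<zeta> ^ n)))"
    if \<phi>: "\<phi> \<in> borel_measurable borel" "\<And>x. \<bar>\<phi> x\<bar> \<le> B" for \<phi> :: "'n torus \<Rightarrow> real" and n B
  proof -
    obtain M where M: "Linf_norm torus_measure \<phi> = ereal M" "0 \<le> M" "AE x in torus_measure. \<bar>\<phi> x\<bar> \<le> M"
      using Linf_norm_bounded[OF \<phi>] by blast
    let ?\<omega> = "omega_se S v \<phi> (\<zeta> ^ n)"
    have osc: "\<bar>\<phi> x - \<phi> (x + abs_torus b)\<bar> \<le> ?\<omega>" if b: "b \<in> W" "norm b \<le> \<zeta> ^ n / K1" for x b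
    proof -
      have "K * norm b \<le> K1 * (\<zeta> ^ n / K1)" using b(2) K K1 by (intro mult_mono) auto
      then have "K * norm b \<le> \<zeta> ^ n" using K1(1) by simp
      from ball_se[OF b(1) this] show ?thesis using omega_se_upper[where \<phi> = \<phi> and B = B, OF \<phi>(2)] by blast
    qed
    \<comment> \<open>The zero vector is among the admissible translations.\<close>
    have \<omega>0: "0 \<le> ?\<omega>"
      using osc[of 0] subspace_0[OF subspaceW] K1(1) \<zeta>0 by (auto intro: order_trans[OF abs_ge_zero])
    have "AE x in torus_measure. x \<in> good n (\<eta> n) \<longrightarrow>
        \<bar>?E (- int n) \<phi> x - integral\<^sup>L torus_measure \<phi>\<bar> \<le> 2 * M * sqrt (\<eta> n) + ?\<omega>"
      unfolding T_def using cond_exp_backward[OF \<phi> M(3) dens osc] .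
    moreover have "2 * M * sqrt (\<eta> n) + ?\<omega> \<le> C * (M * \<xi> ^ n + ?\<omega>)"
    proof -
      have "(2 * sqrt C1) * (M * \<xi> ^ n) \<le> C * (M * \<xi> ^ n)" using C_ge M(2) \<xi> by (intro mult_right_mono) auto
      moreover have "1 * ?\<omega> \<le> C * ?\<omega>" using C_ge \<omega>0 by (intro mult_right_mono) auto
      ultimately show ?thesis unfolding \<eta>(2) by (simp add: algebra_simps)
    qed
    ultimately have "AE x in torus_measure. x \<in> good n (\<eta> n) \<longrightarrow>
        \<bar>?E (- int n) \<phi> x - integral\<^sup>L torus_measure \<phi>\<bar> \<le> C * (M * \<xi> ^ n + ?\<omega>)"
      by (auto elim!: eventually_mono)
    then show ?thesis unfolding M(1) by simp
  qed
  have good: "measure torus_measure (space torus_measure - good n (\<eta> n)) \<le> C * \<xi> ^ n" for n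
  proof -
    have "measure torus_measure (space torus_measure - good n (\<eta> n)) \<le> C2 * sqrt (\<eta> n)"
      using measure_good[OF \<eta>(1), of n n] by (simp add: C2_def Compl_eq_Diff_UNIV)
    also have "\<dots> = (C2 * sqrt C1) * \<xi> ^ n" by (simp add: \<eta>(2))
    also have "\<dots> \<le> C * \<xi> ^ n" using C_ge \<xi> by (intro mult_right_mono) auto
    finally show ?thesis .
  qed
  show ?thesis
  proof (rule exI[of _ C], intro conjI exI[of _ N] bexI[of _ \<xi>] exI[of _ "\<lambda>n. good n (\<eta> n)"] exI[of _ F0] allI impI)
    show "C > 0" by (rule C_ge)
    show "\<xi> \<in> {0<..<1}" using \<xi> by simp
    show "good n (\<eta> n) \<in> sets torus_measure" for n by (simp add: borel_good)
    show "subalgebra torus_measure F0" by (rule subalgebra_F0)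
    show "sets F0 \<subseteq> sets (pullback_algebra T F0 1)" unfolding T_def by (rule F0_increasing)
    fix \<phi> :: "'n torus \<Rightarrow> real" and n
    assume "\<phi> \<in> borel_measurable torus_measure \<and> bounded (range \<phi>) \<and> N \<le> n"
    then have \<phi>: "\<phi> \<in> borel_measurable borel" and bd: "bounded (range \<phi>)" and n: "N \<le> n" by simp_all
    obtain B where B: "\<And>x. \<bar>\<phi> x\<bar> \<le> B" using bd by (auto simp: bounded_iff)
    show "Linf_norm torus_measure
          (\<lambda>x. ?E (int n) \<phi> x - \<phi> x)
          \<le> ereal (omega_u S v \<phi> (\<rho>\<^sub>u ^ n))" by (rule forward[OF \<phi> B n])
    show "AE x in torus_measure. x \<in> good n (\<eta> n) \<longrightarrow>
      ereal \<bar>?E (- int n) \<phi> x - integral\<^sup>L torus_measure \<phi>\<bar>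
      \<le> ereal C * (Linf_norm torus_measure \<phi> * ereal (\<xi> ^ n) + ereal (omega_se S v \<phi> (\<zeta> ^ n)))"
      by (rule backward[OF \<phi> B])
    show "measure torus_measure (space torus_measure - good n (\<eta> n)) \<le> C * \<xi> ^ n" by (rule good)
  qed
qed

end
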